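(* In the setting described in the context, let $K\ge0$. If $V$ is fully $K$-convex, then $\tilde\Gamma_2\ge K\tilde\Gamma$, i.e. $\tilde\Gamma_2(a)\ge K\tilde\Gamma(a)$ in $L^1(\omega^e)$ for every $a\in D((-\mathcal L_V)^{3/2})$. If $V$ is partially $K$-convex, then $\Gamma_2\ge K\Gamma$, i.e. $\Gamma_2(a)\ge K\Gamma(a)$ in $L^1(\omega)$ for every $a\in D((-\mathcal L_V)^{3/2})$.
   Context: Polynomials. Let $m\ge1$, $\mathcal P=\mathbb C\langle\mathcal X^1,\dots,\mathcal X^m\rangle$ (noncommutative polynomials in self-adjoint indeterminates), $V=V^*\in\mathcal P$. For a word $w$ in $\{1,\dots,m\}$ write $\mathcal X^w$ for the ordered monomial. $\partial_i\mathcal X^w=\sum_{w=w_1iw_2}\mathcal X^{w_1}\otimes\mathcal X^{w_2}$ (free difference quotient), $D_i\mathcal X^w=\sum_{w=w_1iw_2}\mathcal X^{w_2}\mathcal X^{w_1}$ (cyclic derivative), $(a\otimes b)\# c=acb$. Dynamics. $(\hat{\mathcal M},\hat\rho)$ is a von Neumann algebra with a faithful tracial state, containing an $m$-dimensional semicircular Brownian motion $(X_t)_{t\ge0}$ (variance $t$), and a self-adjoint tuple $Y_0$ freely independent of $(X_t)_{t\ge0}$ with law $\omega$, such that $dY_t=-DV(Y_t)\,dt+\sqrt2\,dX_t$ has a global adapted solution. $\mathcal M=W^*(Y_0)$; $\mathcal P$ is identified with its image in $\mathcal M$ under evaluation at $Y_0$, and $\omega$ also denotes $\hat\rho|_{\mathcal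 M}$. $P_ta=\mathbb E_0[a(Y_t)]$ for $a\in\mathcal P$, with $\mathbb E_0:\hat{\mathcal M}\to\mathcal M$ the $\hat\rho$-preserving conditional expectation. Invariance is assumed: $\hat\rho(a(Y_t))=\omega(a)$ for all $a\in\mathcal P,t\ge0$. $(P_t)$ extends to a unital completely positive contraction semigroup on $L^p(\omega)$, $1\le p\le\infty$ ($L^\infty(\omega)=\mathcal M$), strongly continuous for $p<\infty$. On $\mathcal P$ its generator is $\mathcal L_Va=-\sum_i(\partial_ia)\#D_iV+2\Delta_\omega a$, where $\Delta_\omega a=\sum_i\bar\eta\big((\partial_i\otimes\mathrm{Id})\partial_ia\big)$, $\bar\eta(a\otimes b\otimes c)=\omega(b)ac$. Standing assumptions. $P_t$ is symmetric on $L^2(\omega)$; $\mathcal L_V$ denotes its non-positive self-adjoint generator on $L^2(\omega)$ and $(\mathcal L_V)_1$ its generator on $L^1(\omega)$; and $\mathcal P$ is an operator core for $D((-\mathcal L_V)^{3/2})$. Enveloping algebra and gradient. $\mathcal P^e=\mathcal P^{op}\otimes\mathcal P$ with product $(a\otimes b)\cdot(c\otimes d)=ca\otimes bd$ (products on the right taken in $\mathcal P$) and $(a\otimes b)^*=a^*\otimes b^*$; $\mathcal M^e=\mathcal M^{op}\,\overline\otimes\,\mathcal M$, $\omega^e=\omega^{op}\otimes\omega$, $P_t^e=P_t^{op}\otimes P_t$, $\mathcal L_V^e=\mathcal L_V^{op}\otimes\mathrm{Id}+\mathrm{Id}\otimes\mathcal L_V$, where $A^{op}(a^{op})=(Aa)^{op}$.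 $\nabla_ia$ is $\partial_ia$ viewed in $\mathcal P^e$, $\nabla=(\nabla_i)_i$; for $\xi,\zeta\in(\mathcal P^e)^m$, $\xi^*\cdot\zeta=\sum_i\xi_i^*\cdot\zeta_i$. $\overline\nabla$ is the closure of $\nabla:\mathcal P\to L^2(\omega^e)^m$ and $D(\overline\nabla)=D((-\mathcal L_V)^{1/2})$. Carré du champ. For $f,g\in\mathcal P$: $\tilde\Gamma(f,g)=(\nabla f)^*\cdot\nabla g\in\mathcal P^e$; $\Gamma(f,g)=\frac12(\mathcal L_V(f^*g)-f^*\mathcal L_Vg-(\mathcal L_Vf)^*g)=(\omega^{op}\otimes\mathrm{Id})\tilde\Gamma(f,g)$; $\Gamma_2(f,g)=\frac12(\mathcal L_V\Gamma(f,g)-\Gamma(f,\mathcal L_Vg)-\Gamma(\mathcal L_Vf,g))$; $\tilde\Gamma_2(f,g)=\frac12(\mathcal L_V^e\tilde\Gamma(f,g)-\tilde\Gamma(f,\mathcal L_Vg)-\tilde\Gamma(\mathcal L_Vf,g))$. Write $\Gamma(f)=\Gamma(f,f)$ etc. $\Gamma,\tilde\Gamma$ extend continuously (graph norm) to $D(\overline\nabla)$ with values in $L^1(\omega)$, $L^1(\omega^e)$, and $\Gamma_2,\tilde\Gamma_2$ extend continuously to $D((-\mathcal L_V)^{3/2})$ with its graph norm, with values in $L^1(\omega)$, $L^1(\omega^e)$ (the generators applied to $\Gamma$, $\tilde\Gamma$ being read as $L^1$-generators). The order on $L^1$ is that of its positive cone: $a\ge0$ iff the trace of $ab$ is $\ge0$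 for every positive bounded $b$. Convexity. $\vec T_V$ acts on $(\mathcal P^e)^m$ by $(\vec T_V\xi)_i=\sum_j(\nabla_iD_jV)\cdot\xi_j$. For $K\ge0$, $V$ is fully $K$-convex if for every $\xi\in(\mathcal P^e)^m$ the element $Q(\xi)=\tfrac12[\xi^*\cdot(\vec T_V\xi)+(\vec T_V\xi)^*\cdot\xi]-K\,\xi^*\cdot\xi$ is positive in $\mathcal M^e$; $V$ is partially $K$-convex if $(\omega^{op}\otimes\mathrm{Id})(Q(\xi))$ is positive in $\mathcal M$ for every $\xi\in(\mathcal P^e)^m$. *)

theory Defs
  imports "HOL-Analysis.Analysis" "HOL-Library.Poly_Mapping" "HOL-Library.Function_Algebras"
    "HOL-Library.Complex_Order"
begin

section \<open>Complex Hilbert spaces and bounded operators\<close>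

text \<open>The inner product is antilinear in the first and linear in the second variable; its real part
  is the real inner product, so norm and topology are those of the real Hilbert space.\<close>

class chilbert = real_inner + complete_space +
  fixes scaleC :: "complex \<Rightarrow> 'a \<Rightarrow> 'a" (infixr \<open>*\<^sub>C\<close> 75)
    and cinner :: "'a \<Rightarrow> 'a \<Rightarrow> complex"
  assumes scaleC_add_right: "c *\<^sub>C (x + y) = c *\<^sub>C x + c *\<^sub>C y"
    and scaleC_add_left: "(c + d) *\<^sub>C x = c *\<^sub>C x + d *\<^sub>C x"
    and scaleC_scaleC: "c *\<^sub>C (d *\<^sub>C x) = (c * d) *\<^sub>C x"
    and scaleC_of_real: "complex_of_real r *\<^sub>C x = r *\<^sub>R x"
    and cinner_commute: "cinner x y = cnj (cinner y x)"
    and cinner_add_right: "cinner x (y + z) = cinner x y + cinner x z"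
    and cinner_scaleC_right: "cinner x (c *\<^sub>C y) = c * cinner x y"
    and inner_eq_Re_cinner: "inner x y = Re (cinner x y)"

text \<open>The library type of bounded real-linear maps carries the operator norm; \<open>bop\<close> singles out
  the complex-linear ones, i.e. \<open>B(H)\<close>.\<close>

type_synonym 'h oper = "'h \<Rightarrow>\<^sub>L 'h"

definition bop :: "'h::chilbert oper set" where
  "bop = {A :: 'h oper. \<forall>c x. blinfun_apply A (c *\<^sub>C x) = c *\<^sub>C blinfun_apply A x}"

definition scale_op :: "complex \<Rightarrow> 'h::chilbert oper \<Rightarrow> 'h oper" where
  "scale_op c A = Blinfun (\<lambda>x. c *\<^sub>C A x)"

definition adj :: "'h::chilbert oper \<Rightarrow> 'h oper" where
  "adj A = (THE B :: 'h oper. \<forall>x y. cinner (blinfun_apply B x) y = cinner x (A y))"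

definition pos_op :: "'h::chilbert oper \<Rightarrow> bool" where
  "pos_op A \<longleftrightarrow> (\<forall>x. 0 \<le> cinner x (A x))"

definition commutant :: "'h::chilbert oper set \<Rightarrow> 'h oper set" where
  "commutant S = {B \<in> bop. \<forall>A\<in>S. A o\<^sub>L B = B o\<^sub>L A}"

definition von_neumann_algebra :: "'h::chilbert oper set \<Rightarrow> bool" where
  "von_neumann_algebra N \<longleftrightarrow> N \<subseteq> bop \<and> adj ` N \<subseteq> N \<and> commutant (commutant N) = N"

definition Wstar :: "'h::chilbert oper set \<Rightarrow> 'h oper set" where
  "Wstar S = commutant (commutant (S \<union> adj ` S))"

definition clinear_functional_on :: "'h::chilbert oper set \<Rightarrow> ('h oper \<Rightarrow> complex) \<Rightarrow> bool" where
  "clinear_functional_on N \<phi> \<longleftrightarrow>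
     (\<forall>A\<in>N. \<forall>B\<in>N. \<phi> (A + B) = \<phi> A + \<phi> B) \<and> (\<forall>c. \<forall>A\<in>N. \<phi> (scale_op c A) = c * \<phi> A)"

text \<open>Normality is ultraweak continuity, i.e. being given by two square-summable sequences.\<close>

definition normal_functional :: "'h::chilbert oper set \<Rightarrow> ('h oper \<Rightarrow> complex) \<Rightarrow> bool" where
  "normal_functional N \<phi> \<longleftrightarrow>
     (\<exists>x y. summable (\<lambda>n::nat. (norm (x n))\<^sup>2) \<and> summable (\<lambda>n. (norm (y n))\<^sup>2) \<and>
            (\<forall>A\<in>N. (\<lambda>n. cinner (x n) (blinfun_apply A (y n))) sums \<phi> A))"

definition faithful_normal_tracial_state :: "'h::chilbert oper set \<Rightarrow> ('h oper \<Rightarrow> complex) \<Rightarrow> bool" where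
  "faithful_normal_tracial_state N \<tau> \<longleftrightarrow>
     clinear_functional_on N \<tau> \<and> normal_functional N \<tau> \<and> \<tau> id_blinfun = 1 \<and>
     (\<forall>A\<in>N. pos_op A \<longrightarrow> 0 \<le> \<tau> A) \<and>
     (\<forall>A\<in>N. pos_op A \<and> \<tau> A = 0 \<longrightarrow> A = 0) \<and>
     (\<forall>A\<in>N. \<forall>B\<in>N. \<tau> (A o\<^sub>L B) = \<tau> (B o\<^sub>L A))"

definition conditional_expectation ::
  "'h::chilbert oper set \<Rightarrow> ('h oper \<Rightarrow> complex) \<Rightarrow> 'h oper set \<Rightarrow> ('h oper \<Rightarrow> 'h oper) \<Rightarrow> bool" where
  "conditional_expectation N \<tau> M E \<longleftrightarrow>
     (\<forall>A\<in>N. E A \<in> M) \<and>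
     (\<forall>A\<in>N. \<forall>B\<in>N. E (A + B) = E A + E B) \<and>
     (\<forall>c. \<forall>A\<in>N. E (scale_op c A) = scale_op c (E A)) \<and>
     (\<forall>A\<in>N. pos_op A \<longrightarrow> pos_op (E A)) \<and>
     (\<forall>B\<in>M. E B = B) \<and>
     (\<forall>A\<in>N. \<forall>B\<in>M. \<forall>C\<in>M. E (B o\<^sub>L A o\<^sub>L C) = B o\<^sub>L E A o\<^sub>L C) \<and>
     (\<forall>A\<in>N. \<tau> (E A) = \<tau> A)"


section \<open>Free probability\<close>

text \<open>A word whose neighbouring letters come from different algebras and whose letters are all
  centred has vanishing expectation.\<close>

definition freely_independent ::
  "('h::chilbert oper \<Rightarrow> complex) \<Rightarrow> 'i set \<Rightarrow> ('i \<Rightarrow> 'h oper set) \<Rightarrow> bool" where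
  "freely_independent \<tau> I \<A> \<longleftrightarrow>
     (\<forall>ps :: ('i \<times> 'h oper) list.
        ps \<noteq> [] \<and> distinct_adj (map fst ps) \<and>
        (\<forall>(i, A) \<in> set ps. i \<in> I \<and> A \<in> \<A> i \<and> \<tau> A = 0)
        \<longrightarrow> \<tau> (foldr (o\<^sub>L) (map snd ps) id_blinfun) = 0)"

definition freely_independent2 ::
  "('h::chilbert oper \<Rightarrow> complex) \<Rightarrow> 'h oper set \<Rightarrow> 'h oper set \<Rightarrow> bool" where
  "freely_independent2 \<tau> \<A> \<B> \<longleftrightarrow> freely_independent \<tau> UNIV (\<lambda>b::bool. if b then \<A> else \<B>)"

definition semicircular :: "('h::chilbert oper \<Rightarrow> complex) \<Rightarrow> real \<Rightarrow> 'h oper \<Rightarrow> bool" where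
  "semicircular \<tau> v A \<longleftrightarrow>
     (\<forall>n. \<tau> (((\<lambda>B. A o\<^sub>L B) ^^ n) id_blinfun) =
          complex_of_real (1 / (2 * pi * v) *
            integral {- 2 * sqrt v .. 2 * sqrt v} (\<lambda>x. x ^ n * sqrt (4 * v - x\<^sup>2))))"

definition semicircular_brownian_motion ::
  "'h::chilbert oper set \<Rightarrow> ('h oper \<Rightarrow> complex) \<Rightarrow> (real \<Rightarrow> 'm \<Rightarrow> 'h oper) \<Rightarrow> bool" where
  "semicircular_brownian_motion N \<tau> X \<longleftrightarrow>
     (\<forall>t\<ge>0. \<forall>i. X t i \<in> N \<and> adj (X t i) = X t i) \<and>
     (\<forall>i. X 0 i = 0) \<and>
     (\<forall>i s t. 0 \<le> s \<and> s < t \<longrightarrow>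
        semicircular \<tau> (t - s) (X t i - X s i) \<and>
        freely_independent2 \<tau> (Wstar {X u i | u. 0 \<le> u \<and> u \<le> s}) (Wstar {X t i - X s i})) \<and>
     freely_independent \<tau> UNIV (\<lambda>i. Wstar {X t i | t. 0 \<le> t})"


section \<open>Noncommutative polynomials and the enveloping algebra\<close>

text \<open>Words form a monoid under concatenation, so the convolution product on finitely supported
  functions on words is the product of the free algebra.\<close>

instantiation list :: (type) monoid_add
begin
definition zero_list :: "'a list" where "zero_list = []"
definition plus_list :: "'a list \<Rightarrow> 'a list \<Rightarrow> 'a list" where "plus_list u v = u @ v"
instance by standard (simp_all add: zero_list_def plus_list_def)
end

type_synonym 'm ncpoly = "'m list \<Rightarrow>\<^sub>0 complex"

text \<open>\<open>BiWord u v\<close> stands for the basis element \<open>X^u \<otimes> X^v\<close> of the algebraic tensor square; the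
  first leg is multiplied in the opposite order, so the convolution product below is
  \<open>(a \<otimes> b) \<cdot> (c \<otimes> d) = ca \<otimes> bd\<close>.\<close>

datatype 'm biword = BiWord "'m list" "'m list"

instantiation biword :: (type) monoid_add
begin
definition zero_biword :: "'a biword" where "zero_biword = BiWord [] []"
fun plus_biword :: "'a biword \<Rightarrow> 'a biword \<Rightarrow> 'a biword" where
  "plus_biword (BiWord u v) (BiWord u' v') = BiWord (u' @ u) (v @ v')"
instance
proof
  fix a b c :: "'a biword"
  show "a + b + c = a + (b + c)" by (cases a; cases b; cases c) simp
  show "0 + a = a" by (cases a) (simp add: zero_biword_def)
  show "a + 0 = a" by (cases a) (simp add: zero_biword_def)
qed
end

type_synonym 'm envpoly = "'m biword \<Rightarrow>\<^sub>0 complex"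

definition pscale :: "complex \<Rightarrow> ('a \<Rightarrow>\<^sub>0 complex) \<Rightarrow> ('a \<Rightarrow>\<^sub>0 complex)" where
  "pscale c p = Poly_Mapping.map ((*) c) p"

definition basis_elt :: "'a \<Rightarrow> ('a \<Rightarrow>\<^sub>0 complex)" where
  "basis_elt w = Poly_Mapping.single w 1"

definition lin_ext :: "('a \<Rightarrow> ('b \<Rightarrow>\<^sub>0 complex)) \<Rightarrow> ('a \<Rightarrow>\<^sub>0 complex) \<Rightarrow> ('b \<Rightarrow>\<^sub>0 complex)" where
  "lin_ext g p = (\<Sum>w\<in>Poly_Mapping.keys p. pscale (Poly_Mapping.lookup p w) (g w))"

definition antilin_ext :: "('a \<Rightarrow> ('b \<Rightarrow>\<^sub>0 complex)) \<Rightarrow> ('a \<Rightarrow>\<^sub>0 complex) \<Rightarrow> ('b \<Rightarrow>\<^sub>0 complex)" where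
  "antilin_ext g p = (\<Sum>w\<in>Poly_Mapping.keys p. pscale (cnj (Poly_Mapping.lookup p w)) (g w))"

definition pstar :: "'m ncpoly \<Rightarrow> 'm ncpoly" where
  "pstar = antilin_ext (\<lambda>w. basis_elt (rev w))"

definition estar :: "'m envpoly \<Rightarrow> 'm envpoly" where
  "estar = antilin_ext (\<lambda>z. case z of BiWord u v \<Rightarrow> basis_elt (BiWord (rev u) (rev v)))"

definition tensor :: "'m ncpoly \<Rightarrow> 'm ncpoly \<Rightarrow> 'm envpoly" where
  "tensor a b = lin_ext (\<lambda>u. lin_ext (\<lambda>v. basis_elt (BiWord u v)) b) a"

text \<open>The free difference quotient; \<open>k\<close> runs over the positions of the letter \<open>i\<close> in the word.\<close>

definition fdq :: "'m \<Rightarrow> 'm ncpoly \<Rightarrow> 'm envpoly" where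
  "fdq i = lin_ext (\<lambda>w. \<Sum>k | k < length w \<and> w ! k = i. basis_elt (BiWord (take k w) (drop (Suc k) w)))"

definition cyclic_deriv :: "'m \<Rightarrow> 'm ncpoly \<Rightarrow> 'm ncpoly" where
  "cyclic_deriv i = lin_ext (\<lambda>w. \<Sum>k | k < length w \<and> w ! k = i. basis_elt (drop (Suc k) w @ take k w))"

definition sharp :: "'m envpoly \<Rightarrow> 'm ncpoly \<Rightarrow> 'm ncpoly" where
  "sharp z c = lin_ext (\<lambda>x. case x of BiWord u v \<Rightarrow> basis_elt u * c * basis_elt v) z"

text \<open>\<open>\<partial>\<^sub>i \<otimes> Id\<close>, with values in the threefold tensor power, whose basis is the set of triples
  of words.\<close>

definition fdq_Id :: "'m \<Rightarrow> 'm envpoly \<Rightarrow> ('m list \<times> 'm list \<times> 'm list \<Rightarrow>\<^sub>0 complex)" where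
  "fdq_Id i = lin_ext (\<lambda>x. case x of BiWord w v \<Rightarrow>
      \<Sum>k | k < length w \<and> w ! k = i. basis_elt (take k w, drop (Suc k) w, v))"

definition eta_bar :: "('m ncpoly \<Rightarrow> complex) \<Rightarrow> ('m list \<times> 'm list \<times> 'm list \<Rightarrow>\<^sub>0 complex) \<Rightarrow> 'm ncpoly" where
  "eta_bar \<omega> = lin_ext (\<lambda>(u, v, w). pscale (\<omega> (basis_elt v)) (basis_elt u * basis_elt w))"

definition Laplacian :: "('m::finite ncpoly \<Rightarrow> complex) \<Rightarrow> 'm ncpoly \<Rightarrow> 'm ncpoly" where
  "Laplacian \<omega> a = (\<Sum>i\<in>UNIV. eta_bar \<omega> (fdq_Id i (fdq i a)))"

definition gen_poly :: "('m::finite ncpoly \<Rightarrow> complex) \<Rightarrow> 'm ncpoly \<Rightarrow> 'm ncpoly \<Rightarrow> 'm ncpoly" where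
  "gen_poly \<omega> V a = - (\<Sum>i\<in>UNIV. sharp (fdq i a) (cyclic_deriv i V)) + pscale 2 (Laplacian \<omega> a)"

definition gen_env :: "('m::finite ncpoly \<Rightarrow> complex) \<Rightarrow> 'm ncpoly \<Rightarrow> 'm envpoly \<Rightarrow> 'm envpoly" where
  "gen_env \<omega> V = lin_ext (\<lambda>x. case x of BiWord u v \<Rightarrow>
      tensor (gen_poly \<omega> V (basis_elt u)) (basis_elt v) + tensor (basis_elt u) (gen_poly \<omega> V (basis_elt v)))"

definition slice :: "('m ncpoly \<Rightarrow> complex) \<Rightarrow> 'm envpoly \<Rightarrow> 'm ncpoly" where
  "slice \<omega> = lin_ext (\<lambda>x. case x of BiWord u v \<Rightarrow> pscale (\<omega> (basis_elt u)) (basis_elt v))"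

definition edot :: "('m::finite \<Rightarrow> 'm envpoly) \<Rightarrow> ('m \<Rightarrow> 'm envpoly) \<Rightarrow> 'm envpoly" where
  "edot \<xi> \<zeta> = (\<Sum>i\<in>UNIV. estar (\<xi> i) * \<zeta> i)"

definition grad :: "'m ncpoly \<Rightarrow> 'm \<Rightarrow> 'm envpoly" where
  "grad a i = fdq i a"

definition Gamma_t_poly :: "'m::finite ncpoly \<Rightarrow> 'm ncpoly \<Rightarrow> 'm envpoly" where
  "Gamma_t_poly f g = edot (grad f) (grad g)"

definition Gamma_poly :: "('m::finite ncpoly \<Rightarrow> complex) \<Rightarrow> 'm ncpoly \<Rightarrow> 'm ncpoly \<Rightarrow> 'm ncpoly \<Rightarrow> 'm ncpoly" where
  "Gamma_poly \<omega> V f g = pscale (1/2)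
     (gen_poly \<omega> V (pstar f * g) - pstar f * gen_poly \<omega> V g - pstar (gen_poly \<omega> V f) * g)"

definition Gamma2_poly :: "('m::finite ncpoly \<Rightarrow> complex) \<Rightarrow> 'm ncpoly \<Rightarrow> 'm ncpoly \<Rightarrow> 'm ncpoly \<Rightarrow> 'm ncpoly" where
  "Gamma2_poly \<omega> V f g = pscale (1/2)
     (gen_poly \<omega> V (Gamma_poly \<omega> V f g)
      - Gamma_poly \<omega> V f (gen_poly \<omega> V g) - Gamma_poly \<omega> V (gen_poly \<omega> V f) g)"

definition Gamma2_t_poly :: "('m::finite ncpoly \<Rightarrow> complex) \<Rightarrow> 'm ncpoly \<Rightarrow> 'm ncpoly \<Rightarrow> 'm ncpoly \<Rightarrow> 'm envpoly" where
  "Gamma2_t_poly \<omega> V f g = pscale (1/2)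
     (gen_env \<omega> V (Gamma_t_poly f g)
      - Gamma_t_poly f (gen_poly \<omega> V g) - Gamma_t_poly (gen_poly \<omega> V f) g)"

definition T_vec :: "'m::finite ncpoly \<Rightarrow> ('m \<Rightarrow> 'm envpoly) \<Rightarrow> ('m \<Rightarrow> 'm envpoly)" where
  "T_vec V \<xi> i = (\<Sum>j\<in>UNIV. grad (cyclic_deriv j V) i * \<xi> j)"

definition Q_form :: "'m::finite ncpoly \<Rightarrow> real \<Rightarrow> ('m \<Rightarrow> 'm envpoly) \<Rightarrow> 'm envpoly" where
  "Q_form V K \<xi> = pscale (1/2) (edot \<xi> (T_vec V \<xi>) + edot (T_vec V \<xi>) \<xi>)
     - pscale (complex_of_real K) (edot \<xi> \<xi>)"


section \<open>Evaluation\<close>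

definition word_op :: "('m \<Rightarrow> 'h::chilbert oper) \<Rightarrow> 'm list \<Rightarrow> 'h oper" where
  "word_op y w = foldr (o\<^sub>L) (map y w) id_blinfun"

definition eval_poly :: "('m \<Rightarrow> 'h::chilbert oper) \<Rightarrow> 'm ncpoly \<Rightarrow> 'h oper" where
  "eval_poly y p = (\<Sum>w\<in>Poly_Mapping.keys p. scale_op (Poly_Mapping.lookup p w) (word_op y w))"

text \<open>\<open>opt A B\<close> is meant to be the operator \<open>A\<^sup>o\<^sup>p \<otimes> B\<close>; see \<open>opposite_tensor\<close> below.\<close>

definition eval_env ::
  "('h::chilbert oper \<Rightarrow> 'h oper \<Rightarrow> 'k::chilbert oper) \<Rightarrow> ('m \<Rightarrow> 'h oper) \<Rightarrow> 'm envpoly \<Rightarrow> 'k oper" where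
  "eval_env opt y z = (\<Sum>x\<in>Poly_Mapping.keys z. scale_op (Poly_Mapping.lookup z x)
      (case x of BiWord u v \<Rightarrow> opt (word_op y u) (word_op y v)))"

definition law :: "('h::chilbert oper \<Rightarrow> complex) \<Rightarrow> ('m \<Rightarrow> 'h oper) \<Rightarrow> 'm ncpoly \<Rightarrow> complex" where
  "law \<tau> y p = \<tau> (eval_poly y p)"

definition fully_convex ::
  "('h::chilbert oper \<Rightarrow> 'h oper \<Rightarrow> 'k::chilbert oper) \<Rightarrow> ('m::finite \<Rightarrow> 'h oper) \<Rightarrow> 'm ncpoly \<Rightarrow> real \<Rightarrow> bool" where
  "fully_convex opt y V K \<longleftrightarrow> (\<forall>\<xi>. pos_op (eval_env opt y (Q_form V K \<xi>)))"

definition partially_convex ::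
  "('h::chilbert oper \<Rightarrow> complex) \<Rightarrow> ('m::finite \<Rightarrow> 'h oper) \<Rightarrow> 'm ncpoly \<Rightarrow> real \<Rightarrow> bool" where
  "partially_convex \<tau> y V K \<longleftrightarrow> (\<forall>\<xi>. pos_op (eval_poly y (slice (law \<tau> y) (Q_form V K \<xi>))))"


section \<open>The algebra \<open>M\<^sup>o\<^sup>p \<otimes> M\<close>\<close>

text \<open>\<open>M\<^sup>o\<^sup>p\<close> is represented on the conjugate Hilbert space of \<open>'h\<close>, the operator \<open>A\<^sup>o\<^sup>p\<close> acting on a
  conjugate vector by the adjoint of \<open>A\<close>. Accordingly \<open>tens\<close> exhibits \<open>'k\<close> as the Hilbert space
  tensor product of the conjugate of \<open>'h\<close> with \<open>'h\<close>: it is antilinear in its first argument,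
  and inner products in the first leg are conjugated.\<close>

definition opposite_tensor ::
  "('h::chilbert \<Rightarrow> 'h \<Rightarrow> 'k::chilbert) \<Rightarrow> ('h oper \<Rightarrow> 'h oper \<Rightarrow> 'k oper) \<Rightarrow> bool" where
  "opposite_tensor tens opt \<longleftrightarrow>
     (\<forall>x x' y. tens (x + x') y = tens x y + tens x' y) \<and>
     (\<forall>x y y'. tens x (y + y') = tens x y + tens x y') \<and>
     (\<forall>c x y. tens (c *\<^sub>C x) y = cnj c *\<^sub>C tens x y) \<and>
     (\<forall>c x y. tens x (c *\<^sub>C y) = c *\<^sub>C tens x y) \<and>
     (\<forall>x x' y y'. cinner (tens x y) (tens x' y') = cinner x' x * cinner y y') \<and>
     closure (span {tens x y | x y. True}) = UNIV \<and>
     (\<forall>A\<in>bop. \<forall>B\<in>bop. opt A B \<in> bop \<and> (\<forall>x y. opt A B (tens x y) = tens (adj A x) (B y)))"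

definition env_algebra ::
  "('h::chilbert oper \<Rightarrow> 'h oper \<Rightarrow> 'k::chilbert oper) \<Rightarrow> 'h oper set \<Rightarrow> 'k oper set" where
  "env_algebra opt M = Wstar {opt A B | A B. A \<in> M \<and> B \<in> M}"


section \<open>Noncommutative \<open>L\<^sup>p\<close> spaces, semigroups and generators\<close>

text \<open>\<open>L\<^sup>2\<close> is any Hilbert space completion of the algebra for \<open>\<langle>A, B\<rangle> = \<tau>(A\<^sup>* B)\<close>.\<close>

definition is_L2 ::
  "'h::chilbert oper set \<Rightarrow> ('h oper \<Rightarrow> complex) \<Rightarrow> ('h oper \<Rightarrow> 'l::chilbert) \<Rightarrow> bool" where
  "is_L2 N \<tau> \<Lambda> \<longleftrightarrow>
     (\<forall>A\<in>N. \<forall>B\<in>N. \<Lambda> (A + B) = \<Lambda> A + \<Lambda> B) \<and>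
     (\<forall>c. \<forall>A\<in>N. \<Lambda> (scale_op c A) = c *\<^sub>C \<Lambda> A) \<and>
     (\<forall>A\<in>N. \<forall>B\<in>N. cinner (\<Lambda> A) (\<Lambda> B) = \<tau> (adj A o\<^sub>L B)) \<and>
     closure (\<Lambda> ` N) = UNIV"

text \<open>\<open>L\<^sup>1\<close> is realised as the predual: a bounded \<open>A\<close> is the functional \<open>B \<mapsto> \<tau>(AB)\<close>, whose norm is
  \<open>\<tau>(\<bar>A\<bar>)\<close>, and \<open>L\<^sup>1\<close> is the closure of these functionals in the dual of the algebra. The value of
  an element of \<open>L\<^sup>1\<close> at \<open>B\<close> is thus the trace of its product with \<open>B\<close>. Functionals are set to 0
  outside the algebra.\<close>

definition L1_emb :: "'h::chilbert oper set \<Rightarrow> ('h oper \<Rightarrow> complex) \<Rightarrow> 'h oper \<Rightarrow> ('h oper \<Rightarrow> complex)" where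
  "L1_emb N \<tau> A = (\<lambda>B. if B \<in> N then \<tau> (A o\<^sub>L B) else 0)"

definition L1 :: "'h::chilbert oper set \<Rightarrow> ('h oper \<Rightarrow> complex) \<Rightarrow> ('h oper \<Rightarrow> complex) set" where
  "L1 N \<tau> = {\<phi>. clinear_functional_on N \<phi> \<and> (\<forall>B. B \<notin> N \<longrightarrow> \<phi> B = 0) \<and>
     (\<exists>A. (\<forall>n::nat. A n \<in> N) \<and>
          uniform_limit {B \<in> N. norm B \<le> 1} (\<lambda>n. L1_emb N \<tau> (A n)) \<phi> sequentially)}"

definition L1_norm :: "'h::chilbert oper set \<Rightarrow> ('h oper \<Rightarrow> complex) \<Rightarrow> real" where
  "L1_norm N \<phi> = (SUP B\<in>{B \<in> N. norm B \<le> 1}. cmod (\<phi> B))"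

definition fscale :: "complex \<Rightarrow> ('a \<Rightarrow> complex) \<Rightarrow> ('a \<Rightarrow> complex)" where
  "fscale c \<phi> = (\<lambda>B. c * \<phi> B)"

definition L1_le :: "'h::chilbert oper set \<Rightarrow> ('h oper \<Rightarrow> complex) \<Rightarrow> ('h oper \<Rightarrow> complex) \<Rightarrow> bool" where
  "L1_le N \<phi> \<psi> \<longleftrightarrow> (\<forall>B\<in>N. pos_op B \<longrightarrow> 0 \<le> (\<psi> - \<phi>) B)"

text \<open>Contraction semigroups and generators on a space \<open>S\<close> with scalar multiplication \<open>sc\<close> and
  norm \<open>nrm\<close>. Unbounded operators are represented by their graphs.\<close>

definition contraction_semigroup ::
  "'v::ab_group_add set \<Rightarrow> (complex \<Rightarrow> 'v \<Rightarrow> 'v) \<Rightarrow> ('v \<Rightarrow> real) \<Rightarrow> (real \<Rightarrow> 'v \<Rightarrow> 'v) \<Rightarrow> bool" where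
  "contraction_semigroup S sc nrm T \<longleftrightarrow>
     (\<forall>t\<ge>0. \<forall>x\<in>S. T t x \<in> S \<and> nrm (T t x) \<le> nrm x) \<and>
     (\<forall>t\<ge>0. \<forall>x\<in>S. \<forall>y\<in>S. T t (x + y) = T t x + T t y) \<and>
     (\<forall>t\<ge>0. \<forall>c. \<forall>x\<in>S. T t (sc c x) = sc c (T t x)) \<and>
     (\<forall>x\<in>S. T 0 x = x) \<and>
     (\<forall>s\<ge>0. \<forall>t\<ge>0. \<forall>x\<in>S. T (s + t) x = T s (T t x))"

definition strongly_continuous :: "'v::ab_group_add set \<Rightarrow> ('v \<Rightarrow> real) \<Rightarrow> (real \<Rightarrow> 'v \<Rightarrow> 'v) \<Rightarrow> bool" where
  "strongly_continuous S nrm T \<longleftrightarrow> (\<forall>x\<in>S. ((\<lambda>t. nrm (T t x - x)) \<longlongrightarrow> 0) (at_right 0))"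

definition generator ::
  "'v::ab_group_add set \<Rightarrow> (complex \<Rightarrow> 'v \<Rightarrow> 'v) \<Rightarrow> ('v \<Rightarrow> real) \<Rightarrow> (real \<Rightarrow> 'v \<Rightarrow> 'v) \<Rightarrow> ('v \<times> 'v) set" where
  "generator S sc nrm T =
     {(x, y). x \<in> S \<and> y \<in> S \<and>
        ((\<lambda>t. nrm (sc (complex_of_real (1 / t)) (T t x - x) - y)) \<longlongrightarrow> 0) (at_right 0)}"

abbreviation L2_generator :: "(real \<Rightarrow> 'l::chilbert \<Rightarrow> 'l) \<Rightarrow> ('l \<times> 'l) set" where
  "L2_generator T \<equiv> generator UNIV scaleC norm T"

abbreviation L1_generator :: "'h::chilbert oper set \<Rightarrow> ('h oper \<Rightarrow> complex) \<Rightarrow>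
    (real \<Rightarrow> ('h oper \<Rightarrow> complex) \<Rightarrow> ('h oper \<Rightarrow> complex)) \<Rightarrow>
    (('h oper \<Rightarrow> complex) \<times> ('h oper \<Rightarrow> complex)) set" where
  "L1_generator N \<tau> T \<equiv> generator (L1 N \<tau>) fscale (L1_norm N) T"

definition completely_positive_on :: "'h::chilbert oper set \<Rightarrow> ('h oper \<Rightarrow> 'h oper) \<Rightarrow> bool" where
  "completely_positive_on N \<Phi> \<longleftrightarrow>
     (\<forall>n A B. (\<forall>j<n::nat. A j \<in> N \<and> B j \<in> N) \<longrightarrow>
        pos_op (\<Sum>j<n. \<Sum>k<n. adj (B j) o\<^sub>L \<Phi> (adj (A j) o\<^sub>L A k) o\<^sub>L B k))"

definition adjoint_graph :: "('l::chilbert \<times> 'l) set \<Rightarrow> ('l \<times> 'l) set" where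
  "adjoint_graph S = {(x, y). \<forall>(a, b)\<in>S. cinner b x = cinner a y}"

definition nonneg_selfadjoint :: "('l::chilbert \<times> 'l) set \<Rightarrow> bool" where
  "nonneg_selfadjoint S \<longleftrightarrow>
     closure (Domain S) = UNIV \<and> S = adjoint_graph S \<and> (\<forall>(a, b)\<in>S. 0 \<le> cinner a b)"

text \<open>The square root of \<open>-L\<close>: the (unique) non-negative self-adjoint operator with square \<open>-L\<close>.\<close>

definition sqrt_of_minus :: "('l::chilbert \<times> 'l) set \<Rightarrow> ('l \<times> 'l) set \<Rightarrow> bool" where
  "sqrt_of_minus L S \<longleftrightarrow> nonneg_selfadjoint S \<and> S O S = {(a, - b) | a b. (a, b) \<in> L}"

abbreviation cube :: "('l \<times> 'l) set \<Rightarrow> ('l \<times> 'l) set" where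
  "cube S \<equiv> S O S O S"

text \<open>Graph-norm convergence in the domain of the operator with graph \<open>G\<close>.\<close>

definition graph_tendsto ::
  "('l::topological_space \<times> 'z::topological_space) set \<Rightarrow> (nat \<Rightarrow> 'l) \<Rightarrow> 'l \<Rightarrow> bool" where
  "graph_tendsto G f a \<longleftrightarrow>
     (\<exists>z z0. (\<forall>n. (f n, z n) \<in> G) \<and> (a, z0) \<in> G \<and> f \<longlonglongrightarrow> a \<and> z \<longlonglongrightarrow> z0)"

text \<open>\<open>F\<close> is the extension, continuous for the graph norm, of the \<open>L\<^sup>1\<close>-valued form \<open>F0\<close> given on
  polynomials; \<open>\<iota>\<close> maps a polynomial to its class in \<open>L\<^sup>2\<close>.\<close>

definition continuous_extension ::
  "('l::topological_space \<times> 'z::topological_space) set \<Rightarrow> ('p \<Rightarrow> 'l) \<Rightarrow>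
   'h::chilbert oper set \<Rightarrow> ('h oper \<Rightarrow> complex) \<Rightarrow>
   ('p \<Rightarrow> 'p \<Rightarrow> 'h oper) \<Rightarrow> ('l \<Rightarrow> 'l \<Rightarrow> ('h oper \<Rightarrow> complex)) \<Rightarrow> bool" where
  "continuous_extension G \<iota> N \<tau> F0 F \<longleftrightarrow>
     (\<forall>p q. F (\<iota> p) (\<iota> q) = L1_emb N \<tau> (F0 p q)) \<and>
     (\<forall>a\<in>Domain G. \<forall>b\<in>Domain G. F a b \<in> L1 N \<tau>) \<and>
     (\<forall>f g a b. graph_tendsto G f a \<and> graph_tendsto G g b \<longrightarrow>
        (\<lambda>n. L1_norm N (F (f n) (g n) - F a b)) \<longlonglongrightarrow> 0)"


section \<open>The setting\<close>

locale free_langevin =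
  fixes Mhat :: "'h::chilbert oper set"
    and \<rho> :: "'h oper \<Rightarrow> complex"
    and V :: "'m::finite ncpoly"
    and X Y :: "real \<Rightarrow> 'm \<Rightarrow> 'h oper"
    and E0 :: "'h oper \<Rightarrow> 'h oper"
  assumes Mhat: "von_neumann_algebra Mhat" "faithful_normal_tracial_state Mhat \<rho>"
    and V_selfadjoint: "pstar V = V"
    and brownian: "semicircular_brownian_motion Mhat \<rho> X"
    and Y_selfadjoint: "0 \<le> t \<Longrightarrow> Y t i \<in> Mhat \<and> adj (Y t i) = Y t i"
    and Y0_free: "freely_independent2 \<rho> (Wstar (range (Y 0))) (Wstar {X t i | t i. 0 \<le> t})"
    and Y_adapted: "0 \<le> t \<Longrightarrow> Y t i \<in> Wstar (range (Y 0) \<union> {X s j | s j. 0 \<le> s \<and> s \<le> t})"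
    and Y_continuous: "continuous_on {0..} (\<lambda>t. Y t i)"
    and Y_solution: "0 \<le> t \<Longrightarrow>
        ((\<lambda>s. eval_poly (Y s) (cyclic_deriv i V)) has_integral
           (Y 0 i + sqrt 2 *\<^sub>R X t i - Y t i)) {0..t}"
    and invariance: "0 \<le> t \<Longrightarrow> \<rho> (eval_poly (Y t) a) = law \<rho> (Y 0) a"
    and E0: "conditional_expectation Mhat \<rho> (Wstar (range (Y 0))) E0"
begin

abbreviation M :: "'h oper set" where "M \<equiv> Wstar (range (Y 0))"
abbreviation \<omega> :: "'m ncpoly \<Rightarrow> complex" where "\<omega> \<equiv> law \<rho> (Y 0)"
abbreviation ev :: "'m ncpoly \<Rightarrow> 'h oper" where "ev \<equiv> eval_poly (Y 0)"

end

text \<open>On \<open>M\<close> the state is the restriction of \<open>\<rho>\<close>. \<open>Tinf\<close>, \<open>T2\<close>, \<open>T1\<close> are the extensions of the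
  semigroup to \<open>M\<close>, \<open>L\<^sup>2(\<omega>)\<close>, \<open>L\<^sup>1(\<omega>)\<close>, and \<open>T1e\<close> is the product semigroup on \<open>L\<^sup>1(\<omega>\<^sup>e)\<close>; \<open>R\<close> is the
  square root of minus the \<open>L\<^sup>2\<close> generator.\<close>

locale free_langevin_semigroup = free_langevin Mhat \<rho> V X Y E0
  for Mhat :: "'h::chilbert oper set"
    and \<rho> :: "'h oper \<Rightarrow> complex"
    and V :: "'m::finite ncpoly"
    and X Y :: "real \<Rightarrow> 'm \<Rightarrow> 'h oper"
    and E0 :: "'h oper \<Rightarrow> 'h oper" +
  fixes tens :: "'h \<Rightarrow> 'h \<Rightarrow> 'k::chilbert"
    and opt :: "'h oper \<Rightarrow> 'h oper \<Rightarrow> 'k oper"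
    and \<omega>e :: "'k oper \<Rightarrow> complex"
    and \<Lambda> :: "'h oper \<Rightarrow> 'l::chilbert"
    and \<Lambda>e :: "'k oper \<Rightarrow> 'le::chilbert"
    and Tinf :: "real \<Rightarrow> 'h oper \<Rightarrow> 'h oper"
    and T2 :: "real \<Rightarrow> 'l \<Rightarrow> 'l"
    and T1 :: "real \<Rightarrow> ('h oper \<Rightarrow> complex) \<Rightarrow> ('h oper \<Rightarrow> complex)"
    and T1e :: "real \<Rightarrow> ('k oper \<Rightarrow> complex) \<Rightarrow> ('k oper \<Rightarrow> complex)"
    and R :: "('l \<times> 'l) set"
  assumes tensor: "opposite_tensor tens opt"
    and omega_e: "faithful_normal_tracial_state (env_algebra opt M) \<omega>e"
      "A \<in> M \<Longrightarrow> B \<in> M \<Longrightarrow> \<omega>e (opt A B) = \<rho> A * \<rho> B"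
    and L2_omega: "is_L2 M \<rho> \<Lambda>"
    and L2_omega_e: "is_L2 (env_algebra opt M) \<omega>e \<Lambda>e"
    and Tinf: "contraction_semigroup M scale_op norm Tinf"
      "0 \<le> t \<Longrightarrow> Tinf t (ev a) = E0 (eval_poly (Y t) a)"
      "0 \<le> t \<Longrightarrow> Tinf t id_blinfun = id_blinfun"
      "0 \<le> t \<Longrightarrow> completely_positive_on M (Tinf t)"
    and T2: "contraction_semigroup UNIV scaleC norm T2"
      "strongly_continuous UNIV norm T2"
      "0 \<le> t \<Longrightarrow> A \<in> M \<Longrightarrow> T2 t (\<Lambda> A) = \<Lambda> (Tinf t A)"
    and T1: "contraction_semigroup (L1 M \<rho>) fscale (L1_norm M) T1"
      "strongly_continuous (L1 M \<rho>) (L1_norm M) T1"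
      "0 \<le> t \<Longrightarrow> A \<in> M \<Longrightarrow> T1 t (L1_emb M \<rho> A) = L1_emb M \<rho> (Tinf t A)"
    and T1e: "contraction_semigroup (L1 (env_algebra opt M) \<omega>e) fscale (L1_norm (env_algebra opt M)) T1e"
      "strongly_continuous (L1 (env_algebra opt M) \<omega>e) (L1_norm (env_algebra opt M)) T1e"
      "0 \<le> t \<Longrightarrow> A \<in> M \<Longrightarrow> B \<in> M \<Longrightarrow>
         T1e t (L1_emb (env_algebra opt M) \<omega>e (opt A B))
         = L1_emb (env_algebra opt M) \<omega>e (opt (Tinf t A) (Tinf t B))"
    and generator_on_polynomials: "(\<Lambda> (ev a), \<Lambda> (ev (gen_poly \<omega> V a))) \<in> L2_generator T2"
    and symmetric: "0 \<le> t \<Longrightarrow> cinner (T2 t x) y = cinner x (T2 t y)"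
    and R_sqrt: "sqrt_of_minus (L2_generator T2) R"
    and core: "\<Lambda> (ev a) \<in> Domain (cube R)"
      "cube R \<subseteq> closure {(x, y) \<in> cube R. x \<in> range (\<lambda>a. \<Lambda> (ev a))}"
begin

abbreviation Me :: "'k oper set" where "Me \<equiv> env_algebra opt M"
abbreviation eve :: "'m envpoly \<Rightarrow> 'k oper" where "eve \<equiv> eval_env opt (Y 0)"
abbreviation \<iota> :: "'m ncpoly \<Rightarrow> 'l" where "\<iota> a \<equiv> \<Lambda> (ev a)"

text \<open>The graph of the closed gradient.\<close>

definition nabla_bar :: "('l \<times> ('le ^ 'm)) set" where
  "nabla_bar = closure (range (\<lambda>a. (\<iota> a, \<chi> i. \<Lambda>e (eve (grad a i)))))"

end

text \<open>\<open>\<Gamma>\<close>, \<open>\<Gamma>t\<close> (for \<open>\<Gamma>\<close> with a tilde), \<open>\<Gamma>2\<close>, \<open>\<Gamma>t2\<close> are the continuous extensions; the last two assumptions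
  say that \<open>\<Gamma>2\<close> and \<open>\<Gamma>t2\<close> are given on the whole domain by their defining formulas, with the
  generators on \<open>L\<^sup>1(\<omega>)\<close> and \<open>L\<^sup>1(\<omega>\<^sup>e)\<close>.\<close>

locale free_langevin_carre_du_champ =
  free_langevin_semigroup Mhat \<rho> V X Y E0 tens opt \<omega>e \<Lambda> \<Lambda>e Tinf T2 T1 T1e R
  for Mhat :: "'h::chilbert oper set"
    and \<rho> :: "'h oper \<Rightarrow> complex"
    and V :: "'m::finite ncpoly"
    and X Y :: "real \<Rightarrow> 'm \<Rightarrow> 'h oper"
    and E0 :: "'h oper \<Rightarrow> 'h oper"
    and tens :: "'h \<Rightarrow> 'h \<Rightarrow> 'k::chilbert"
    and opt :: "'h oper \<Rightarrow> 'h oper \<Rightarrow> 'k oper"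
    and \<omega>e :: "'k oper \<Rightarrow> complex"
    and \<Lambda> :: "'h oper \<Rightarrow> 'l::chilbert"
    and \<Lambda>e :: "'k oper \<Rightarrow> 'le::chilbert"
    and Tinf :: "real \<Rightarrow> 'h oper \<Rightarrow> 'h oper"
    and T2 :: "real \<Rightarrow> 'l \<Rightarrow> 'l"
    and T1 :: "real \<Rightarrow> ('h oper \<Rightarrow> complex) \<Rightarrow> ('h oper \<Rightarrow> complex)"
    and T1e :: "real \<Rightarrow> ('k oper \<Rightarrow> complex) \<Rightarrow> ('k oper \<Rightarrow> complex)"
    and R :: "('l \<times> 'l) set" +
  fixes \<Gamma> \<Gamma>2 :: "'l \<Rightarrow> 'l \<Rightarrow> ('h oper \<Rightarrow> complex)"
    and \<Gamma>t \<Gamma>t2 :: "'l \<Rightarrow> 'l \<Rightarrow> ('k oper \<Rightarrow> complex)"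
  assumes nabla_closable: "single_valued nabla_bar"
    and nabla_domain: "Domain nabla_bar = Domain R"
    and \<Gamma>_ext: "continuous_extension nabla_bar \<iota> M \<rho> (\<lambda>f g. ev (Gamma_poly \<omega> V f g)) \<Gamma>"
    and \<Gamma>t_ext: "continuous_extension nabla_bar \<iota> Me \<omega>e (\<lambda>f g. eve (Gamma_t_poly f g)) \<Gamma>t"
    and \<Gamma>2_ext: "continuous_extension (cube R) \<iota> M \<rho> (\<lambda>f g. ev (Gamma2_poly \<omega> V f g)) \<Gamma>2"
    and \<Gamma>t2_ext: "continuous_extension (cube R) \<iota> Me \<omega>e (\<lambda>f g. eve (Gamma2_t_poly \<omega> V f g)) \<Gamma>t2"
    and \<Gamma>2_formula: "f \<in> Domain (cube R) \<Longrightarrow> g \<in> Domain (cube R) \<Longrightarrow>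
        (f, Lf) \<in> L2_generator T2 \<Longrightarrow> (g, Lg) \<in> L2_generator T2 \<Longrightarrow>
        \<exists>h. (\<Gamma> f g, h) \<in> L1_generator M \<rho> T1 \<and> \<Gamma>2 f g = fscale (1/2) (h - \<Gamma> f Lg - \<Gamma> Lf g)"
    and \<Gamma>t2_formula: "f \<in> Domain (cube R) \<Longrightarrow> g \<in> Domain (cube R) \<Longrightarrow>
        (f, Lf) \<in> L2_generator T2 \<Longrightarrow> (g, Lg) \<in> L2_generator T2 \<Longrightarrow>
        \<exists>h. (\<Gamma>t f g, h) \<in> L1_generator Me \<omega>e T1e \<and> \<Gamma>t2 f g = fscale (1/2) (h - \<Gamma>t f Lg - \<Gamma>t Lf g)"

end

theory Submission
  imports Defs
begin

text \<open>On polynomials the commutator of \<open>\<nabla>\<close> with the generator is minus the Hessian of \<open>V\<close>, which gives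
  Bochner's formula \<open>\<Gamma>t2(a) - K \<Gamma>t(a) = \<Sum>i. \<Gamma>e(\<nabla>i a) + Q(\<nabla> a)\<close> with \<open>\<Gamma>e\<close> the carre du champ of the generator
  of the enveloping algebra. On elementary tensors \<open>\<Gamma>e(x, y)\<close> is a sum of terms \<open>\<omega>(p\<^sup>* q) x'\<^sup>* y'\<close>, a Gram
  kernel times a square, so by the Schur product theorem every positive functional is non-negative on
  \<open>\<Gamma>e(x, x)\<close>; the term \<open>Q\<close> is handled by convexity. The untilded forms are the images of the tilded ones
  under \<open>\<omega> \<otimes> Id\<close> because \<open>\<omega>\<close> is invariant. To pass from polynomials to the domain of \<open>R\<^sup>3\<close>, where
  \<open>R\<^sup>2 = - L\<close>, one uses \<open>\<parallel>\<nabla> p\<parallel> = \<parallel>R p\<parallel>\<close> and \<open>\<parallel>R x\<parallel>\<^sup>3 \<le> \<parallel>x\<parallel>\<^sup>2 \<parallel>R\<^sup>3 x\<parallel>\<close>.\<close>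

section \<open>Complex Hilbert spaces\<close>

text \<open>Only the Hessian survives in the commutator because the free difference quotient is
  coassociative: a letter i and a contracted pair j, j outside of which it lies can be chosen in
  either order, whereas a letter inside the contracted block is absorbed into a scalar. The Gram
  kernel has the same origin: the defect of the Leibniz rule contracts one letter of each factor,
  and \<omega> of the block between them is an inner product of words in L^2. Both claims then rest
  on one inequality for linear functionals on the enveloping polynomials that are non-negative on
  squares; the untilded case tests it with a functional composed with the slice map, so a single
  Bochner formula serves both. The obstacle in the limit is that the two forms are continuous for
  different graph norms, that of the closed gradient and that of \<open>R\<^sup>3\<close>, while the
  core assumption supplies polynomials converging in the second. The interpolation inequality makes
  the same sequence converge in the first as well.\<close>

lemma cinner_add_left: "cinner (x + y) z = cinner x z + cinner y (z::'a::chilbert)"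
  by (metis cinner_add_right cinner_commute complex_cnj_add)

lemma cinner_scaleC_left: "cinner (c *\<^sub>C x) y = cnj c * cinner x (y::'a::chilbert)"
  by (metis cinner_commute cinner_scaleC_right complex_cnj_mult)

lemma scaleR_scaleC: "r *\<^sub>R x = complex_of_real r *\<^sub>C (x::'a::chilbert)"
  by (simp add: scaleC_of_real)

lemma scaleC_one [simp]: "1 *\<^sub>C x = (x::'a::chilbert)"
  using scaleC_of_real[of 1 x] by simp

lemma scaleC_zero_left [simp]: "0 *\<^sub>C x = (0::'a::chilbert)"
  using scaleC_of_real[of 0 x] by simp

lemma scaleC_minus_one: "(- 1) *\<^sub>C x = - (x::'a::chilbert)"
  using scaleC_of_real[of "-1" x] by simp

lemma scaleC_zero_right [simp]: "c *\<^sub>C (0::'a::chilbert) = 0"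
  using scaleC_add_right[of c 0 "0::'a"] by simp

lemma cinner_scaleR_right: "cinner x (r *\<^sub>R y) = of_real r * cinner x (y::'a::chilbert)"
  by (simp add: scaleR_scaleC cinner_scaleC_right)

lemma cinner_scaleR_left: "cinner (r *\<^sub>R x) y = of_real r * cinner x (y::'a::chilbert)"
  by (simp add: scaleR_scaleC cinner_scaleC_left)

lemma cinner_zero_right [simp]: "cinner x (0::'a::chilbert) = 0"
  using cinner_scaleR_right[of x 0 0] by simp

lemma cinner_zero_left [simp]: "cinner (0::'a::chilbert) x = 0"
  using cinner_scaleR_left[of 0 0 x] by simp

lemma cinner_minus_right: "cinner x (- y) = - cinner x (y::'a::chilbert)"
  using cinner_scaleR_right[of x "-1" y] by simp

lemma cinner_minus_left: "cinner (- x) y = - cinner x (y::'a::chilbert)"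
  using cinner_scaleR_left[of "-1" x y] by simp

lemma cinner_diff_right: "cinner x (y - z) = cinner x y - cinner x (z::'a::chilbert)"
  using cinner_add_right[of x y "- z"] by (simp add: cinner_minus_right)

lemma cinner_diff_left: "cinner (x - y) z = cinner x z - cinner y (z::'a::chilbert)"
  using cinner_add_left[of x "- y" z] by (simp add: cinner_minus_left)

lemma Im_cinner: "Im (cinner x y) = inner x ((- \<i>) *\<^sub>C (y::'a::chilbert))"
  by (simp add: inner_eq_Re_cinner cinner_scaleC_right)

lemma cinner_self: "cinner x x = complex_of_real ((norm (x::'a::chilbert))\<^sup>2)"
proof (rule complex_eqI)
  show "Re (cinner x x) = Re (complex_of_real ((norm x)\<^sup>2))"
    by (simp add: inner_eq_Re_cinner[symmetric] power2_norm_eq_inner)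
  have "Im (cinner x x) = Im (cnj (cinner x x))" using cinner_commute[of x x] by simp
  then show "Im (cinner x x) = Im (complex_of_real ((norm x)\<^sup>2))" by simp
qed

lemma norm_scaleC: "norm (c *\<^sub>C x) = cmod c * norm (x::'a::chilbert)"
proof -
  have "complex_of_real ((norm (c *\<^sub>C x))\<^sup>2) = (c * cnj c) * complex_of_real ((norm x)\<^sup>2)"
    unfolding cinner_self[symmetric] by (simp add: cinner_scaleC_left cinner_scaleC_right)
  also have "\<dots> = complex_of_real ((cmod c * norm x)\<^sup>2)"
    by (simp add: complex_norm_square[symmetric] power_mult_distrib)
  finally have "(norm (c *\<^sub>C x))\<^sup>2 = (cmod c * norm x)\<^sup>2" using of_real_eq_iff by blast
  then show ?thesis by (simp add: power2_eq_iff_nonneg)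
qed

lemma bounded_linear_scaleC: "bounded_linear (\<lambda>x::'a::chilbert. c *\<^sub>C x)"
  by (rule bounded_linear_intro[where K="cmod c"])
    (simp_all add: scaleC_add_right norm_scaleC scaleR_scaleC scaleC_scaleC mult.commute)

lemma norm_cinner: "cmod (cinner x y) \<le> norm x * norm (y::'a::chilbert)"
proof (cases "cinner x y = 0")
  case False
  \<comment> \<open>A phase of modulus one that turns the inner product into its modulus, so that
    the real Cauchy-Schwarz inequality applies.\<close>
  define u where "u = cnj (sgn (cinner x y))"
  have u: "cmod u = 1" using False by (simp add: u_def norm_sgn)
  have "u * cinner x y = complex_of_real (cmod (cinner x y))"
  proof -
    have "u * cinner x y = cnj (cinner x y) * cinner x y / cmod (cinner x y)"
      by (simp add: u_def sgn_eq)
    also have "\<dots> = complex_of_real ((cmod (cinner x y))\<^sup>2) / cmod (cinner x y)"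
      by (subst complex_norm_square) (simp add: mult.commute)
    finally show ?thesis using False by (simp add: power2_eq_square)
  qed
  then have "cmod (cinner x y) = Re (cinner x (u *\<^sub>C y))" by (simp add: cinner_scaleC_right)
  also have "\<dots> = inner x (u *\<^sub>C y)" by (simp add: inner_eq_Re_cinner)
  also have "\<dots> \<le> norm x * norm (u *\<^sub>C y)" by (rule norm_cauchy_schwarz)
  finally show ?thesis by (simp add: norm_scaleC u)
qed simp

lemma bounded_linear_cinner_right: "bounded_linear (\<lambda>y::'a::chilbert. cinner x y)"
  by (rule bounded_linear_intro[where K="norm x"])
    (simp_all add: cinner_add_right cinner_scaleR_right norm_cinner scaleR_conv_of_real mult.commute[of _ "norm x"])

lemma cinner_eqI: "(\<And>y. cinner y x = cinner y x') \<Longrightarrow> x = (x'::'a::chilbert)"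
  using cinner_self[of "x - x'"] by (simp add: cinner_diff_right)

lemma cinner_eqI': "(\<And>y. cinner x y = cinner x' y) \<Longrightarrow> x = (x'::'a::chilbert)"
  by (rule cinner_eqI) (metis cinner_commute)

text \<open>The representing vector minimises \<open>\<parallel>x\<parallel>\<^sup>2 / 2 - f x\<close>; the parallelogram law makes a
  minimising sequence Cauchy.\<close>

lemma riesz_representation:
  fixes f :: "'a::{real_inner,complete_space} \<Rightarrow> real"
  assumes f: "bounded_linear f"
  shows "\<exists>z. \<forall>y. f y = inner z y"
proof -
  interpret f: bounded_linear f by (rule f)
  define J where "J y = (norm y)\<^sup>2 / 2 - f y" for y
  obtain C where C: "\<And>y. norm (f y) \<le> norm y * C" using f.bounded by blast
  have J_lower: "- (C\<^sup>2 / 2) \<le> J y" for y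
  proof -
    have "f y \<le> norm y * C" using C[of y] by simp
    moreover have "0 \<le> (norm y - C)\<^sup>2" by simp
    ultimately show ?thesis unfolding J_def power2_diff by (simp add: algebra_simps)
  qed
  then have bdd: "bdd_below (range J)" by (intro bdd_belowI2)
  define m where "m = (INF y. J y)"
  have m: "m \<le> J y" for y unfolding m_def by (rule cINF_lower[OF bdd]) simp
  have "\<exists>y. J y < m + inverse (real (Suc n))" for n
    using cINF_less_iff[OF _ bdd, of "m + inverse (real (Suc n))"] by (auto simp: m_def)
  then obtain y where y: "\<And>n. J (y n) < m + inverse (real (Suc n))" by metis
  have par: "(norm (u - v))\<^sup>2 / 4 = J u + J v - 2 * J ((1/2) *\<^sub>R (u + v))" for u v
  proof -
    have "(norm (u - v))\<^sup>2 = 2 * (norm u)\<^sup>2 + 2 * (norm v)\<^sup>2 - (norm (u + v))\<^sup>2"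
      by (simp add: power2_norm_eq_inner inner_simps inner_commute)
    moreover have "(norm ((1/2) *\<^sub>R (u + v)))\<^sup>2 = (norm (u + v))\<^sup>2 / 4"
      by (simp add: power_mult_distrib power_divide del: scaleR_add_right)
    ultimately show ?thesis
      unfolding J_def f.scaleR f.add by (simp add: field_simps)
  qed
  have "Cauchy y"
  proof (rule metric_CauchyI)
    fix e :: real assume e: "0 < e"
    \<comment> \<open>By \<open>par\<close> a quarter of the squared distance is at most the sum of
      the two excesses over the infimum, each of which is below
      \<open>e\<^sup>2 / 8\<close>.\<close>
    then obtain N where N: "inverse (real (Suc N)) < e\<^sup>2 / 8"
      using reals_Archimedean[of "e\<^sup>2 / 8"] by auto
    have "dist (y k) (y l) < e" if "k \<ge> N" "l \<ge> N" for k l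
    proof -
      have "inverse (real (Suc k)) \<le> inverse (real (Suc N))" "inverse (real (Suc l)) \<le> inverse (real (Suc N))"
        using that by (auto intro!: le_imp_inverse_le)
      then have "(norm (y k - y l))\<^sup>2 / 4 < e\<^sup>2 / 4"
        unfolding par using y[of k] y[of l] m[of "(1/2) *\<^sub>R (y k + y l)"] N by linarith
      then have "(norm (y k - y l))\<^sup>2 < e\<^sup>2" by simp
      then show ?thesis using e by (simp add: dist_norm power2_less_imp_less)
    qed
    then show "\<exists>M. \<forall>k\<ge>M. \<forall>l\<ge>M. dist (y k) (y l) < e" by blast
  qed
  then obtain z where z: "y \<longlonglongrightarrow> z" using Cauchy_convergent_iff convergent_def by blast
  have "(\<lambda>n. J (y n)) \<longlonglongrightarrow> J z"
    unfolding J_def by (intro tendsto_intros f.tendsto z) simp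
  moreover have "(\<lambda>n. m + inverse (real (Suc n))) \<longlonglongrightarrow> m + 0"
    by (intro tendsto_intros LIMSEQ_inverse_real_of_nat)
  ultimately have "J z \<le> m + 0"
    by (rule LIMSEQ_le) (use y in \<open>auto intro!: exI[of _ 0] less_imp_le\<close>)
  then have min: "J z \<le> J v" for v using m[of v] by simp
  have "f v = inner z v" for v
  proof -
    define d where "d = inner z v - f v"
    have "0 \<le> t * d + t\<^sup>2 * (norm v)\<^sup>2 / 2" for t
    proof -
      have "J (z + t *\<^sub>R v) = J z + t * d + t\<^sup>2 * (norm v)\<^sup>2 / 2"
        unfolding J_def d_def
        unfolding power2_norm_eq_inner
        by (simp add: f.scaleR f.add inner_simps inner_commute algebra_simps power2_eq_square add_divide_distrib)
      then show ?thesis using min[of "z + t *\<^sub>R v"] by simp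
    qed
    note ge = this
    have "d = 0"
    proof (rule ccontr)
      assume d: "d \<noteq> 0"
      \<comment> \<open>The value - d / p minimises \<open>t * d + t\<^sup>2 * p / 2\<close>; the
        summand 1 keeps p positive when v = 0.\<close>
      define p where "p = (norm v)\<^sup>2 + 1"
      define t where "t = - d / p"
      have p: "p > 0" by (simp add: p_def add_nonneg_pos)
      have td: "t * p = - d" using p by (simp add: t_def)
      have "t * d + t\<^sup>2 * (norm v)\<^sup>2 / 2 \<le> t * d + t * (t * p) / 2"
        by (simp add: power2_eq_square p_def algebra_simps)
      also have "\<dots> = - (d * d / p) / 2"
        unfolding td by (simp add: t_def)
      also have "\<dots> < 0"
      proof -
        have "0 < d * d / p" using d p not_real_square_gt_zero[of d] by (intro divide_pos_pos) blast+
        then show ?thesis by (metis divide_neg_pos neg_less_0_iff_less zero_less_numeral)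
      qed
      finally show False using ge[of t] by simp
    qed
    then show ?thesis by (simp add: d_def)
  qed
  then show ?thesis by blast
qed

section \<open>Operators\<close>

lemma bopD: "A \<in> bop \<Longrightarrow> blinfun_apply A (c *\<^sub>C x) = c *\<^sub>C blinfun_apply A x"
  by (simp add: bop_def)

lemma scale_op_apply [simp]: "blinfun_apply (scale_op c A) x = c *\<^sub>C blinfun_apply A x"
  unfolding scale_op_def
  by (simp add: bounded_linear_Blinfun_apply bounded_linear_compose[OF bounded_linear_scaleC blinfun.bounded_linear_right])

lemma bop_id [simp]: "id_blinfun \<in> bop" by (simp add: bop_def)

lemma bop_compose: "A \<in> bop \<Longrightarrow> B \<in> bop \<Longrightarrow> A o\<^sub>L B \<in> bop" by (simp add: bop_def)

lemma bop_add: "A \<in> bop \<Longrightarrow> B \<in> bop \<Longrightarrow> A + B \<in> bop"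
  by (simp add: bop_def blinfun.add_left scaleC_add_right)

lemma bop_scale: "A \<in> bop \<Longrightarrow> scale_op c A \<in> bop"
  by (simp add: bop_def scaleC_scaleC mult.commute)

lemma adj_exists:
  fixes A :: "'h::chilbert oper"
  assumes A: "A \<in> bop"
  shows "\<exists>B. \<forall>x y. cinner (blinfun_apply B x) y = cinner x (A y)"
proof -
  have "\<exists>z. \<forall>y. inner x (A y) = inner z y" for x
    by (rule riesz_representation[OF bounded_linear_compose[OF bounded_linear_inner_right blinfun.bounded_linear_right]])
  then obtain b where b: "\<And>x y. inner (b x) y = inner x (A y)" by metis
  have lin: "bounded_linear b"
  proof (rule bounded_linear_intro[where K="norm A"])
    show "b (x + y) = b x + b y" for x y
      by (rule vector_eq_ldot[THEN iffD1]) (simp add: inner_simps b inner_commute[of _ "b x" for x])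
    show "b (r *\<^sub>R x) = r *\<^sub>R b x" for r x
      by (rule vector_eq_ldot[THEN iffD1]) (simp add: inner_simps b inner_commute[of _ "b x" for x])
    show "norm (b x) \<le> norm x * norm A" for x
    proof (cases "b x = 0")
      case False
      have "norm (b x) * norm (b x) = inner x (A (b x))"
        by (simp add: b[symmetric] power2_norm_eq_inner[symmetric] power2_eq_square)
      also have "\<dots> \<le> norm x * norm (A (b x))" by (rule norm_cauchy_schwarz)
      also have "\<dots> \<le> norm x * (norm A * norm (b x))"
        by (intro mult_left_mono norm_blinfun) simp
      finally show ?thesis using False by simp
    qed simp
  qed
  \<comment> \<open>The map b is known only through real parts; the imaginary parts follow by
    testing with - \<i> times y, since A is complex-linear.\<close>
  have "cinner (Blinfun b x) y = cinner x (A y)" for x y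
    by (rule complex_eqI) (simp_all add: bounded_linear_Blinfun_apply[OF lin] inner_eq_Re_cinner[symmetric]
        Im_cinner b bopD[OF A])
  then show ?thesis by blast
qed

lemma cinner_adj:
  assumes A: "A \<in> bop"
  shows "cinner (blinfun_apply (adj A) x) y = cinner x (blinfun_apply A y)"
proof -
  obtain B where B: "\<forall>x y. cinner (blinfun_apply B x) y = cinner x (A y)" using adj_exists[OF A] by blast
  have "\<forall>x y. cinner (blinfun_apply (adj A) x) y = cinner x (A y)"
    unfolding adj_def
  proof (rule theI[where a=B])
    fix C assume C: "\<forall>x y. cinner (blinfun_apply C x) y = cinner x (blinfun_apply A y)"
    show "C = B" by (rule blinfun_eqI, rule cinner_eqI') (simp add: B C)
  qed (rule B)
  then show ?thesis by blast
qed

lemma cinner_adj': "A \<in> bop \<Longrightarrow> cinner y (blinfun_apply (adj A) x) = cinner (blinfun_apply A y) x"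
  by (metis cinner_adj cinner_commute)

lemma adj_unique:
  assumes "\<And>x y. cinner (blinfun_apply B x) y = cinner x (blinfun_apply A y)"
  shows "adj A = B"
  unfolding adj_def
proof (rule the_equality)
  fix C assume C: "\<forall>x y. cinner (blinfun_apply C x) y = cinner x (blinfun_apply A y)"
  show "C = B" by (rule blinfun_eqI, rule cinner_eqI') (simp add: assms C)
qed (simp add: assms)

lemma adj_bop: "A \<in> bop \<Longrightarrow> adj A \<in> bop"
  unfolding bop_def mem_Collect_eq
  by (intro allI cinner_eqI') (simp add: cinner_adj bop_def cinner_scaleC_left)

lemma adj_adj: "A \<in> bop \<Longrightarrow> adj (adj A) = A"
  by (rule adj_unique) (simp add: cinner_adj')

lemma adj_compose: "A \<in> bop \<Longrightarrow> B \<in> bop \<Longrightarrow> adj (A o\<^sub>L B) = adj B o\<^sub>L adj A"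
  by (rule adj_unique) (simp add: cinner_adj)

lemma adj_add: "A \<in> bop \<Longrightarrow> B \<in> bop \<Longrightarrow> adj (A + B) = adj A + adj B"
  by (rule adj_unique) (simp add: cinner_adj blinfun.add_left cinner_add_left cinner_add_right)

lemma adj_scale: "A \<in> bop \<Longrightarrow> adj (scale_op c A) = scale_op (cnj c) (adj A)"
  by (rule adj_unique) (simp add: cinner_adj cinner_scaleC_left cinner_scaleC_right)

lemma adj_id [simp]: "adj (id_blinfun :: 'h::chilbert oper) = id_blinfun"
  by (rule adj_unique) simp

lemma scale_op_scaleR: "scale_op (of_real r) A = r *\<^sub>R A"
  by (rule blinfun_eqI) (simp add: blinfun.scaleR_left scaleC_of_real)

text \<open>The vector \<open>x + c y\<close> with \<open>c = 1\<close> and \<open>c = \<i>\<close> recovers the symmetry from the real diagonal.\<close>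

lemma pos_op_adj:
  assumes A: "A \<in> bop" and pos: "pos_op A"
  shows "adj A = A"
proof (rule adj_unique)
  fix x y
  have real: "cinner v (A v) = cinner (A v) v" for v
  proof -
    have "Im (cinner v (A v)) = 0" using pos by (simp add: pos_op_def less_eq_complex_def)
    then have "cnj (cinner v (A v)) = cinner v (A v)" by (simp add: complex_eq_iff)
    then show ?thesis by (metis cinner_commute)
  qed
  have 1: "cinner x (A y) + cinner y (A x) = cinner (A x) y + cinner (A y) x"
    using real[of "x + y"] real[of x] real[of y]
    by (simp add: blinfun.add_right cinner_add_left cinner_add_right algebra_simps)
  have "\<i> * cinner x (A y) - \<i> * cinner y (A x) = \<i> * cinner (A x) y - \<i> * cinner (A y) x"
    using real[of "x + \<i> *\<^sub>C y"] real[of x] real[of "\<i> *\<^sub>C y"]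
    by (simp add: blinfun.add_right cinner_add_left cinner_add_right bopD[OF A]
        cinner_scaleC_left cinner_scaleC_right algebra_simps)
  then have "\<i> * (cinner x (A y) - cinner y (A x)) = \<i> * (cinner (A x) y - cinner (A y) x)"
    by (simp add: algebra_simps)
  then have 2: "cinner x (A y) - cinner y (A x) = cinner (A x) y - cinner (A y) x"
    by (simp only: mult_cancel_left) simp
  have "2 * cinner x (A y) = 2 * cinner (A x) y"
    using arg_cong2[OF 1 2, of "(+)"] by (simp add: algebra_simps)
  then show "cinner (A x) y = cinner x (A y)" by simp
qed

lemma pos_op_sandwich:
  assumes "B \<in> bop" "pos_op A"
  shows "pos_op (adj B o\<^sub>L A o\<^sub>L B)"
  using assms by (auto simp: pos_op_def cinner_adj')

lemma pos_op_add: "pos_op A \<Longrightarrow> pos_op B \<Longrightarrow> pos_op (A + B)"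
  by (auto simp: pos_op_def blinfun.add_left cinner_add_right)

section \<open>Operator algebras\<close>

definition star_algebra :: "'h::chilbert oper set \<Rightarrow> bool" where
  "star_algebra N \<longleftrightarrow> N \<subseteq> bop \<and> id_blinfun \<in> N \<and> (\<forall>A\<in>N. adj A \<in> N) \<and>
     (\<forall>A\<in>N. \<forall>B\<in>N. A + B \<in> N \<and> A o\<^sub>L B \<in> N) \<and> (\<forall>c. \<forall>A\<in>N. scale_op c A \<in> N)"

lemma commutantD:
  assumes "A \<in> commutant S" "C \<in> S"
  shows "blinfun_apply C (blinfun_apply A x) = blinfun_apply A (blinfun_apply C x)"
proof -
  have "C o\<^sub>L A = A o\<^sub>L C" using assms by (simp add: commutant_def)
  then show ?thesis using blinfun_apply_blinfun_compose by metis
qed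

lemma star_algebra_commutant:
  assumes S: "S \<subseteq> bop" and adj: "adj ` S \<subseteq> S"
  shows "star_algebra (commutant S)"
  unfolding star_algebra_def
proof (intro conjI ballI allI)
  show "commutant S \<subseteq> bop" by (auto simp: commutant_def)
  show "id_blinfun \<in> commutant S" by (auto simp: commutant_def intro: blinfun_eqI)
  fix A assume A: "A \<in> commutant S"
  have Ab: "A \<in> bop" using A by (simp add: commutant_def)
  have Ac: "C (A x) = A (C x)" if "C \<in> S" for C x
    by (rule commutantD[OF A that])
  have "C o\<^sub>L adj A = adj A o\<^sub>L C" if "C \<in> S" for C
  proof -
    have C: "C \<in> bop" "adj C \<in> S" using that S adj by auto
    then have "adj C o\<^sub>L A = A o\<^sub>L adj C" using A by (simp add: commutant_def)
    then have "adj (adj C o\<^sub>L A) = adj (A o\<^sub>L adj C)" by simp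
    then show ?thesis using C Ab by (simp add: adj_compose adj_adj adj_bop)
  qed
  then show "adj A \<in> commutant S" using Ab by (simp add: commutant_def adj_bop)
  show "scale_op c A \<in> commutant S" for c
    unfolding commutant_def mem_Collect_eq
  proof (intro conjI ballI)
    show "scale_op c A \<in> bop" by (rule bop_scale[OF Ab])
    fix C assume "C \<in> S"
    then show "C o\<^sub>L scale_op c A = scale_op c A o\<^sub>L C"
      using S by (intro blinfun_eqI) (simp add: Ac bopD subset_iff)
  qed
  fix B assume B: "B \<in> commutant S"
  have Bb: "B \<in> bop" using B by (simp add: commutant_def)
  have Bc: "C (B x) = B (C x)" if "C \<in> S" for C x
    by (rule commutantD[OF B that])
  show "A + B \<in> commutant S" using Ab Bb Ac Bc
    by (auto simp: commutant_def bop_add blinfun.add_left blinfun.add_right intro!: blinfun_eqI)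
  show "A o\<^sub>L B \<in> commutant S" using Ab Bb Ac Bc
    by (auto simp: commutant_def bop_compose intro!: blinfun_eqI)
qed

lemma star_algebra_Wstar:
  assumes S: "S \<subseteq> bop"
  shows "star_algebra (Wstar S)" and "S \<subseteq> Wstar S"
proof -
  let ?T = "S \<union> adj ` S"
  have T: "?T \<subseteq> bop" "adj ` ?T \<subseteq> ?T" using S by (auto simp: adj_bop adj_adj subset_iff)
  then have c: "star_algebra (commutant ?T)" by (rule star_algebra_commutant)
  then show "star_algebra (Wstar S)" unfolding Wstar_def
    by (intro star_algebra_commutant) (auto simp: star_algebra_def)
  show "S \<subseteq> Wstar S" using S by (auto simp: Wstar_def commutant_def)
qed

lemma Wstar_subset:
  assumes N: "von_neumann_algebra N" and S: "S \<subseteq> N"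
  shows "Wstar S \<subseteq> N"
proof -
  have "S \<union> adj ` S \<subseteq> N" using assms by (auto simp: von_neumann_algebra_def)
  then have "commutant (commutant (S \<union> adj ` S)) \<subseteq> commutant (commutant N)"
    unfolding commutant_def by blast
  then show ?thesis using N by (simp add: Wstar_def von_neumann_algebra_def)
qed

section \<open>Tracial functionals\<close>

text \<open>Both M with \<rho> and the enveloping algebra with \<open>\<omega>e\<close> are
  instances, so that every estimate involving the trace is proved once.\<close>

locale tracial_algebra =
  fixes N :: "'h::chilbert oper set" and \<tau> :: "'h oper \<Rightarrow> complex"
  assumes star: "star_algebra N"
    and linear: "clinear_functional_on N \<tau>"
    and normal: "normal_functional N \<tau>"
    and pos: "A \<in> N \<Longrightarrow> pos_op A \<Longrightarrow> 0 \<le> \<tau> A"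
    and trace: "A \<in> N \<Longrightarrow> B \<in> N \<Longrightarrow> \<tau> (A o\<^sub>L B) = \<tau> (B o\<^sub>L A)"
begin

lemma mem_bop: "A \<in> N \<Longrightarrow> A \<in> bop"
  and mem_id: "id_blinfun \<in> N"
  and mem_adj: "A \<in> N \<Longrightarrow> adj A \<in> N"
  and mem_add: "A \<in> N \<Longrightarrow> B \<in> N \<Longrightarrow> A + B \<in> N"
  and mem_compose: "A \<in> N \<Longrightarrow> B \<in> N \<Longrightarrow> A o\<^sub>L B \<in> N"
  and mem_scale: "A \<in> N \<Longrightarrow> scale_op c A \<in> N"
  using star by (auto simp: star_algebra_def)

lemma tau_add: "A \<in> N \<Longrightarrow> B \<in> N \<Longrightarrow> \<tau> (A + B) = \<tau> A + \<tau> B"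
  and tau_scale: "A \<in> N \<Longrightarrow> \<tau> (scale_op c A) = c * \<tau> A"
  using linear by (auto simp: clinear_functional_on_def)

lemma minus_scale: "A - B = A + scale_op (- 1) (B :: 'h oper)"
  by (rule blinfun_eqI) (simp add: blinfun.add_left blinfun.diff_left scaleC_minus_one)

lemma mem_diff: "A \<in> N \<Longrightarrow> B \<in> N \<Longrightarrow> A - B \<in> N"
  by (simp add: minus_scale mem_add mem_scale)

lemma tau_diff: "A \<in> N \<Longrightarrow> B \<in> N \<Longrightarrow> \<tau> (A - B) = \<tau> A - \<tau> B"
  by (simp add: minus_scale tau_add tau_scale mem_scale)

lemma mem_zero: "0 \<in> N"
  using mem_diff[OF mem_id mem_id] by simp

lemma mem_sum: "(\<And>i. i \<in> I \<Longrightarrow> f i \<in> N) \<Longrightarrow> (\<Sum>i\<in>I. f i) \<in> N"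
  by (induction I rule: infinite_finite_induct) (auto simp: mem_zero mem_add)

text \<open>The square-summable sequences of a normal functional dominate its series termwise, by 2
  s t \<le> s^2 + t^2. Norm continuity is what bounds elements of L^1 on the unit ball.\<close>

lemma tau_bounded: "\<exists>C. \<forall>A\<in>N. cmod (\<tau> A) \<le> C * norm A"
proof -
  obtain x y :: "nat \<Rightarrow> 'h" where x: "summable (\<lambda>n. (norm (x n))\<^sup>2)" and y: "summable (\<lambda>n. (norm (y n))\<^sup>2)"
    and s: "\<And>A. A \<in> N \<Longrightarrow> (\<lambda>n. cinner (x n) (A (y n))) sums \<tau> A"
    using normal unfolding normal_functional_def by blast
  define d where "d n = (norm (x n))\<^sup>2 + (norm (y n))\<^sup>2" for n
  have d: "summable d" unfolding d_def by (intro summable_add x y)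
  have "cmod (\<tau> A) \<le> suminf d * norm A" if A: "A \<in> N" for A
  proof -
    have le: "cmod (cinner (x n) (A (y n))) \<le> d n * norm A" for n
    proof -
      have "cmod (cinner (x n) (A (y n))) \<le> norm (x n) * norm (A (y n))" by (rule norm_cinner)
      also have "\<dots> \<le> norm (x n) * (norm A * norm (y n))"
        by (intro mult_left_mono norm_blinfun) simp
      also have "\<dots> = (norm (x n) * norm (y n)) * norm A" by simp
      also have "\<dots> \<le> d n * norm A"
      proof (rule mult_right_mono)
        have "2 * norm (x n) * norm (y n) \<le> d n"
          using sum_squares_bound[of "norm (x n)" "norm (y n)"] by (simp add: d_def)
        moreover have "0 \<le> norm (x n) * norm (y n)" by simp
        ultimately show "norm (x n) * norm (y n) \<le> d n" by linarith
      qed simp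
      finally show ?thesis .
    qed
    have sm: "summable (\<lambda>n. d n * norm A)" by (rule summable_mult2[OF d])
    have "cmod (\<tau> A) = cmod (suminf (\<lambda>n. cinner (x n) (A (y n))))"
      using s[OF A] by (simp add: sums_iff)
    also have "\<dots> \<le> suminf (\<lambda>n. d n * norm A)"
      by (rule norm_suminf_le[OF le sm])
    also have "\<dots> = suminf d * norm A" using suminf_mult2[OF d] by simp
    finally show ?thesis .
  qed
  then show ?thesis by blast
qed

lemma pos_op_square: "A \<in> N \<Longrightarrow> pos_op (adj A o\<^sub>L A)"
  by (auto simp: pos_op_def cinner_adj' mem_bop cinner_self less_eq_complex_def simp del: of_real_power)

lemma tau_square: "A \<in> N \<Longrightarrow> 0 \<le> \<tau> (adj A o\<^sub>L A)"
  by (intro pos pos_op_square mem_compose mem_adj)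

text \<open>Positivity of \<open>(A + c)\<^sup>* (A + c)\<close> for \<open>c = 1, \<i>\<close> determines the imaginary and real parts.\<close>

lemma tau_adj:
  assumes A: "A \<in> N"
  shows "\<tau> (adj A) = cnj (\<tau> A)"
proof -
  have "Im (c * \<tau> (adj A) + cnj c * \<tau> A) = 0" for c
  proof -
    let ?B = "A + scale_op c id_blinfun"
    have B: "?B \<in> N" by (intro mem_add A mem_scale mem_id)
    have "adj ?B o\<^sub>L ?B = (adj A o\<^sub>L A) + (scale_op c (adj A) + (scale_op (cnj c) A + scale_op (cnj c * c) id_blinfun))"
      by (rule blinfun_eqI) (simp add: adj_add adj_scale bop_scale mem_bop A blinfun.add_left blinfun.add_right
          scaleC_add_right scaleC_scaleC bopD mem_adj)
    then have "\<tau> (adj ?B o\<^sub>L ?B) = \<tau> (adj A o\<^sub>L A) + (c * \<tau> (adj A) + (cnj c * \<tau> A + cnj c * c * \<tau> id_blinfun))"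
      by (simp add: tau_add tau_scale mem_add mem_scale mem_compose mem_adj A mem_id)
    moreover have "Im (\<tau> (adj ?B o\<^sub>L ?B)) = 0" "Im (\<tau> (adj A o\<^sub>L A)) = 0"
      using tau_square[OF B] tau_square[OF A] by (simp_all add: less_eq_complex_def)
    moreover have "Im (\<tau> id_blinfun) = 0"
      using pos[OF mem_id] by (simp add: less_eq_complex_def pos_op_def cinner_self)
    then have "Im (cnj c * c * \<tau> id_blinfun) = 0"
      by (simp add: mult.commute[of "cnj c"] complex_mult_cnj)
    ultimately show ?thesis by (simp only: plus_complex.sel)
  qed
  from this[of 1] this[of \<i>] show ?thesis by (simp add: complex_eq_iff)
qed

text \<open>Traciality rewrites the value as the trace of Z B Z^*, which is positive; squares are
  handled in this way without a square root of B.\<close>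

lemma tau_sandwich:
  assumes Z: "Z \<in> N" and B: "B \<in> N" "pos_op B"
  shows "0 \<le> \<tau> (adj Z o\<^sub>L Z o\<^sub>L B)"
proof -
  have "pos_op (adj (adj Z) o\<^sub>L B o\<^sub>L adj Z)"
    by (intro pos_op_sandwich B mem_bop mem_adj Z)
  then have "0 \<le> \<tau> (Z o\<^sub>L B o\<^sub>L adj Z)"
    by (intro pos mem_compose mem_adj Z B) (simp add: adj_adj mem_bop Z)
  also have "\<tau> (Z o\<^sub>L B o\<^sub>L adj Z) = \<tau> (adj Z o\<^sub>L (Z o\<^sub>L B))"
    by (intro trace mem_compose mem_adj Z B)
  also have "adj Z o\<^sub>L (Z o\<^sub>L B) = adj Z o\<^sub>L Z o\<^sub>L B"
    by (rule blinfun_eqI) simp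
  finally show ?thesis .
qed

text \<open>With \<open>A\<^sub>0 = A\<close> and \<open>A\<^sub>n\<^sub>+\<^sub>1 = A\<^sub>n - A\<^sub>n\<^sup>2\<close> one has \<open>A = \<Sum>k<n. A\<^sub>k\<^sup>2 + A\<^sub>n\<close>, whence
  \<open>\<tau> (A B) \<ge> \<tau> (A\<^sub>n B)\<close> for positive \<open>B\<close>, and \<open>\<tau> (A\<^sub>n B)\<close> tends to 0 because the series
  \<open>\<Sum>k. \<tau> (A\<^sub>k\<^sup>2)\<close> converges. This replaces the square root of \<open>A\<close>.\<close>

lemma tau_pos_mult_contraction:
  assumes A: "A \<in> N" "pos_op A" "pos_op (id_blinfun - A)" and B: "B \<in> N" "pos_op B"
  shows "0 \<le> Re (\<tau> (A o\<^sub>L B))"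
proof -
  define a where "a n = ((\<lambda>C. C - (C o\<^sub>L C)) ^^ n) A" for n
  have aSuc: "a (Suc n) = a n - (a n o\<^sub>L a n)" for n by (simp add: a_def)
  have a: "a n \<in> N \<and> pos_op (a n) \<and> pos_op (id_blinfun - a n)" for n
  proof (induction n)
    case 0
    then show ?case using A by (simp add: a_def)
  next
    case (Suc n)
    let ?D = "id_blinfun - a n"
    have N: "a n \<in> N" "?D \<in> N" using Suc by (auto intro: mem_diff mem_id)
    have adj: "adj (a n) = a n" "adj ?D = ?D"
      using Suc N by (auto intro!: pos_op_adj mem_bop)
    \<comment> \<open>With a = \<open>a n\<close> and d = 1 - a one has a - a^2 = a d a + d a d and
      1 - (a - a^2) = d + a^2, which keeps the iterates between 0 and 1.\<close>
    have "pos_op ((adj (a n) o\<^sub>L ?D o\<^sub>L a n) + (adj ?D o\<^sub>L a n o\<^sub>L ?D))"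
      using Suc N by (intro pos_op_add pos_op_sandwich mem_bop) auto
    moreover have "a (Suc n) = (adj (a n) o\<^sub>L ?D o\<^sub>L a n) + (adj ?D o\<^sub>L a n o\<^sub>L ?D)"
      unfolding adj aSuc
      by (rule blinfun_eqI) (simp add: blinfun.add_left blinfun.diff_left blinfun.diff_right)
    moreover have "id_blinfun - a (Suc n) = ?D + (adj (a n) o\<^sub>L a n)"
      unfolding adj aSuc by (rule blinfun_eqI) (simp add: blinfun.add_left blinfun.diff_left)
    moreover have "pos_op (?D + (adj (a n) o\<^sub>L a n))"
      using Suc by (intro pos_op_add pos_op_square) auto
    moreover have "a (Suc n) \<in> N" unfolding aSuc by (intro mem_diff mem_compose N)
    ultimately show ?case by metis
  qed
  then have aN: "a n \<in> N" and aadj: "adj (a n) = a n" for n by (auto intro!: pos_op_adj mem_bop)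
  define q where "q n = Re (\<tau> (a n o\<^sub>L a n))" for n
  define r where "r n = Re (\<tau> (a n o\<^sub>L B))" for n
  have q: "0 \<le> q n" for n
    using tau_square[OF aN[of n]] by (simp add: q_def aadj less_eq_complex_def)
  have rS: "r (Suc n) \<le> r n" for n
  proof -
    have "\<tau> ((a n - (a n o\<^sub>L a n)) o\<^sub>L B) = \<tau> ((a n o\<^sub>L B) - ((adj (a n) o\<^sub>L a n) o\<^sub>L B))"
      unfolding aadj by (rule arg_cong[of _ _ \<tau>], rule blinfun_eqI) (simp add: blinfun.diff_left)
    also have "\<dots> = \<tau> (a n o\<^sub>L B) - \<tau> ((adj (a n) o\<^sub>L a n) o\<^sub>L B)"
      by (intro tau_diff mem_compose mem_adj aN B)
    finally show ?thesis
      using tau_sandwich[OF aN[of n] B] by (simp add: r_def aSuc less_eq_complex_def)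
  qed
  have r0: "r n \<le> r 0" for n by (induction n) (use rS order_trans in blast)+
  have "(\<Sum>k<n. q k) \<le> Re (\<tau> (a 0))" for n
  proof -
    have "(\<Sum>k<n. q k) = Re (\<tau> (a 0)) - Re (\<tau> (a n))"
      by (induction n) (simp_all add: aSuc q_def tau_diff aN mem_compose)
    moreover have "0 \<le> Re (\<tau> (a n))" using pos[OF aN[of n]] a[of n] by (simp add: less_eq_complex_def)
    ultimately show ?thesis by linarith
  qed
  then have "summable q" by (intro summableI_nonneg_bounded q)
  then have q0: "q \<longlonglongrightarrow> 0" by (rule summable_LIMSEQ_zero)
  define b where "b = Re (\<tau> (B o\<^sub>L B))"
  have badj: "adj B = B" using B by (intro pos_op_adj mem_bop)
  \<comment> \<open>Positivity of the square of \<open>a n\<close> + s B bounds 2 s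
    \<open>r n\<close> below by - (\<open>q n\<close> + s^2 b). Letting n tend to infinity removes
    \<open>q n\<close>; dividing by s and letting s tend to 0 removes b.\<close>
  have low: "- (q n + s\<^sup>2 * b) \<le> 2 * s * r 0" if s: "0 < s" for s n
  proof -
    let ?C = "a n + scale_op (of_real s) B"
    have C: "?C \<in> N" by (intro mem_add aN mem_scale B)
    have "adj ?C o\<^sub>L ?C = (a n o\<^sub>L a n) + (scale_op (of_real s) (a n o\<^sub>L B) + (scale_op (of_real s) (B o\<^sub>L a n)
            + scale_op (of_real (s\<^sup>2)) (B o\<^sub>L B)))"
      by (rule blinfun_eqI) (simp add: adj_add adj_scale bop_scale mem_bop aN B aadj badj blinfun.add_left
          blinfun.add_right scaleC_add_right scaleC_scaleC bopD power2_eq_square)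
    then have "\<tau> (adj ?C o\<^sub>L ?C) = \<tau> (a n o\<^sub>L a n) + (s * \<tau> (a n o\<^sub>L B) + (s * \<tau> (B o\<^sub>L a n) + s\<^sup>2 * \<tau> (B o\<^sub>L B)))"
      by (simp add: tau_add tau_scale mem_add mem_scale mem_compose aN B)
    also have "\<tau> (B o\<^sub>L a n) = \<tau> (a n o\<^sub>L B)" by (intro trace aN B)
    finally have "Re (\<tau> (adj ?C o\<^sub>L ?C)) = q n + 2 * s * r n + s\<^sup>2 * b"
      unfolding of_real_power[symmetric] by (simp add: q_def r_def b_def)
    then have "0 \<le> q n + 2 * s * r n + s\<^sup>2 * b"
      using tau_square[OF C] by (simp add: less_eq_complex_def)
    moreover have "s * r n \<le> s * r 0" using r0[of n] s by simp
    ultimately show ?thesis by linarith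
  qed
  have low': "- (s * b) \<le> 2 * r 0" if s: "0 < s" for s
  proof -
    have "(\<lambda>n. - (q n + s\<^sup>2 * b)) \<longlonglongrightarrow> - (0 + s\<^sup>2 * b)" by (intro tendsto_intros q0)
    then have "- (0 + s\<^sup>2 * b) \<le> 2 * s * r 0"
      by (rule LIMSEQ_le_const2) (use low[OF s] in blast)
    then have "s * (- (s * b)) \<le> s * (2 * r 0)" by (simp add: power2_eq_square algebra_simps)
    then show ?thesis using s by (simp only: mult_le_cancel_left_pos)
  qed
  have "((\<lambda>s. - (s * b)) \<longlongrightarrow> - (0 * b)) (at_right 0)" by (intro tendsto_intros)
  then have "- (0 * b) \<le> 2 * r 0"
    by (rule tendsto_upperbound) (auto simp: eventually_at_right_less low' intro!: eventually_at_right_less[THEN eventually_mono])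
  then show ?thesis by (simp add: r_def a_def)
qed

text \<open>The product of two positive operators is in general not positive; only its trace is.
  Rescaling reduces the real part to contractions, where the 1 added to the norm covers A = 0. The
  imaginary part vanishes because the adjoint of A B is B A, which has the same trace.\<close>

lemma tau_pos_mult:
  assumes A: "A \<in> N" "pos_op A" and B: "B \<in> N" "pos_op B"
  shows "0 \<le> \<tau> (A o\<^sub>L B)"
proof -
  define r where "r = 1 / (norm A + 1)"
  have r: "0 < r" "r * norm A \<le> 1" by (auto simp: r_def add_nonneg_pos divide_simps)
  let ?A = "scale_op (of_real r) A"
  have A': "?A \<in> N" by (intro mem_scale A)
  have pA: "pos_op ?A" using A(2) r unfolding pos_op_def
    by (auto simp: cinner_scaleC_right less_eq_complex_def)
  have "pos_op (id_blinfun - ?A)"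
    unfolding pos_op_def
  proof
    fix x
    have 0: "0 \<le> cinner x (A x)" using A(2) by (simp add: pos_op_def)
    have "Re (cinner x (A x)) \<le> norm x * norm (A x)"
      using norm_cauchy_schwarz[of x "A x"] by (simp add: inner_eq_Re_cinner)
    also have "\<dots> \<le> norm x * (norm A * norm x)" by (intro mult_left_mono norm_blinfun) simp
    finally have "r * Re (cinner x (A x)) \<le> r * (norm x * (norm A * norm x))"
      using r(1) by (intro mult_left_mono) auto
    also have "\<dots> = (r * norm A) * (norm x)\<^sup>2" by (simp add: power2_eq_square)
    also have "\<dots> \<le> 1 * (norm x)\<^sup>2" by (intro mult_right_mono r) simp
    finally show "0 \<le> cinner x ((id_blinfun - ?A) x)"
      using 0 by (simp add: blinfun.diff_left cinner_diff_right cinner_scaleC_right cinner_self less_eq_complex_def)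
  qed
  then have "0 \<le> Re (\<tau> (?A o\<^sub>L B))" by (rule tau_pos_mult_contraction[OF A' pA _ B])
  also have "?A o\<^sub>L B = scale_op (of_real r) (A o\<^sub>L B)" by (rule blinfun_eqI) simp
  also have "Re (\<tau> \<dots>) = r * Re (\<tau> (A o\<^sub>L B))" by (simp add: tau_scale mem_compose A B)
  finally have Re: "0 \<le> Re (\<tau> (A o\<^sub>L B))" using r(1) by (simp add: zero_le_mult_iff)
  have "cnj (\<tau> (A o\<^sub>L B)) = \<tau> (adj (A o\<^sub>L B))" by (intro tau_adj[symmetric] mem_compose A B)
  also have "adj (A o\<^sub>L B) = B o\<^sub>L A"
    using A B by (simp add: adj_compose mem_bop pos_op_adj)
  also have "\<tau> (B o\<^sub>L A) = \<tau> (A o\<^sub>L B)" by (intro trace A B)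
  finally have "Im (\<tau> (A o\<^sub>L B)) = 0" by (simp add: complex_eq_iff)
  with Re show ?thesis by (simp add: less_eq_complex_def)
qed

text \<open>\<open>L\<^sup>1\<close> convergence is tested pointwise, the supremum in \<open>L1_norm\<close> being finite on \<open>L\<^sup>1\<close>.\<close>

lemma L1_bounded:
  assumes "\<phi> \<in> L1 N \<tau>"
  shows "\<exists>C. \<forall>B\<in>{B \<in> N. norm B \<le> 1}. cmod (\<phi> B) \<le> C"
proof -
  obtain A where A: "\<And>n. A n \<in> N"
    and lim: "uniform_limit {B \<in> N. norm B \<le> 1} (\<lambda>n::nat. L1_emb N \<tau> (A n)) \<phi> sequentially"
    using assms unfolding L1_def by blast
  from uniform_limitD[OF lim, of 1] obtain n
    where n: "\<And>B. B \<in> N \<Longrightarrow> norm B \<le> 1 \<Longrightarrow> dist (L1_emb N \<tau> (A n) B) (\<phi> B) < 1"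
    by (auto simp: eventually_sequentially)
  obtain C where C: "\<And>A. A \<in> N \<Longrightarrow> cmod (\<tau> A) \<le> C * norm A" using tau_bounded by blast
  have "cmod (\<phi> B) \<le> \<bar>C\<bar> * norm (A n) + 1" if B: "B \<in> N" "norm B \<le> 1" for B
  proof -
    have "cmod (\<tau> (A n o\<^sub>L B)) \<le> C * norm (A n o\<^sub>L B)" by (intro C mem_compose A B)
    also have "\<dots> \<le> \<bar>C\<bar> * (norm (A n) * norm B)"
      by (intro mult_mono norm_blinfun_compose) auto
    also have "\<dots> \<le> \<bar>C\<bar> * (norm (A n) * 1)" using B by (intro mult_left_mono) auto
    finally have "cmod (\<tau> (A n o\<^sub>L B)) \<le> \<bar>C\<bar> * norm (A n)" by simp
    moreover have "cmod (\<phi> B) \<le> cmod (\<tau> (A n o\<^sub>L B)) + dist (\<tau> (A n o\<^sub>L B)) (\<phi> B)"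
      by (metis dist_0_norm dist_commute dist_triangle)
    ultimately show ?thesis using n[OF B] B by (simp add: L1_emb_def)
  qed
  then show ?thesis by blast
qed

lemma L1_tendsto_apply:
  assumes \<phi>: "\<And>n. \<phi> n \<in> L1 N \<tau>" and \<psi>: "\<psi> \<in> L1 N \<tau>"
    and lim: "(\<lambda>n::nat. L1_norm N (\<phi> n - \<psi>)) \<longlonglongrightarrow> 0" and B: "B \<in> N"
  shows "(\<lambda>n. \<phi> n B) \<longlonglongrightarrow> \<psi> B"
proof -
  define r where "r = norm B + 1"
  have r: "0 < r" by (simp add: r_def add_nonneg_pos)
  let ?B = "scale_op (of_real (1 / r)) B"
  have B': "?B \<in> N" "norm ?B \<le> 1"
  proof -
    have "norm B / r \<le> 1" using r by (simp add: divide_le_eq_1) (simp add: r_def)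
    then show "norm ?B \<le> 1" unfolding scale_op_scaleR using r by simp
  qed (intro mem_scale B)
  have "cmod ((\<phi> n - \<psi>) B) \<le> r * L1_norm N (\<phi> n - \<psi>)" for n
  proof -
    obtain C where C: "\<And>B. B \<in> {B \<in> N. norm B \<le> 1} \<Longrightarrow> cmod (\<phi> n B) \<le> C" using L1_bounded[OF \<phi>] by metis
    obtain D where D: "\<And>B. B \<in> {B \<in> N. norm B \<le> 1} \<Longrightarrow> cmod (\<psi> B) \<le> D" using L1_bounded[OF \<psi>] by metis
    have "bdd_above ((\<lambda>B. cmod ((\<phi> n - \<psi>) B)) ` {B \<in> N. norm B \<le> 1})"
    proof (rule bdd_aboveI2)
      fix B assume "B \<in> {B \<in> N. norm B \<le> 1}"
      then show "cmod ((\<phi> n - \<psi>) B) \<le> C + D"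
        using C[of B] D[of B] norm_triangle_ineq4[of "\<phi> n B" "\<psi> B"] by simp
    qed
    then have le: "cmod ((\<phi> n - \<psi>) ?B) \<le> L1_norm N (\<phi> n - \<psi>)"
      unfolding L1_norm_def using B' by (intro cSUP_upper) auto
    have "\<phi> n ?B = of_real (1 / r) * \<phi> n B" "\<psi> ?B = of_real (1 / r) * \<psi> B"
      using \<phi>[of n] \<psi> B by (auto simp: L1_def clinear_functional_on_def simp del: of_real_divide)
    then have "cmod ((\<phi> n - \<psi>) ?B) = (1 / r) * cmod ((\<phi> n - \<psi>) B)"
      using r by (simp add: norm_divide diff_divide_distrib[symmetric])
    with le show ?thesis using r by (simp del: fun_diff_def minus_apply add: pos_divide_le_eq mult.commute[of r])
  qed
  then have "\<forall>\<^sub>F n in sequentially. norm ((\<phi> n - \<psi>) B) \<le> r * L1_norm N (\<phi> n - \<psi>)" by simp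
  moreover have "(\<lambda>n. r * L1_norm N (\<phi> n - \<psi>)) \<longlonglongrightarrow> 0" by (rule tendsto_mult_right_zero[OF lim])
  ultimately have "(\<lambda>n. (\<phi> n - \<psi>) B) \<longlonglongrightarrow> 0" by (rule Lim_null_comparison)
  then show ?thesis by (simp add: LIM_zero_iff)
qed

end

section \<open>A Schur product lemma\<close>

text \<open>Induction on the index set: after subtracting from every \<open>a i\<close> its projection to the line of
  \<open>a k\<close>, the index \<open>k\<close> drops out, and the projections contribute a rank one term.\<close>

lemma schur_product_nonneg:
  fixes a :: "'i \<Rightarrow> 'l::chilbert" and H :: "'i \<Rightarrow> 'i \<Rightarrow> complex"
  assumes "finite I" and "\<And>c. 0 \<le> (\<Sum>i\<in>I. \<Sum>j\<in>I. cnj (c i) * c j * H i j)"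
  shows "0 \<le> (\<Sum>i\<in>I. \<Sum>j\<in>I. cinner (a i) (a j) * H i j)"
  using assms
proof (induction I arbitrary: a rule: finite_induct)
  case (insert k I)
  define r where "r = norm (a k)"
  \<comment> \<open>The coefficient of \<open>a i\<close> along the unit vector in the direction of
    \<open>a k\<close>. The default for r = 0 avoids the division, and \<open>b k\<close> is 0 in
    both cases.\<close>
  define e where "e i = (if r = 0 then 0 else cinner (a k) (a i) / of_real r)" for i
  define b where "b i = (if r = 0 then a i else a i - (e i / of_real r) *\<^sub>C a k)" for i
  have bk: "b k = 0"
    by (auto simp: b_def e_def cinner_self r_def power2_eq_square)
  have split: "cinner (a i) (a j) = cinner (b i) (b j) + cnj (e i) * e j" for i j
  proof (cases "r = 0")
    case False
    have *: "cinner (a i) (a k) = cnj (e i) * of_real r" "cinner (a k) (a j) = e j * of_real r"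
      using False cinner_commute[of "a i" "a k"] by (simp_all add: e_def)
    show ?thesis using False
      by (simp add: b_def cinner_diff_left cinner_diff_right cinner_scaleC_left cinner_scaleC_right *
          cinner_self r_def[symmetric] power2_eq_square)
  qed (simp add: b_def e_def)
  \<comment> \<open>Coefficients vanishing at k restrict the hypothesis to I.\<close>
  have "0 \<le> (\<Sum>i\<in>I. \<Sum>j\<in>I. cnj (c i) * c j * H i j)" for c
  proof -
    have "(\<Sum>i\<in>insert k I. \<Sum>j\<in>insert k I. cnj ((c(k := 0)) i) * (c(k := 0)) j * H i j)
        = (\<Sum>i\<in>I. \<Sum>j\<in>I. cnj ((c(k := 0)) i) * (c(k := 0)) j * H i j)"
      using insert.hyps by simp
    also have "\<dots> = (\<Sum>i\<in>I. \<Sum>j\<in>I. cnj (c i) * c j * H i j)"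
      using insert.hyps by (intro sum.cong refl) auto
    finally show ?thesis using insert.prems[of "c(k := 0)"] by simp
  qed
  then have "0 \<le> (\<Sum>i\<in>I. \<Sum>j\<in>I. cinner (b i) (b j) * H i j)" by (rule insert.IH)
  also have "\<dots> = (\<Sum>i\<in>insert k I. \<Sum>j\<in>insert k I. cinner (b i) (b j) * H i j)"
    using insert.hyps by (simp add: bk)
  finally have "0 \<le> (\<Sum>i\<in>insert k I. \<Sum>j\<in>insert k I. cinner (b i) (b j) * H i j)
      + (\<Sum>i\<in>insert k I. \<Sum>j\<in>insert k I. cnj (e i) * e j * H i j)"
    using insert.prems[of e] by (rule add_nonneg_nonneg)
  then show ?case unfolding split distrib_right sum.distrib .
qed simp

section \<open>Linear maps between free modules\<close>

lemma lookup_pscale [simp]: "Poly_Mapping.lookup (pscale c p) w = c * Poly_Mapping.lookup p w"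
  by (auto simp: pscale_def Poly_Mapping.map.rep_eq when_def)

lemma pscale_add_right: "pscale c (p + q) = pscale c p + pscale c q"
  and pscale_add_left: "pscale (c + d) p = pscale c p + pscale d p"
  and pscale_pscale: "pscale c (pscale d p) = pscale (c * d) p"
  and pscale_one [simp]: "pscale 1 p = p"
  and pscale_zero_left [simp]: "pscale 0 p = 0"
  and pscale_zero_right [simp]: "pscale c 0 = 0"
  by (rule poly_mapping_eqI; simp add: lookup_add algebra_simps)+

lemma pscale_minus_right: "pscale c (- p) = - pscale c p"
  and pscale_diff_right: "pscale c (p - q) = pscale c p - pscale c q"
  by (rule poly_mapping_eqI; simp add: lookup_minus algebra_simps)+

lemma pscale_sum_right: "pscale c (\<Sum>i\<in>I. f i) = (\<Sum>i\<in>I. pscale c (f i))"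
  by (induction I rule: infinite_finite_induct) (simp_all add: pscale_add_right)

lemma poly_decomp: "p = (\<Sum>w\<in>Poly_Mapping.keys p. pscale (Poly_Mapping.lookup p w) (basis_elt w))"
proof (rule poly_mapping_eqI)
  fix v
  have "Poly_Mapping.lookup (\<Sum>w\<in>Poly_Mapping.keys p. pscale (Poly_Mapping.lookup p w) (basis_elt w)) v
      = (\<Sum>w\<in>Poly_Mapping.keys p. if w = v then Poly_Mapping.lookup p v else 0)"
    unfolding lookup_sum by (rule sum.cong) (auto simp: basis_elt_def lookup_single when_def)
  then show "Poly_Mapping.lookup p v
      = Poly_Mapping.lookup (\<Sum>w\<in>Poly_Mapping.keys p. pscale (Poly_Mapping.lookup p w) (basis_elt w)) v"
    by (simp add: in_keys_iff)
qed

text \<open>Turns scalars into multiples of the unit, which commute with everything; the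
  compatibility of scalars with products then comes from associativity.\<close>

lemma pscale_single_mult: "pscale c p = Poly_Mapping.single 0 c * (p :: 'a::monoid_add \<Rightarrow>\<^sub>0 complex)"
  and pscale_mult_single: "pscale c p = p * Poly_Mapping.single 0 c"
proof -
  have s: "pscale e (Poly_Mapping.single w d) = Poly_Mapping.single w (e * d)" for d e and w :: 'a
    by (rule poly_mapping_eqI) (simp add: lookup_single when_def)
  have b: "pscale d (basis_elt w) = Poly_Mapping.single w d" for d and w :: 'a
    by (simp add: basis_elt_def s)
  have 1: "pscale c (pscale d (basis_elt w)) = Poly_Mapping.single 0 c * pscale d (basis_elt w)"
    "pscale c (pscale d (basis_elt w)) = pscale d (basis_elt w) * Poly_Mapping.single 0 c" for d and w :: 'a
    by (simp_all add: b s mult_single mult.commute)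
  show "pscale c p = Poly_Mapping.single 0 c * p"
    by (subst (1 2) poly_decomp[of p]) (simp add: pscale_sum_right sum_distrib_left 1(1))
  show "pscale c p = p * Poly_Mapping.single 0 c"
    by (subst (1 2) poly_decomp[of p]) (simp add: pscale_sum_right sum_distrib_right 1(2))
qed

lemma pscale_mult_left: "pscale c p * q = pscale c (p * q)"
  for p q :: "'a::monoid_add \<Rightarrow>\<^sub>0 complex"
  by (simp add: pscale_single_mult mult.assoc)

lemma pscale_mult_right: "p * pscale c q = pscale c (p * q)"
  for p q :: "'a::monoid_add \<Rightarrow>\<^sub>0 complex"
  by (simp add: pscale_mult_single mult.assoc)

text \<open>\<open>slin \<sigma>\<close> covers linear (\<open>\<sigma> = id\<close>) and antilinear (\<open>\<sigma> = cnj\<close>) maps at once.\<close>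

definition slin :: "(complex \<Rightarrow> complex) \<Rightarrow> (('a \<Rightarrow>\<^sub>0 complex) \<Rightarrow> ('b \<Rightarrow>\<^sub>0 complex)) \<Rightarrow> bool" where
  "slin \<sigma> f \<longleftrightarrow> (\<forall>p q. f (p + q) = f p + f q) \<and> (\<forall>c p. f (pscale c p) = pscale (\<sigma> c) (f p))"

lemma slin_add: "slin \<sigma> f \<Longrightarrow> f (p + q) = f p + f q"
  and slin_scale: "slin \<sigma> f \<Longrightarrow> f (pscale c p) = pscale (\<sigma> c) (f p)"
  by (auto simp: slin_def)

lemma slin_zero: "slin \<sigma> f \<Longrightarrow> f 0 = 0"
  using slin_add[of \<sigma> f 0 0] by simp

lemma slin_diff: "slin \<sigma> f \<Longrightarrow> f (p - q) = f p - f q"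
  using slin_add[of \<sigma> f "p - q" q] by simp

lemma slin_minus: "slin \<sigma> f \<Longrightarrow> f (- q) = - f q"
  using slin_diff[of \<sigma> f 0 q] by (simp add: slin_zero)

lemma slin_sum: "slin \<sigma> f \<Longrightarrow> f (\<Sum>i\<in>I. g i) = (\<Sum>i\<in>I. f (g i))"
  by (induction I rule: infinite_finite_induct) (simp_all add: slin_zero slin_add)

text \<open>With this rule identities in several arguments are verified on words, one argument at a
  time.\<close>

lemma slin_eqI:
  assumes f: "slin \<sigma> f" and g: "slin \<sigma> g" and eq: "\<And>w. f (basis_elt w) = g (basis_elt w)"
  shows "f p = g p"
  by (subst (1 2) poly_decomp[of p]) (simp add: slin_sum[OF f] slin_sum[OF g] slin_scale[OF f] slin_scale[OF g] eq)

text \<open>Cancellation can shrink the support of p + q, so all three sums are moved to the union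
  of the supports. The summand is general in order to cover linear, antilinear and operator-valued
  extensions alike.\<close>

lemma sum_keys_add:
  fixes F :: "complex \<Rightarrow> 'a \<Rightarrow> 'v::ab_group_add"
  assumes F: "\<And>c d w. F (c + d) w = F c w + F d w"
  shows "(\<Sum>w\<in>Poly_Mapping.keys (p + q). F (Poly_Mapping.lookup (p + q) w) w)
    = (\<Sum>w\<in>Poly_Mapping.keys p. F (Poly_Mapping.lookup p w) w) + (\<Sum>w\<in>Poly_Mapping.keys q. F (Poly_Mapping.lookup q w) w)"
proof -
  have F0: "F 0 w = 0" for w using F[of 0 0 w] by simp
  let ?K = "Poly_Mapping.keys p \<union> Poly_Mapping.keys q"
  have K: "(\<Sum>w\<in>Poly_Mapping.keys r. F (Poly_Mapping.lookup r w) w) = (\<Sum>w\<in>?K. F (Poly_Mapping.lookup r w) w)"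
    if "Poly_Mapping.keys r \<subseteq> ?K" for r
    using that by (intro sum.mono_neutral_left) (auto simp: in_keys_iff F0)
  show ?thesis
    using Poly_Mapping.keys_add[of p q]
    by (simp only: K Un_upper1 Un_upper2) (simp add: lookup_add F sum.distrib)
qed

lemma sum_keys_scale:
  fixes F :: "complex \<Rightarrow> 'a \<Rightarrow> 'v::ab_group_add"
  assumes F: "\<And>w. F 0 w = 0"
  shows "(\<Sum>w\<in>Poly_Mapping.keys (pscale c p). F (Poly_Mapping.lookup (pscale c p) w) w)
    = (\<Sum>w\<in>Poly_Mapping.keys p. F (c * Poly_Mapping.lookup p w) w)"
proof -
  have "(\<Sum>w\<in>Poly_Mapping.keys (pscale c p). F (Poly_Mapping.lookup (pscale c p) w) w)
    = (\<Sum>w\<in>Poly_Mapping.keys p. F (Poly_Mapping.lookup (pscale c p) w) w)"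
    by (intro sum.mono_neutral_left) (auto simp: in_keys_iff F)
  then show ?thesis by simp
qed

lemma keys_basis_elt [simp]: "Poly_Mapping.keys (basis_elt w) = {w}"
  by (simp add: basis_elt_def)

lemma lookup_basis_elt [simp]: "Poly_Mapping.lookup (basis_elt w) w = 1"
  by (simp add: basis_elt_def)

lemma lin_ext_basis [simp]: "lin_ext g (basis_elt w) = g w"
  and antilin_ext_basis [simp]: "antilin_ext g (basis_elt w) = g w"
  by (simp_all add: lin_ext_def antilin_ext_def)

lemma slin_lin_ext: "slin id (lin_ext g)"
  unfolding slin_def lin_ext_def
  using sum_keys_add[of "\<lambda>c w. pscale c (g w)"] sum_keys_scale[of "\<lambda>c w. pscale c (g w)"]
  by (simp add: pscale_add_left pscale_sum_right pscale_pscale)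

lemma slin_antilin_ext: "slin cnj (antilin_ext g)"
  unfolding slin_def antilin_ext_def
  using sum_keys_add[of "\<lambda>c w. pscale (cnj c) (g w)"] sum_keys_scale[of "\<lambda>c w. pscale (cnj c) (g w)"]
  by (simp add: pscale_add_left pscale_sum_right pscale_pscale)

lemma slin_id: "slin id (\<lambda>p. p)" by (simp add: slin_def)

lemma slin_plus: "slin \<sigma> f \<Longrightarrow> slin \<sigma> g \<Longrightarrow> slin \<sigma> (\<lambda>p. f p + g p)"
  by (simp add: slin_def pscale_add_right algebra_simps)

lemma slin_neg: "slin \<sigma> f \<Longrightarrow> slin \<sigma> (\<lambda>p. - f p)"
  by (simp add: slin_def pscale_minus_right)

lemma slin_minus2: "slin \<sigma> f \<Longrightarrow> slin \<sigma> g \<Longrightarrow> slin \<sigma> (\<lambda>p. f p - g p)"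
  by (simp add: slin_def pscale_diff_right)

lemma slin_setsum: "(\<And>i. slin \<sigma> (f i)) \<Longrightarrow> slin \<sigma> (\<lambda>p. \<Sum>i\<in>I. f i p)"
  by (simp add: slin_def sum.distrib pscale_sum_right)

lemma slin_pscale: "slin \<sigma> f \<Longrightarrow> slin \<sigma> (\<lambda>p. pscale c (f p))"
  by (simp add: slin_def pscale_add_right pscale_pscale mult.commute)

lemma slin_mult_left: "slin \<sigma> f \<Longrightarrow> slin \<sigma> (\<lambda>p. a * f p)"
  and slin_mult_right: "slin \<sigma> f \<Longrightarrow> slin \<sigma> (\<lambda>p. f p * a)"
  for a :: "'b::monoid_add \<Rightarrow>\<^sub>0 complex"
  by (simp_all add: slin_def distrib_left distrib_right pscale_mult_left pscale_mult_right)

lemma slin_lin: "slin id f \<Longrightarrow> slin \<sigma> g \<Longrightarrow> slin \<sigma> (\<lambda>p. f (g p))"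
  by (simp add: slin_def)

lemma slin_antilin: "slin cnj f \<Longrightarrow> slin id g \<Longrightarrow> slin cnj (\<lambda>p. f (g p))"
  by (simp add: slin_def)

lemma slin_antilin2: "slin cnj f \<Longrightarrow> slin cnj g \<Longrightarrow> slin id (\<lambda>p. f (g p))"
  by (simp add: slin_def)

lemma slin_fdq: "slin id (fdq i)"
  and slin_cyclic: "slin id (cyclic_deriv i)"
  and slin_fdq_Id: "slin id (fdq_Id i)"
  and slin_eta_bar: "slin id (eta_bar \<omega>)"
  and slin_gen_env: "slin id (gen_env \<omega> V)"
  and slin_slice: "slin id (slice \<omega>)"
  and slin_sharp: "slin id (\<lambda>z. sharp z c)"
  and slin_tensor_left: "slin id (\<lambda>a. tensor a b)"
  and slin_pstar: "slin cnj pstar"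
  and slin_estar: "slin cnj estar"
  unfolding fdq_def cyclic_deriv_def fdq_Id_def eta_bar_def gen_env_def slice_def sharp_def tensor_def
    pstar_def estar_def
  by (rule slin_lin_ext slin_antilin_ext)+

lemma slin_tensor_right: "slin id (tensor a)"
  unfolding tensor_def slin_def lin_ext_def[of _ a]
  by (simp add: slin_add[OF slin_lin_ext] slin_scale[OF slin_lin_ext] pscale_add_right sum.distrib
      pscale_sum_right pscale_pscale mult.commute)

lemmas slin_intros = slin_id slin_plus slin_neg slin_minus2 slin_setsum slin_pscale slin_mult_left slin_mult_right
  slin_lin[OF slin_fdq] slin_lin[OF slin_cyclic] slin_lin[OF slin_fdq_Id] slin_lin[OF slin_eta_bar]
  slin_lin[OF slin_gen_env] slin_lin[OF slin_slice] slin_lin[OF slin_sharp]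
  slin_lin[OF slin_tensor_left] slin_lin[OF slin_tensor_right] slin_pstar slin_estar

lemma slin_gen_poly: "slin id (gen_poly \<omega> V)"
  unfolding gen_poly_def Laplacian_def by (intro slin_intros)

section \<open>Words\<close>

lemma basis_append: "basis_elt (u @ v) = basis_elt u * basis_elt (v :: 'm list)"
  by (simp add: basis_elt_def mult_single plus_list_def)

lemma basis_Nil: "basis_elt ([] :: 'm list) = 1"
  by (simp add: basis_elt_def zero_list_def[symmetric])

lemma basis_BiWord_mult:
  "basis_elt (BiWord u v) * basis_elt (BiWord u' v') = basis_elt (BiWord (u' @ u) (v @ v'))"
  by (simp add: basis_elt_def mult_single)

lemma tensor_basis: "tensor (basis_elt u) (basis_elt v) = basis_elt (BiWord u v)"
  by (simp add: tensor_def)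

lemma pstar_basis [simp]: "pstar (basis_elt w) = basis_elt (rev w)"
  by (simp add: pstar_def)

lemma estar_basis [simp]: "estar (basis_elt (BiWord u v)) = basis_elt (BiWord (rev u) (rev v))"
  by (simp add: estar_def)

lemma slice_basis [simp]: "slice \<omega> (basis_elt (BiWord u v)) = pscale (\<omega> (basis_elt u)) (basis_elt v)"
  by (simp add: slice_def)

lemma gen_env_basis: "gen_env \<omega> V (basis_elt (BiWord u v))
    = tensor (gen_poly \<omega> V (basis_elt u)) (basis_elt v) + tensor (basis_elt u) (gen_poly \<omega> V (basis_elt v))"
  by (simp add: gen_env_def)

lemma tensor_mult: "tensor a b * tensor c d = tensor (c * a) (b * d)"
proof -
  have 1: "tensor (basis_elt u) (basis_elt v) * tensor (basis_elt u') (basis_elt v')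
      = tensor (basis_elt u' * basis_elt u) (basis_elt v * basis_elt v')" for u v u' v' :: "'a list"
    by (simp add: tensor_basis basis_BiWord_mult basis_append[symmetric])
  have 2: "tensor a (basis_elt v) * tensor (basis_elt u') (basis_elt v')
      = tensor (basis_elt u' * a) (basis_elt v * basis_elt v')" for v u' v'
    by (rule slin_eqI[where \<sigma>=id and p=a]; (intro slin_intros | rule 1))
  have 3: "tensor a b * tensor (basis_elt u') (basis_elt v')
      = tensor (basis_elt u' * a) (b * basis_elt v')" for u' v'
    by (rule slin_eqI[where \<sigma>=id and p=b]; (intro slin_intros | rule 2))
  have 4: "tensor a b * tensor c (basis_elt v') = tensor (c * a) (b * basis_elt v')" for v'
    by (rule slin_eqI[where \<sigma>=id and p=c]; (intro slin_intros | rule 3))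
  show ?thesis by (rule slin_eqI[where \<sigma>=id and p=d]; (intro slin_intros | rule 4))
qed

lemma pstar_mult: "pstar (p * q) = pstar q * pstar p"
proof -
  have 1: "pstar (basis_elt u * basis_elt v) = pstar (basis_elt v) * pstar (basis_elt u)" for u v :: "'a list"
    by (simp add: basis_append[symmetric])
  have 2: "pstar (p * basis_elt v) = pstar (basis_elt v) * pstar p" for v
    by (rule slin_eqI[where \<sigma>=cnj and p=p]; (intro slin_intros slin_antilin[OF slin_pstar] | rule 1))
  show ?thesis
    by (rule slin_eqI[where \<sigma>=cnj and p=q]; (intro slin_intros slin_antilin[OF slin_pstar] | rule 2))
qed

lemma estar_tensor: "estar (tensor p q) = tensor (pstar p) (pstar q)"
proof -
  have 1: "estar (tensor (basis_elt u) (basis_elt v)) = tensor (pstar (basis_elt u)) (pstar (basis_elt v))"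
    for u v :: "'a list"
    by (simp add: tensor_basis)
  have 2: "estar (tensor p (basis_elt v)) = tensor (pstar p) (pstar (basis_elt v))" for v
    by (rule slin_eqI[where \<sigma>=cnj and p=p]; (intro slin_intros slin_antilin[OF slin_estar] | rule 1))
  show ?thesis
    by (rule slin_eqI[where \<sigma>=cnj and p=q]; (intro slin_intros slin_antilin[OF slin_estar] | rule 2))
qed

text \<open>The sum of \<open>f u v\<close> over all factorisations \<open>w = u j v\<close>.\<close>

definition ssum :: "'m \<Rightarrow> 'm list \<Rightarrow> ('m list \<Rightarrow> 'm list \<Rightarrow> 'v::comm_monoid_add) \<Rightarrow> 'v" where
  "ssum j w f = (\<Sum>k | k < length w \<and> w ! k = j. f (take k w) (drop (Suc k) w))"

lemma ssum_Nil [simp]: "ssum j [] f = 0"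
  by (simp add: ssum_def)

text \<open>Trades positions for recursion on the word, which makes the rules on concatenation,
  reversal and iterated splitting provable by induction.\<close>

lemma ssum_Cons: "ssum j (a # w) f = (if a = j then f [] w else 0) + ssum j w (\<lambda>u v. f (a # u) v)"
proof -
  have eq: "ssum j w f = (\<Sum>k<length w. if w ! k = j then f (take k w) (drop (Suc k) w) else 0)" for w f
    unfolding ssum_def by (subst sum.inter_filter[symmetric]) (auto intro: sum.cong)
  show ?thesis
    unfolding eq length_Cons sum.lessThan_Suc_shift by (simp cong: if_cong)
qed

lemma ssum_plus: "ssum j w (\<lambda>u v. f u v + g u v) = ssum j w f + ssum j w g"
  by (simp add: ssum_def sum.distrib)

lemma ssum_hom:
  assumes "h 0 = 0" "\<And>a b. h (a + b) = h a + h b"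
  shows "h (ssum j w f) = ssum j w (\<lambda>u v. h (f u v))"
  by (induction w arbitrary: f) (simp_all add: assms ssum_Cons)

lemma ssum_slin: "slin \<sigma> h \<Longrightarrow> h (ssum j w f) = ssum j w (\<lambda>u v. h (f u v))"
  by (rule ssum_hom) (simp_all add: slin_zero slin_add)

lemma ssum_append: "ssum j (a @ b) f = ssum j a (\<lambda>u v. f u (v @ b)) + ssum j b (\<lambda>u v. f (a @ u) v)"
  by (induction a arbitrary: f) (simp_all add: ssum_Cons add.assoc)

lemma ssum_rev: "ssum j (rev w) f = ssum j w (\<lambda>u v. f (rev v) (rev u))"
  by (induction w arbitrary: f) (simp_all add: ssum_Cons ssum_append add.commute)

lemma ssum_swap: "ssum i u (\<lambda>p q. ssum j v (\<lambda>r s. f p q r s)) = ssum j v (\<lambda>r s. ssum i u (\<lambda>p q. f p q r s))"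
  unfolding ssum_def by (rule sum.swap)

text \<open>Both sides run over the factorisations \<open>w = u i p j q\<close>; this is the
  coassociativity of the free difference quotient.\<close>

lemma ssum_coassoc: "ssum i w (\<lambda>u v. ssum j v (\<lambda>p q. f u p q)) = ssum j w (\<lambda>u v. ssum i u (\<lambda>p q. f p q v))"
  by (induction w arbitrary: f) (simp_all add: ssum_Cons ssum_plus, auto simp: ssum_def)

lemma fdq_word: "fdq i (basis_elt w) = ssum i w (\<lambda>u v. basis_elt (BiWord u v))"
  by (simp add: fdq_def ssum_def)

lemma cyclic_word: "cyclic_deriv i (basis_elt w) = ssum i w (\<lambda>u v. basis_elt (v @ u))"
  by (simp add: cyclic_deriv_def ssum_def)

lemma fdq_Id_basis: "fdq_Id i (basis_elt (BiWord w v)) = ssum i w (\<lambda>p q. basis_elt (p, q, v))"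
  by (simp add: fdq_Id_def ssum_def)

text \<open>The picture behind all later computations: the drift replaces a letter j by minus the
  cyclic derivative of V, and the Laplacian deletes two equal letters and turns the block between
  them into a scalar.\<close>

lemma gen_word: "gen_poly \<omega> V (basis_elt w) =
    - (\<Sum>j\<in>UNIV. ssum j w (\<lambda>u v. basis_elt u * cyclic_deriv j V * basis_elt v))
    + pscale 2 (\<Sum>j\<in>UNIV. ssum j w (\<lambda>u v. ssum j u (\<lambda>p q. pscale (\<omega> (basis_elt q)) (basis_elt (p @ v)))))"
proof -
  have "sharp (fdq j (basis_elt w)) c = ssum j w (\<lambda>u v. basis_elt u * c * basis_elt v)" for j c
    unfolding fdq_word ssum_slin[OF slin_sharp] by (simp add: sharp_def)
  moreover have "eta_bar \<omega> (fdq_Id j (fdq j (basis_elt w)))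
      = ssum j w (\<lambda>u v. ssum j u (\<lambda>p q. pscale (\<omega> (basis_elt q)) (basis_elt (p @ v))))" for j
    unfolding fdq_word
    by (simp add: ssum_slin[OF slin_fdq_Id] ssum_slin[OF slin_eta_bar] fdq_Id_basis basis_append)
      (simp add: eta_bar_def)
  ultimately show ?thesis by (simp add: gen_poly_def Laplacian_def)
qed

section \<open>The generator on polynomials\<close>

text \<open>The Leibniz rule. Since the first leg is multiplied in the opposite order, right
  multiplication by p \<otimes> 1 places p to the left of the first leg.\<close>

lemma fdq_mult: "fdq i (p * q) = fdq i p * tensor 1 q + fdq i q * tensor p 1"
proof -
  have 1: "fdq i (basis_elt u * basis_elt v) = fdq i (basis_elt u) * tensor 1 (basis_elt v) + fdq i (basis_elt v) * tensor (basis_elt u) 1"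
    for u v :: "'a list"
  proof -
    have t: "tensor 1 (basis_elt v) = basis_elt (BiWord [] v)" "tensor (basis_elt u) 1 = basis_elt (BiWord u [])"
      by (simp_all add: tensor_basis[symmetric] basis_Nil)
    show ?thesis
      unfolding basis_append[symmetric] fdq_word ssum_append t
        ssum_slin[OF slin_mult_right[OF slin_id]] basis_BiWord_mult by simp
  qed
  have 2: "fdq i (p * basis_elt v) = fdq i p * tensor 1 (basis_elt v) + fdq i (basis_elt v) * tensor p 1" for v
    by (rule slin_eqI[where \<sigma>=id and p=p]; (intro slin_intros | rule 1))
  show ?thesis by (rule slin_eqI[where \<sigma>=id and p=q]; (intro slin_intros | rule 2))
qed

text \<open>The drift is a derivation and leaves no remainder. A pair contracted by the Laplacian
  lies in a, lies in b, or has one letter in each; the remainder collects the last kind.\<close>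

lemma gen_append:
  "gen_poly \<omega> V (basis_elt (a @ b)) = gen_poly \<omega> V (basis_elt a) * basis_elt b + basis_elt a * gen_poly \<omega> V (basis_elt b)
    + pscale 2 (\<Sum>j\<in>UNIV. ssum j b (\<lambda>u v. ssum j a (\<lambda>p q. pscale (\<omega> (basis_elt (q @ u))) (basis_elt (p @ v)))))"
proof -
  have 1: "ssum j (a @ b) (\<lambda>u v. basis_elt u * D * basis_elt v)
      = ssum j a (\<lambda>u v. basis_elt u * D * basis_elt v) * basis_elt b
        + basis_elt a * ssum j b (\<lambda>u v. basis_elt u * D * basis_elt v)" for j D
    unfolding ssum_append basis_append ssum_slin[OF slin_mult_right[OF slin_id]] ssum_slin[OF slin_mult_left[OF slin_id]]
    by (simp add: mult.assoc)
  have 2: "ssum j (a @ b) (\<lambda>u v. ssum j u (\<lambda>p q. pscale (\<omega> (basis_elt q)) (basis_elt (p @ v))))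
      = ssum j a (\<lambda>u v. ssum j u (\<lambda>p q. pscale (\<omega> (basis_elt q)) (basis_elt (p @ v)))) * basis_elt b
      + basis_elt a * ssum j b (\<lambda>u v. ssum j u (\<lambda>p q. pscale (\<omega> (basis_elt q)) (basis_elt (p @ v))))
      + ssum j b (\<lambda>u v. ssum j a (\<lambda>p q. pscale (\<omega> (basis_elt (q @ u))) (basis_elt (p @ v))))" for j
    unfolding ssum_append ssum_plus ssum_slin[OF slin_mult_right[OF slin_id]] ssum_slin[OF slin_mult_left[OF slin_id]]
    by (simp add: pscale_mult_left pscale_mult_right basis_append[symmetric])
  show ?thesis
    unfolding gen_word 1 2 sum.distrib
    by (simp add: distrib_left distrib_right sum_distrib_left sum_distrib_right pscale_add_right pscale_mult_left pscale_mult_right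
        sum.distrib left_diff_distrib right_diff_distrib)
qed

text \<open>A letter i to the left or right of the modified place leaves that place within one leg,
  where \<open>gen_env\<close> acts; a letter i inside the inserted cyclic derivative gives the
  Hessian term. Nothing comes from the contracted block, which has become a scalar, nor from a pair
  separated by i, whose letters lie in different legs.\<close>

lemma fdq_gen_poly:
  "fdq i (gen_poly \<omega> V g) = gen_env \<omega> V (fdq i g) - (\<Sum>j\<in>UNIV. fdq i (cyclic_deriv j V) * fdq j g)"
proof (rule slin_eqI[where \<sigma>=id and p=g])
  fix w
  \<comment> \<open>The letter i is taken to the left of D, inside D, or to its right.\<close>
  have lhs1: "fdq i (basis_elt u * D * basis_elt v) =
      ssum i u (\<lambda>r s. tensor (basis_elt r) (basis_elt s * D * basis_elt v))
      + fdq i D * basis_elt (BiWord u v)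
      + ssum i v (\<lambda>r s. tensor (basis_elt u * D * basis_elt r) (basis_elt s))" for u v and D :: "'a ncpoly"
    unfolding fdq_mult
    by (simp add: fdq_word ssum_slin[OF slin_mult_right[OF slin_id]] distrib_right tensor_basis[symmetric] tensor_mult
        mult.assoc)
  have A: "ssum j w (\<lambda>u v. fdq i (basis_elt u * D * basis_elt v))
      = ssum i w (\<lambda>u v. tensor (ssum j u (\<lambda>r s. basis_elt r * D * basis_elt s)) (basis_elt v))
      + ssum i w (\<lambda>u v. tensor (basis_elt u) (ssum j v (\<lambda>r s. basis_elt r * D * basis_elt s)))
      + fdq i D * fdq j (basis_elt w)" for j and D :: "'a ncpoly"
    unfolding lhs1 ssum_plus ssum_slin[OF slin_tensor_left] ssum_slin[OF slin_tensor_right] fdq_word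
      ssum_slin[OF slin_mult_left[OF slin_id]] ssum_coassoc[of j w i, symmetric] ssum_coassoc[of i w j]
    by (simp add: ssum_coassoc[of i w j])
  \<comment> \<open>The letter i lies to the right of the contracted pair, which is then in the
    first leg, or to its left, which puts the pair in the second leg; coassociativity moves the
    choice of i to the front.\<close>
  have B: "ssum j w (\<lambda>u v. ssum j u (\<lambda>p q. pscale (\<omega> (basis_elt q)) (fdq i (basis_elt (p @ v)))))
      = ssum i w (\<lambda>u v. tensor (ssum j u (\<lambda>x y. ssum j x (\<lambda>p q. pscale (\<omega> (basis_elt q)) (basis_elt (p @ y))))) (basis_elt v))
      + ssum i w (\<lambda>u v. tensor (basis_elt u) (ssum j v (\<lambda>x y. ssum j x (\<lambda>p q. pscale (\<omega> (basis_elt q)) (basis_elt (p @ y))))))"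
    (is "?l = ?r1 + ?r2") for j
  proof -
    let ?c = "\<lambda>q. \<omega> (basis_elt q)"
    have "?l = ssum j w (\<lambda>u v. ssum j u (\<lambda>p q. ssum i p (\<lambda>r s. pscale (?c q) (basis_elt (BiWord r (s @ v))))))
        + ssum j w (\<lambda>u v. ssum j u (\<lambda>p q. ssum i v (\<lambda>r s. pscale (?c q) (basis_elt (BiWord (p @ r) s)))))"
      by (simp add: fdq_word ssum_append pscale_add_right ssum_plus ssum_slin[OF slin_pscale[OF slin_id]])
    also have "ssum j w (\<lambda>u v. ssum j u (\<lambda>p q. ssum i p (\<lambda>r s. pscale (?c q) (basis_elt (BiWord r (s @ v)))))) = ?r2"
    proof -
      have "?r2 = ssum i w (\<lambda>u v. ssum j v (\<lambda>x y. ssum j x (\<lambda>p q. pscale (?c q) (basis_elt (BiWord u (p @ y))))))"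
        by (simp add: ssum_slin[OF slin_tensor_right] slin_scale[OF slin_tensor_right] tensor_basis)
      also have "\<dots> = ssum j w (\<lambda>u v. ssum i u (\<lambda>r x. ssum j x (\<lambda>p q. pscale (?c q) (basis_elt (BiWord r (p @ v))))))"
        by (rule ssum_coassoc)
      also have "\<dots> = ssum j w (\<lambda>u v. ssum j u (\<lambda>x q. ssum i x (\<lambda>r p. pscale (?c q) (basis_elt (BiWord r (p @ v))))))"
        by (subst ssum_coassoc) simp
      finally show ?thesis by simp
    qed
    also have "ssum j w (\<lambda>u v. ssum j u (\<lambda>p q. ssum i v (\<lambda>r s. pscale (?c q) (basis_elt (BiWord (p @ r) s))))) = ?r1"
    proof -
      have "?r1 = ssum i w (\<lambda>u v. ssum j u (\<lambda>x y. ssum j x (\<lambda>p q. pscale (?c q) (basis_elt (BiWord (p @ y) v)))))"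
        by (simp add: ssum_slin[OF slin_tensor_left] slin_scale[OF slin_tensor_left] tensor_basis)
      also have "\<dots> = ssum j w (\<lambda>u v. ssum i v (\<lambda>r s. ssum j u (\<lambda>p q. pscale (?c q) (basis_elt (BiWord (p @ r) s)))))"
        by (rule ssum_coassoc[symmetric])
      finally show ?thesis by (subst ssum_swap) simp
    qed
    finally show ?thesis by (simp add: add.commute)
  qed
  have "fdq i (gen_poly \<omega> V (basis_elt w)) =
     - (\<Sum>j\<in>UNIV. ssum j w (\<lambda>u v. fdq i (basis_elt u * cyclic_deriv j V * basis_elt v)))
    + pscale 2 (\<Sum>j\<in>UNIV. ssum j w (\<lambda>u v. ssum j u (\<lambda>p q. pscale (\<omega> (basis_elt q)) (fdq i (basis_elt (p @ v))))))"
    unfolding gen_word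
    by (simp add: slin_add[OF slin_fdq] slin_diff[OF slin_fdq] slin_sum[OF slin_fdq] slin_scale[OF slin_fdq]
        ssum_slin[OF slin_fdq])
  moreover have "gen_env \<omega> V (fdq i (basis_elt w)) =
      - (\<Sum>j\<in>UNIV. ssum i w (\<lambda>u v. tensor (ssum j u (\<lambda>r s. basis_elt r * cyclic_deriv j V * basis_elt s)) (basis_elt v)))
      + pscale 2 (\<Sum>j\<in>UNIV. ssum i w (\<lambda>u v. tensor (ssum j u (\<lambda>x y. ssum j x (\<lambda>p q. pscale (\<omega> (basis_elt q)) (basis_elt (p @ y))))) (basis_elt v)))
      + (- (\<Sum>j\<in>UNIV. ssum i w (\<lambda>u v. tensor (basis_elt u) (ssum j v (\<lambda>r s. basis_elt r * cyclic_deriv j V * basis_elt s))))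
      + pscale 2 (\<Sum>j\<in>UNIV. ssum i w (\<lambda>u v. tensor (basis_elt u) (ssum j v (\<lambda>x y. ssum j x (\<lambda>p q. pscale (\<omega> (basis_elt q)) (basis_elt (p @ y))))))))"
  proof -
    have swap: "ssum i w (\<lambda>u v. - (\<Sum>j\<in>UNIV. f j u v) + pscale 2 (\<Sum>j\<in>UNIV. g j u v))
       = - (\<Sum>j\<in>UNIV. ssum i w (f j)) + pscale 2 (\<Sum>j\<in>UNIV. ssum i w (g j))"
      for f g :: "'a \<Rightarrow> 'a list \<Rightarrow> 'a list \<Rightarrow> 'a envpoly"
      unfolding ssum_def by (simp add: sum.distrib sum_negf pscale_sum_right) (simp only: sum.swap[of _ _ UNIV] sum_subtractf)
    show ?thesis
      unfolding fdq_word ssum_slin[OF slin_gen_env] gen_env_basis gen_word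
        slin_add[OF slin_tensor_left] slin_minus[OF slin_tensor_left] slin_scale[OF slin_tensor_left] slin_sum[OF slin_tensor_left]
        slin_add[OF slin_tensor_right] slin_minus[OF slin_tensor_right] slin_scale[OF slin_tensor_right] slin_sum[OF slin_tensor_right]
        id_apply ssum_plus[where f="\<lambda>u v. - f u v + g u v" for f g]
      by (simp only: swap)
  qed
  ultimately show "fdq i (gen_poly \<omega> V (basis_elt w)) = gen_env \<omega> V (fdq i (basis_elt w))
      - (\<Sum>j\<in>UNIV. fdq i (cyclic_deriv j V) * fdq j (basis_elt w))"
    unfolding A B by (simp add: sum.distrib pscale_add_right)
qed (intro slin_intros slin_lin[OF slin_gen_poly])+

text \<open>Twice the carre du champ of \<open>gen_env\<close>.\<close>

definition env_carre :: "('m::finite ncpoly \<Rightarrow> complex) \<Rightarrow> 'm ncpoly \<Rightarrow> 'm envpoly \<Rightarrow> 'm envpoly \<Rightarrow> 'm envpoly" where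
  "env_carre \<omega> V x y = gen_env \<omega> V (estar x * y) - estar x * gen_env \<omega> V y - estar (gen_env \<omega> V x) * y"

lemma env_carre_antilinear: "slin cnj (\<lambda>x. env_carre \<omega> V x y)"
  unfolding env_carre_def by (intro slin_intros slin_antilin[OF slin_estar])

lemma env_carre_linear: "slin id (env_carre \<omega> V x)"
  unfolding env_carre_def by (intro slin_intros)

text \<open>Bochner's formula: by \<open>fdq_gen_poly\<close> the commutator of the gradient with the generator is
  minus the Hessian of \<open>V\<close>.\<close>

lemma bochner:
  "Gamma2_t_poly \<omega> V a a - pscale (of_real K) (Gamma_t_poly a a)
    = pscale (1/2) (\<Sum>i\<in>UNIV. env_carre \<omega> V (fdq i a) (fdq i a)) + Q_form V K (grad a)"
proof -
  let ?L = "gen_env \<omega> V" and ?x = "\<lambda>i. fdq i a"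
  define T where "T i = (\<Sum>j\<in>UNIV. fdq i (cyclic_deriv j V) * fdq j a)" for i
  have g: "fdq i (gen_poly \<omega> V a) = ?L (?x i) - T i" for i by (simp add: fdq_gen_poly T_def)
  have T: "T_vec V (grad a) = T" by (rule ext) (simp add: T_vec_def T_def grad_def)
  have e: "(\<Sum>i\<in>UNIV. env_carre \<omega> V (?x i) (?x i)) = ?L (\<Sum>i\<in>UNIV. estar (?x i) * ?x i)
      - (\<Sum>i\<in>UNIV. estar (?x i) * ?L (?x i)) - (\<Sum>i\<in>UNIV. estar (?L (?x i)) * ?x i)"
    by (simp add: env_carre_def sum_subtractf slin_sum[OF slin_gen_env])
  have "Gamma2_t_poly \<omega> V a a = pscale (1/2) (?L (\<Sum>i\<in>UNIV. estar (?x i) * ?x i)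
      - (\<Sum>i\<in>UNIV. estar (?x i) * (?L (?x i) - T i)) - (\<Sum>i\<in>UNIV. estar (?L (?x i) - T i) * ?x i))"
    by (simp add: Gamma2_t_poly_def Gamma_t_poly_def edot_def grad_def g)
  also have "\<dots> = pscale (1/2) (\<Sum>i\<in>UNIV. env_carre \<omega> V (?x i) (?x i))
      + pscale (1/2) ((\<Sum>i\<in>UNIV. estar (?x i) * T i) + (\<Sum>i\<in>UNIV. estar (T i) * ?x i))"
    unfolding e pscale_add_right[symmetric] slin_diff[OF slin_estar] right_diff_distrib left_diff_distrib sum_subtractf
    by (simp add: algebra_simps)
  finally show ?thesis
    by (simp add: Q_form_def Gamma_t_poly_def edot_def grad_def T)
qed

text \<open>The vector \<open>\<kappa> w\<close> stands for the class of the word w in L^2. Through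
  \<open>gram\<close> the value of \<omega> on a contracted block becomes an entry of a Gram matrix,
  which is what the Schur product argument consumes.\<close>

locale polynomial_trace =
  fixes \<omega> :: "'m::finite ncpoly \<Rightarrow> complex" and V :: "'m ncpoly"
    and \<kappa> :: "'m list \<Rightarrow> 'l::chilbert"
  assumes \<omega>_add: "\<omega> (p + q) = \<omega> p + \<omega> q"
    and \<omega>_scale: "\<omega> (pscale c p) = c * \<omega> p"
    and \<omega>_trace: "\<omega> (basis_elt (u @ v)) = \<omega> (basis_elt (v @ u))"
    and gram: "\<omega> (basis_elt (rev u @ v)) = cinner (\<kappa> u) (\<kappa> v)"
    and V_star: "pstar V = V"
begin

lemma \<omega>_rev: "\<omega> (basis_elt (rev w)) = cnj (\<omega> (basis_elt w))"
  using gram[of w "[]"] gram[of "[]" w] cinner_commute[of "\<kappa> w" "\<kappa> []"] by simp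

text \<open>Reversal carries \<open>u j v\<close> to \<open>rev v j rev u\<close>, whose
  contribution \<open>rev u @ rev v\<close> is the reverse of \<open>v @ u\<close>. Hence the cyclic
  derivative commutes with the involution, which fixes V.\<close>

lemma pstar_cyclic: "pstar (cyclic_deriv j V) = cyclic_deriv j V"
proof -
  have "pstar (cyclic_deriv j (pstar p)) = cyclic_deriv j p" for p :: "'m ncpoly"
  proof (rule slin_eqI[where \<sigma>=id and p=p])
    show "slin id (\<lambda>p. pstar (cyclic_deriv j (pstar p)))"
      by (intro slin_antilin2[OF slin_pstar] slin_lin[OF slin_cyclic] slin_pstar)
  qed (simp_all add: slin_cyclic cyclic_word ssum_rev ssum_slin[OF slin_pstar])
  from this[of V] show ?thesis by (simp add: V_star)
qed

lemma pstar_gen_word: "pstar (gen_poly \<omega> V (basis_elt w)) = gen_poly \<omega> V (basis_elt (rev w))"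
proof -
  \<comment> \<open>Reversal makes the second letter of a contracted pair the one chosen first;
    coassociativity with equal letters restores the order.\<close>
  have 2: "ssum j w (\<lambda>u v. ssum j u (\<lambda>p q. f p q v)) = ssum j w (\<lambda>u v. ssum j v (\<lambda>p q. f u p q))"
    for j and f :: "'m list \<Rightarrow> 'm list \<Rightarrow> 'm list \<Rightarrow> 'm ncpoly"
    by (rule ssum_coassoc[symmetric])
  show ?thesis
    unfolding gen_word
    by (simp add: slin_add[OF slin_pstar] slin_diff[OF slin_pstar] slin_sum[OF slin_pstar] slin_scale[OF slin_pstar]
        ssum_slin[OF slin_pstar] pstar_mult pstar_cyclic ssum_rev mult.assoc \<omega>_rev 2)
qed

lemma estar_gen_env_basis:
  "estar (gen_env \<omega> V (basis_elt (BiWord u v))) = gen_env \<omega> V (basis_elt (BiWord (rev u) (rev v)))"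
  by (simp add: gen_env_basis slin_add[OF slin_estar] estar_tensor pstar_gen_word)

text \<open>The generator acts on one leg at a time, and by \<open>gen_append\<close> only pairs
  with one letter in each factor survive. In the first leg the opposite order gives the block
  \<open>q @ rev v\<close>, which traciality rotates into an inner product; in the second leg the
  block is \<open>rev u @ p\<close> and already has that form.\<close>

lemma env_carre_basis:
  "env_carre \<omega> V (basis_elt (BiWord a b)) (basis_elt (BiWord c d)) = pscale 2 (\<Sum>j\<in>UNIV.
      ssum j a (\<lambda>u v. ssum j c (\<lambda>p q. pscale (cinner (\<kappa> v) (\<kappa> q))
        (estar (basis_elt (BiWord u b)) * basis_elt (BiWord p d))))
    + ssum j b (\<lambda>u v. ssum j d (\<lambda>p q. pscale (cinner (\<kappa> u) (\<kappa> p))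
        (estar (basis_elt (BiWord a v)) * basis_elt (BiWord c q)))))"
proof -
  let ?L = "gen_poly \<omega> V" and ?e = "basis_elt :: 'm list \<Rightarrow> 'm ncpoly"
  have "env_carre \<omega> V (basis_elt (BiWord a b)) (basis_elt (BiWord c d))
    = tensor (?L (?e (c @ rev a)) - ?L (?e c) * ?e (rev a) - ?e c * ?L (?e (rev a))) (?e (rev b @ d))
    + tensor (?e (c @ rev a)) (?L (?e (rev b @ d)) - ?L (?e (rev b)) * ?e d - ?e (rev b) * ?L (?e d))"
    unfolding env_carre_def estar_gen_env_basis
    by (simp add: basis_BiWord_mult gen_env_basis)
      (simp add: tensor_basis[symmetric] tensor_mult distrib_left distrib_right
        basis_append slin_diff[OF slin_tensor_left] slin_diff[OF slin_tensor_right])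
  also have "?L (?e (c @ rev a)) - ?L (?e c) * ?e (rev a) - ?e c * ?L (?e (rev a))
    = pscale 2 (\<Sum>j\<in>UNIV. ssum j a (\<lambda>u v. ssum j c (\<lambda>p q. pscale (cinner (\<kappa> v) (\<kappa> q)) (?e (p @ rev u)))))"
    unfolding gen_append ssum_rev by (simp add: gram[symmetric] \<omega>_trace[of "rev u" for u])
  also have "?L (?e (rev b @ d)) - ?L (?e (rev b)) * ?e d - ?e (rev b) * ?L (?e d)
    = pscale 2 (\<Sum>j\<in>UNIV. ssum j b (\<lambda>u v. ssum j d (\<lambda>p q. pscale (cinner (\<kappa> u) (\<kappa> p)) (?e (rev v @ q)))))"
    unfolding gen_append ssum_rev
    by (simp add: gram) (subst ssum_swap, simp)
  finally show ?thesis
    by (simp add: slin_scale[OF slin_tensor_left] slin_scale[OF slin_tensor_right] slin_sum[OF slin_tensor_left]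
        slin_sum[OF slin_tensor_right] ssum_slin[OF slin_tensor_left] ssum_slin[OF slin_tensor_right]
        tensor_basis basis_BiWord_mult sum.distrib pscale_add_right)
qed

end

section \<open>Positive functionals on polynomials\<close>

definition flin :: "(('a \<Rightarrow>\<^sub>0 complex) \<Rightarrow> complex) \<Rightarrow> bool" where
  "flin \<phi> \<longleftrightarrow> (\<forall>p q. \<phi> (p + q) = \<phi> p + \<phi> q) \<and> (\<forall>c p. \<phi> (pscale c p) = c * \<phi> p)"

lemma flin_add: "flin \<phi> \<Longrightarrow> \<phi> (p + q) = \<phi> p + \<phi> q"
  and flin_scale: "flin \<phi> \<Longrightarrow> \<phi> (pscale c p) = c * \<phi> p"
  by (auto simp: flin_def)

lemma flin_zero: "flin \<phi> \<Longrightarrow> \<phi> 0 = 0"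
  using flin_add[of \<phi> 0 0] by simp

lemma flin_sum: "flin \<phi> \<Longrightarrow> \<phi> (\<Sum>i\<in>I. g i) = (\<Sum>i\<in>I. \<phi> (g i))"
  by (induction I rule: infinite_finite_induct) (simp_all add: flin_zero flin_add)

lemma flin_ssum: "flin \<phi> \<Longrightarrow> \<phi> (ssum j w f) = ssum j w (\<lambda>u v. \<phi> (f u v))"
  by (rule ssum_hom) (simp_all add: flin_zero flin_add)

lemma flin_slin: "flin \<phi> \<Longrightarrow> slin id f \<Longrightarrow> flin (\<lambda>p. \<phi> (f p))"
  by (simp add: flin_def slin_def)

lemma flin_eqI:
  assumes f: "flin f" and g: "flin g" and eq: "\<And>w. f (basis_elt w) = g (basis_elt w)"
  shows "f p = g p"
  by (subst (1 2) poly_decomp[of p]) (simp add: flin_sum[OF f] flin_sum[OF g] flin_scale[OF f] flin_scale[OF g] eq)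

lemma sesqui_expand:
  assumes F1: "\<And>y. slin cnj (\<lambda>x. F x y)" and F2: "\<And>x. slin id (F x)"
  shows "F p q = (\<Sum>a\<in>Poly_Mapping.keys p. \<Sum>b\<in>Poly_Mapping.keys q.
    pscale (cnj (Poly_Mapping.lookup p a) * Poly_Mapping.lookup q b) (F (basis_elt a) (basis_elt b)))"
proof -
  have "F p q = (\<Sum>a\<in>Poly_Mapping.keys p. pscale (cnj (Poly_Mapping.lookup p a)) (F (basis_elt a) q))"
    by (subst poly_decomp[of p]) (simp add: slin_sum[OF F1] slin_scale[OF F1])
  moreover have "F x q = (\<Sum>b\<in>Poly_Mapping.keys q. pscale (Poly_Mapping.lookup q b) (F x (basis_elt b)))" for x
    by (subst poly_decomp[of q]) (simp add: slin_sum[OF F2] slin_scale[OF F2])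
  ultimately show ?thesis by (simp add: pscale_sum_right pscale_pscale)
qed

text \<open>The Schur lemma is applied to pairs of an index x and a position k in it. Its second
  kernel is positive because a combination of its entries is \<psi> of the square of the element z
  below.\<close>

lemma gram_form_nonneg:
  fixes \<psi> :: "'m envpoly \<Rightarrow> complex" and \<alpha> :: "'x \<Rightarrow> 'k \<Rightarrow> 'l::chilbert"
  assumes \<psi>: "flin \<psi>" and pos: "\<And>z. 0 \<le> \<psi> (estar z * z)"
    and fin: "finite K" "\<And>x. finite (P x)"
  shows "0 \<le> (\<Sum>x\<in>K. \<Sum>y\<in>K. cnj (c x) * c y *
      (\<Sum>k\<in>P x. \<Sum>l\<in>P y. cinner (\<alpha> x k) (\<alpha> y l) * \<psi> (estar (\<beta> x k) * \<beta> y l)))"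
proof -
  let ?I = "Sigma K P"
  let ?H = "\<lambda>i j. cnj (c (fst i)) * c (fst j) * \<psi> (estar (\<beta> (fst i) (snd i)) * \<beta> (fst j) (snd j))"
  have "0 \<le> (\<Sum>i\<in>?I. \<Sum>j\<in>?I. cinner (\<alpha> (fst i) (snd i)) (\<alpha> (fst j) (snd j)) * ?H i j)"
  proof (rule schur_product_nonneg)
    show "finite ?I" by (intro finite_SigmaI fin)
    fix d
    define z where "z = (\<Sum>i\<in>?I. pscale (d i * c (fst i)) (\<beta> (fst i) (snd i)))"
    have "\<psi> (estar z * z) = (\<Sum>i\<in>?I. \<Sum>j\<in>?I. cnj (d i) * d j * ?H i j)"
      unfolding z_def
      by (simp add: slin_sum[OF slin_estar] slin_scale[OF slin_estar] sum_distrib_left sum_distrib_right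
          pscale_mult_left pscale_mult_right flin_sum[OF \<psi>] flin_scale[OF \<psi>] mult.assoc)
        (subst sum.swap, intro sum.cong refl, simp add: algebra_simps)
    then show "0 \<le> (\<Sum>i\<in>?I. \<Sum>j\<in>?I. cnj (d i) * d j * ?H i j)" using pos[of z] by simp
  qed
  also have "\<dots> = (\<Sum>x\<in>K. \<Sum>k\<in>P x. \<Sum>y\<in>K. \<Sum>l\<in>P y. cinner (\<alpha> x k) (\<alpha> y l)
      * (cnj (c x) * c y * \<psi> (estar (\<beta> x k) * \<beta> y l)))"
  proof -
    have S: "(\<Sum>i\<in>?I. f i) = (\<Sum>x\<in>K. \<Sum>k\<in>P x. f (x, k))" for f :: "_ \<Rightarrow> complex"
      using fin by (simp add: sum.Sigma)
    show ?thesis by (simp only: S fst_conv snd_conv)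
  qed
  also have "\<dots> = (\<Sum>x\<in>K. \<Sum>y\<in>K. \<Sum>k\<in>P x. \<Sum>l\<in>P y. cinner (\<alpha> x k) (\<alpha> y l)
      * (cnj (c x) * c y * \<psi> (estar (\<beta> x k) * \<beta> y l)))"
    by (intro sum.cong refl sum.swap)
  finally show ?thesis by (simp add: sum_distrib_left algebra_simps)
qed

context polynomial_trace
begin

lemma slice_tensor: "slice \<omega> (tensor p q) = pscale (\<omega> p) q"
proof -
  have l: "slin id (\<lambda>p. pscale (\<omega> p) q)" for q :: "'m ncpoly"
    by (simp add: slin_def \<omega>_add \<omega>_scale pscale_add_left pscale_pscale)
  have 1: "slice \<omega> (tensor p (basis_elt v)) = pscale (\<omega> p) (basis_elt v)" for v
    by (rule slin_eqI[where \<sigma>=id and p=p]; (intro slin_intros l)?) (simp add: tensor_basis)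
  show ?thesis by (rule slin_eqI[where \<sigma>=id and p=q]; (intro slin_intros | rule 1))
qed

text \<open>On the part of \<open>gen_env\<close> acting in the first leg the slice map takes
  \<omega> of a value of the generator, which vanishes by invariance.\<close>

lemma slice_gen_env:
  assumes inv: "\<And>a. \<omega> (gen_poly \<omega> V a) = 0"
  shows "slice \<omega> (gen_env \<omega> V z) = gen_poly \<omega> V (slice \<omega> z)"
proof (rule slin_eqI[where \<sigma>=id and p=z])
  show "slice \<omega> (gen_env \<omega> V (basis_elt w)) = gen_poly \<omega> V (slice \<omega> (basis_elt w))" for w
    by (cases w) (simp add: gen_env_basis slin_add[OF slin_slice] slice_tensor inv slin_scale[OF slin_gen_poly])
qed (intro slin_intros slin_lin[OF slin_gen_poly])+

text \<open>On words both sides contract a letter of f^* with an equal letter of g and take \<omega>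
  of the block between. In the product of the gradients this block is, up to cyclic rotation, the
  first leg, the one that \<open>slice\<close> integrates.\<close>

lemma Gamma_slice: "Gamma_poly \<omega> V f g = slice \<omega> (Gamma_t_poly f g)"
proof -
  have 1: "Gamma_poly \<omega> V (basis_elt a) (basis_elt b) = slice \<omega> (Gamma_t_poly (basis_elt a) (basis_elt b))" for a b
  proof -
    have "Gamma_poly \<omega> V (basis_elt a) (basis_elt b) =
       (\<Sum>j\<in>UNIV. ssum j b (\<lambda>u v. ssum j a (\<lambda>p q. pscale (\<omega> (basis_elt (rev p @ u))) (basis_elt (rev q @ v)))))"
      by (simp add: Gamma_poly_def pstar_gen_word basis_append[symmetric] gen_append ssum_rev pscale_pscale)
    also have "\<dots> = slice \<omega> (Gamma_t_poly (basis_elt a) (basis_elt b))"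
      unfolding Gamma_t_poly_def edot_def grad_def fdq_word ssum_slin[OF slin_estar] slin_sum[OF slin_slice]
        ssum_slin[OF slin_mult_left[OF slin_id]] ssum_slin[OF slin_mult_right[OF slin_id]] ssum_slin[OF slin_slice]
      by (simp add: basis_BiWord_mult \<omega>_trace[of "rev u" for u])
    finally show ?thesis .
  qed
  have 2: "Gamma_poly \<omega> V f (basis_elt b) = slice \<omega> (Gamma_t_poly f (basis_elt b))" for b
  proof (rule slin_eqI[where \<sigma>=cnj and p=f])
    show "slin cnj (\<lambda>f. Gamma_poly \<omega> V f (basis_elt b))"
      unfolding Gamma_poly_def by (intro slin_intros slin_lin[OF slin_gen_poly] slin_antilin[OF slin_pstar] slin_gen_poly)
    show "slin cnj (\<lambda>f. slice \<omega> (Gamma_t_poly f (basis_elt b)))"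
      unfolding Gamma_t_poly_def edot_def grad_def by (intro slin_intros slin_antilin[OF slin_estar])
  qed (rule 1)
  show ?thesis
  proof (rule slin_eqI[where \<sigma>=id and p=g])
    show "slin id (Gamma_poly \<omega> V f)"
      unfolding Gamma_poly_def by (intro slin_intros slin_lin[OF slin_gen_poly])
    show "slin id (\<lambda>g. slice \<omega> (Gamma_t_poly f g))"
      unfolding Gamma_t_poly_def edot_def grad_def by (intro slin_intros)
  qed (rule 2)
qed

lemma Gamma2_slice:
  assumes inv: "\<And>a. \<omega> (gen_poly \<omega> V a) = 0"
  shows "Gamma2_poly \<omega> V f g = slice \<omega> (Gamma2_t_poly \<omega> V f g)"
  unfolding Gamma2_poly_def Gamma2_t_poly_def Gamma_slice
  by (simp add: slin_scale[OF slin_slice] slin_diff[OF slin_slice] slice_gen_env[OF inv])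

lemma env_carre_nonneg:
  assumes \<psi>: "flin \<psi>" and pos: "\<And>z. 0 \<le> \<psi> (estar z * z)"
  shows "0 \<le> \<psi> (env_carre \<omega> V x x)"
proof -
  define l r where "l = (\<lambda>z :: 'm biword. case z of BiWord u v \<Rightarrow> u)" and "r = (\<lambda>z :: 'm biword. case z of BiWord u v \<Rightarrow> v)"
  define P where "P w j = {k. k < length w \<and> w ! k = j}" for w :: "'m list" and j
  define c where "c = Poly_Mapping.lookup x"
  let ?K = "Poly_Mapping.keys x"
  \<comment> \<open>\<open>?A\<close> collects the contractions in the first leg, weighted by the
    suffixes after the removed letters, and \<open>?B\<close> those in the second leg, weighted by
    the prefixes. For a fixed letter j each is a Gram form.\<close>
  let ?A = "\<lambda>j a b. \<Sum>k\<in>P (l a) j. \<Sum>m\<in>P (l b) j. cinner (\<kappa> (drop (Suc k) (l a))) (\<kappa> (drop (Suc m) (l b)))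
      * \<psi> (estar (basis_elt (BiWord (take k (l a)) (r a))) * basis_elt (BiWord (take m (l b)) (r b)))"
  let ?B = "\<lambda>j a b. \<Sum>k\<in>P (r a) j. \<Sum>m\<in>P (r b) j. cinner (\<kappa> (take k (r a))) (\<kappa> (take m (r b)))
      * \<psi> (estar (basis_elt (BiWord (l a) (drop (Suc k) (r a)))) * basis_elt (BiWord (l b) (drop (Suc m) (r b))))"
  have *: "\<psi> (env_carre \<omega> V (basis_elt a) (basis_elt b)) = 2 * (\<Sum>j\<in>UNIV. ?A j a b + ?B j a b)" for a b
  proof -
    obtain a1 a2 b1 b2 where "a = BiWord a1 a2" "b = BiWord b1 b2" by (metis biword.exhaust)
    then show ?thesis
      unfolding P_def by (simp add: l_def r_def env_carre_basis flin_scale[OF \<psi>] flin_sum[OF \<psi>] flin_add[OF \<psi>]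
          flin_ssum[OF \<psi>] del: estar_basis) (simp add: ssum_def del: estar_basis)
  qed
  have "\<psi> (env_carre \<omega> V x x) = (\<Sum>a\<in>?K. \<Sum>b\<in>?K. cnj (c a) * c b * (2 * (\<Sum>j\<in>UNIV. ?A j a b + ?B j a b)))"
    by (subst sesqui_expand[OF env_carre_antilinear env_carre_linear])
      (simp add: flin_sum[OF \<psi>] flin_scale[OF \<psi>] * c_def)
  also have "\<dots> = 2 * (\<Sum>j\<in>UNIV. (\<Sum>a\<in>?K. \<Sum>b\<in>?K. cnj (c a) * c b * ?A j a b) + (\<Sum>a\<in>?K. \<Sum>b\<in>?K. cnj (c a) * c b * ?B j a b))"
  proof -
    have swap: "(\<Sum>a\<in>?K. \<Sum>b\<in>?K. d a b * (2 * (\<Sum>j\<in>UNIV. A j a b + B j a b)))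
        = 2 * (\<Sum>j\<in>UNIV. (\<Sum>a\<in>?K. \<Sum>b\<in>?K. d a b * A j a b) + (\<Sum>a\<in>?K. \<Sum>b\<in>?K. d a b * B j a b))"
      for d :: "_ \<Rightarrow> _ \<Rightarrow> complex" and A B :: "'m \<Rightarrow> 'm biword \<Rightarrow> 'm biword \<Rightarrow> complex"
    proof -
      have "(\<Sum>a\<in>?K. \<Sum>b\<in>?K. d a b * (2 * (\<Sum>j\<in>UNIV. A j a b + B j a b)))
          = (\<Sum>a\<in>?K. \<Sum>b\<in>?K. \<Sum>j\<in>UNIV. 2 * (d a b * A j a b + d a b * B j a b))"
        by (simp add: sum_distrib_left algebra_simps)
      also have "\<dots> = (\<Sum>a\<in>?K. \<Sum>j\<in>UNIV. \<Sum>b\<in>?K. 2 * (d a b * A j a b + d a b * B j a b))"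
        by (intro sum.cong refl sum.swap)
      also have "\<dots> = (\<Sum>j\<in>UNIV. \<Sum>a\<in>?K. \<Sum>b\<in>?K. 2 * (d a b * A j a b + d a b * B j a b))"
        by (rule sum.swap)
      finally show ?thesis by (simp add: sum_distrib_left sum.distrib distrib_left)
    qed
    show ?thesis by (rule swap)
  qed
  finally have eq: "\<psi> (env_carre \<omega> V x x) = \<dots>" .
  have fin: "finite (P w j)" for w j by (simp add: P_def)
  show ?thesis
    unfolding eq
  proof (rule mult_nonneg_nonneg)
    show "(0::complex) \<le> 2" by (simp add: less_eq_complex_def)
    show "0 \<le> (\<Sum>j\<in>UNIV. (\<Sum>a\<in>?K. \<Sum>b\<in>?K. cnj (c a) * c b * ?A j a b) + (\<Sum>a\<in>?K. \<Sum>b\<in>?K. cnj (c a) * c b * ?B j a b))"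
      by (rule sum_nonneg, rule add_nonneg_nonneg; rule gram_form_nonneg[OF \<psi> pos]; simp add: fin)
  qed
qed

text \<open>The functional is abstract because two are inserted: the trace against a positive
  element of the enveloping algebra, and the trace against a positive element of M after
  slicing.\<close>

lemma bochner_nonneg:
  assumes \<psi>: "flin \<psi>" and pos: "\<And>z. 0 \<le> \<psi> (estar z * z)"
    and Q: "0 \<le> \<psi> (Q_form V K (grad a))"
  shows "0 \<le> \<psi> (Gamma2_t_poly \<omega> V a a - pscale (of_real K) (Gamma_t_poly a a))"
proof -
  have "0 \<le> 1 / 2 * (\<Sum>i\<in>UNIV. \<psi> (env_carre \<omega> V (fdq i a) (fdq i a)))"
    by (intro mult_nonneg_nonneg sum_nonneg env_carre_nonneg[OF \<psi> pos]) (simp add: less_eq_complex_def)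
  then show ?thesis
    unfolding bochner flin_add[OF \<psi>] flin_scale[OF \<psi>] flin_sum[OF \<psi>] using Q by (rule add_nonneg_nonneg)
qed

text \<open>On basis tensors the form is the Schur product of the Gram kernel of the first legs with
  the form given by \<phi> on the second legs.\<close>

lemma slice_positive:
  assumes \<phi>: "flin \<phi>" and pos: "\<And>p. 0 \<le> \<phi> (pstar p * p)"
  shows "0 \<le> \<phi> (slice \<omega> (estar z * z))"
proof -
  define l r where "l = (\<lambda>z :: 'm biword. case z of BiWord u v \<Rightarrow> u)" and "r = (\<lambda>z :: 'm biword. case z of BiWord u v \<Rightarrow> v)"
  let ?K = "Poly_Mapping.keys z" and ?c = "Poly_Mapping.lookup z"
  let ?H = "\<lambda>a b. cnj (?c a) * ?c b * \<phi> (pstar (basis_elt (r a)) * basis_elt (r b))"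
  have b: "\<phi> (slice \<omega> (estar (basis_elt a) * basis_elt b))
      = cinner (\<kappa> (l a)) (\<kappa> (l b)) * \<phi> (pstar (basis_elt (r a)) * basis_elt (r b))" for a b
    by (cases a; cases b) (simp add: basis_BiWord_mult flin_scale[OF \<phi>] gram[symmetric] \<omega>_trace[of "rev u" for u]
        basis_append[symmetric] l_def r_def)
  have "\<phi> (slice \<omega> (estar z * z)) = (\<Sum>a\<in>?K. \<Sum>b\<in>?K. cinner (\<kappa> (l a)) (\<kappa> (l b)) * ?H a b)"
  proof -
    have F: "slin cnj (\<lambda>x. slice \<omega> (estar x * y))" "slin id (\<lambda>y. slice \<omega> (estar x * y))" for x y
      by (intro slin_intros slin_antilin[OF slin_estar])+
    show ?thesis
      by (subst sesqui_expand[of "\<lambda>x y. slice \<omega> (estar x * y)", OF F]) (simp add: flin_sum[OF \<phi>] flin_scale[OF \<phi>] b mult.left_commute)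
  qed
  moreover have "0 \<le> (\<Sum>a\<in>?K. \<Sum>b\<in>?K. cinner (\<kappa> (l a)) (\<kappa> (l b)) * ?H a b)"
  proof (rule schur_product_nonneg)
    fix d
    define p where "p = (\<Sum>a\<in>?K. pscale (d a * ?c a) (basis_elt (r a)))"
    have "\<phi> (pstar p * p) = (\<Sum>a\<in>?K. \<Sum>b\<in>?K. cnj (d a) * d b * ?H a b)"
      unfolding p_def
      by (simp add: slin_sum[OF slin_pstar] slin_scale[OF slin_pstar] sum_distrib_left sum_distrib_right
          pscale_mult_left pscale_mult_right flin_sum[OF \<phi>] flin_scale[OF \<phi>] mult.assoc)
        (subst sum.swap, intro sum.cong refl, simp add: algebra_simps)
    then show "0 \<le> (\<Sum>a\<in>?K. \<Sum>b\<in>?K. cnj (d a) * d b * ?H a b)" using pos[of p] by simp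
  qed simp
  ultimately show ?thesis by simp
qed

end

section \<open>Evaluation\<close>

lemma scale_op_add_left: "scale_op (c + d) A = scale_op c A + scale_op d (A :: 'h::chilbert oper)"
  and scale_op_add_right: "scale_op c (A + B) = scale_op c A + scale_op c B"
  and scale_op_scale_op: "scale_op c (scale_op d A) = scale_op (c * d) A"
  and scale_op_zero_left [simp]: "scale_op 0 A = 0"
  and scale_op_one [simp]: "scale_op 1 A = A"
  and scale_op_zero_right [simp]: "scale_op c (0 :: 'h oper) = 0"
  and scale_op_compose_left: "scale_op c A o\<^sub>L B = scale_op c (A o\<^sub>L B)"
  by (rule blinfun_eqI; simp add: blinfun.add_left scaleC_add_left scaleC_add_right scaleC_scaleC)+

lemma scale_op_compose_right: "A \<in> bop \<Longrightarrow> A o\<^sub>L scale_op c B = scale_op c (A o\<^sub>L B)"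
  by (rule blinfun_eqI) (simp add: bopD)

lemma compose_add_left: "(A + B) o\<^sub>L C = (A o\<^sub>L C) + (B o\<^sub>L C)"
  and compose_add_right: "C o\<^sub>L (A + B) = (C o\<^sub>L A) + (C o\<^sub>L B)"
  by (rule blinfun_eqI; simp add: blinfun.add_left blinfun.add_right)+

lemma oper_compose_assoc: "(A o\<^sub>L B) o\<^sub>L C = A o\<^sub>L (B o\<^sub>L C)"
  by (rule blinfun_eqI) simp

lemma compose_id [simp]: "id_blinfun o\<^sub>L A = A" "A o\<^sub>L id_blinfun = A"
  by (rule blinfun_eqI; simp)+

lemma scale_op_sum: "scale_op c (\<Sum>i\<in>I. f i) = (\<Sum>i\<in>I. scale_op c (f i))"
  by (induction I rule: infinite_finite_induct) (simp_all add: scale_op_add_right)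

definition oslin :: "(complex \<Rightarrow> complex) \<Rightarrow> (('a \<Rightarrow>\<^sub>0 complex) \<Rightarrow> 'h::chilbert oper) \<Rightarrow> bool" where
  "oslin \<sigma> f \<longleftrightarrow> (\<forall>p q. f (p + q) = f p + f q) \<and> (\<forall>c p. f (pscale c p) = scale_op (\<sigma> c) (f p))"

lemma oslin_add: "oslin \<sigma> f \<Longrightarrow> f (p + q) = f p + f q"
  and oslin_scale: "oslin \<sigma> f \<Longrightarrow> f (pscale c p) = scale_op (\<sigma> c) (f p)"
  by (auto simp: oslin_def)

lemma oslin_zero: "oslin \<sigma> f \<Longrightarrow> f 0 = 0"
  using oslin_add[of \<sigma> f 0 0] by simp

lemma oslin_sum: "oslin \<sigma> f \<Longrightarrow> f (\<Sum>i\<in>I. g i) = (\<Sum>i\<in>I. f (g i))"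
  by (induction I rule: infinite_finite_induct) (simp_all add: oslin_zero oslin_add)

lemma oslin_eqI:
  assumes f: "oslin \<sigma> f" and g: "oslin \<sigma> g" and eq: "\<And>w. f (basis_elt w) = g (basis_elt w)"
  shows "f p = g p"
  by (subst (1 2) poly_decomp[of p]) (simp add: oslin_sum[OF f] oslin_sum[OF g] oslin_scale[OF f] oslin_scale[OF g] eq)

text \<open>The common form of \<open>eval_poly\<close> and \<open>eval_env\<close>, so that
  linearity, multiplicativity and adjoints are treated once.\<close>

definition op_eval :: "('a \<Rightarrow> 'h::chilbert oper) \<Rightarrow> ('a \<Rightarrow>\<^sub>0 complex) \<Rightarrow> 'h oper" where
  "op_eval h p = (\<Sum>w\<in>Poly_Mapping.keys p. scale_op (Poly_Mapping.lookup p w) (h w))"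

lemma op_eval_basis [simp]: "op_eval h (basis_elt w) = h w"
  by (simp add: op_eval_def)

lemma oslin_op_eval: "oslin id (op_eval h)"
  unfolding oslin_def op_eval_def
  using sum_keys_add[of "\<lambda>c w. scale_op c (h w)"] sum_keys_scale[of "\<lambda>c w. scale_op c (h w)"]
  by (simp add: scale_op_add_left scale_op_sum scale_op_scale_op)

context tracial_algebra
begin

lemma op_eval_mem: "(\<And>w. h w \<in> N) \<Longrightarrow> op_eval h p \<in> N"
  unfolding op_eval_def by (intro mem_sum mem_scale)

lemma op_eval_mult:
  fixes h :: "'a::monoid_add \<Rightarrow> 'h oper"
  assumes h: "\<And>w. h w \<in> N" and hom: "\<And>u v. h (u + v) = h u o\<^sub>L h v"
  shows "op_eval h (p * q) = op_eval h p o\<^sub>L op_eval h q"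
proof -
  have b: "basis_elt u * basis_elt v = basis_elt (u + v)" for u v :: 'a
    by (simp add: basis_elt_def mult_single)
  have 1: "op_eval h (p * basis_elt v) = op_eval h p o\<^sub>L op_eval h (basis_elt v)" for v
    by (rule oslin_eqI[where \<sigma>=id and p=p])
      (simp_all add: b hom, simp_all add: oslin_def oslin_add[OF oslin_op_eval] oslin_scale[OF oslin_op_eval] distrib_right pscale_mult_left
        compose_add_left scale_op_compose_left)
  show ?thesis
  proof (rule oslin_eqI[where \<sigma>=id and p=q])
    \<comment> \<open>Elements of \<open>oper\<close> are only real-linear; the left factor has to
      lie in \<open>bop\<close> for scalars to pass through it.\<close>
    show "oslin id (\<lambda>q. op_eval h p o\<^sub>L op_eval h q)"
      using mem_bop[OF op_eval_mem[of h, OF h]]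
      by (simp add: oslin_def oslin_add[OF oslin_op_eval] oslin_scale[OF oslin_op_eval]
          compose_add_right scale_op_compose_right)
  qed (rule 1 | simp add: oslin_def oslin_add[OF oslin_op_eval] oslin_scale[OF oslin_op_eval] distrib_left pscale_mult_right)+
qed

lemma op_eval_adj:
  assumes h: "\<And>w. h w \<in> N" and s: "slin cnj s" and hs: "\<And>w. op_eval h (s (basis_elt w)) = adj (h w)"
  shows "op_eval h (s p) = adj (op_eval h p)"
proof (rule oslin_eqI[where \<sigma>=cnj and p=p])
  show "oslin cnj (\<lambda>p. op_eval h (s p))"
    by (simp add: oslin_def slin_add[OF s] slin_scale[OF s] oslin_add[OF oslin_op_eval] oslin_scale[OF oslin_op_eval])
  show "oslin cnj (\<lambda>p. adj (op_eval h p))"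
    using mem_bop[OF op_eval_mem[of h, OF h]]
    by (simp add: oslin_def oslin_add[OF oslin_op_eval] oslin_scale[OF oslin_op_eval] adj_add adj_scale)
qed (simp add: hs)

lemma flin_op_eval:
  assumes h: "\<And>w. h w \<in> N" and B: "B \<in> N"
  shows "flin (\<lambda>p. \<tau> (op_eval h p o\<^sub>L B))"
  by (simp add: flin_def oslin_add[OF oslin_op_eval] oslin_scale[OF oslin_op_eval] compose_add_left
      scale_op_compose_left tau_add tau_scale mem_compose op_eval_mem[of h, OF h] B)

text \<open>Both forms are followed along one sequence that converges for both graph norms. The
  order is tested against a fixed B, so pointwise limits suffice.\<close>

lemma L1_le_extension:
  assumes F: "continuous_extension G \<iota> N \<tau> F0 F" and F': "continuous_extension G' \<iota> N \<tau> F0' F'"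
    and p: "graph_tendsto G (\<lambda>n. \<iota> (p n)) a" and p': "graph_tendsto G' (\<lambda>n. \<iota> (p n)) a"
    and nonneg: "\<And>n B. B \<in> N \<Longrightarrow> pos_op B \<Longrightarrow>
        0 \<le> \<tau> (F0' (p n) (p n) o\<^sub>L B) - of_real K * \<tau> (F0 (p n) (p n) o\<^sub>L B)"
  shows "L1_le N (fscale (of_real K) (F a a)) (F' a a)"
  unfolding L1_le_def
proof (intro ballI impI)
  fix B assume B: "B \<in> N" "pos_op B"
  have lim: "(\<lambda>n. \<tau> (H0 (p n) (p n) o\<^sub>L B)) \<longlonglongrightarrow> H a a B"
    if H: "continuous_extension E \<iota> N \<tau> H0 H" and p: "graph_tendsto E (\<lambda>n. \<iota> (p n)) a"
    for E :: "('v::topological_space \<times> 'w::topological_space) set" and \<iota> a H H0 and p :: "nat \<Rightarrow> 'p"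
  proof -
    have D: "\<iota> (p n) \<in> Domain E" "a \<in> Domain E" for n
      using p unfolding graph_tendsto_def by blast+
    have "(\<lambda>n. H (\<iota> (p n)) (\<iota> (p n)) B) \<longlonglongrightarrow> H a a B"
      using H p D B(1) unfolding continuous_extension_def by (intro L1_tendsto_apply) blast+
    moreover have "H (\<iota> (p n)) (\<iota> (p n)) B = \<tau> (H0 (p n) (p n) o\<^sub>L B)" for n
      using H B(1) by (simp add: continuous_extension_def L1_emb_def)
    ultimately show ?thesis by simp
  qed
  have "(\<lambda>n. \<tau> (F0' (p n) (p n) o\<^sub>L B) - of_real K * \<tau> (F0 (p n) (p n) o\<^sub>L B))
      \<longlonglongrightarrow> F' a a B - of_real K * F a a B" (is "?f \<longlonglongrightarrow> ?l")
    by (intro tendsto_diff tendsto_mult tendsto_const lim[OF F p] lim[OF F' p'])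
  \<comment> \<open>Non-negativity of a complex number includes being real, so the limit is taken in
    real and imaginary parts separately.\<close>
  then have Re: "(\<lambda>n. Re (?f n)) \<longlonglongrightarrow> Re ?l" and Im: "(\<lambda>n. Im (?f n)) \<longlonglongrightarrow> Im ?l"
    by (rule tendsto_Re, rule tendsto_Im)
  have f: "0 \<le> Re (?f n)" "Im (?f n) = 0" for n
    using nonneg[OF B, of n] by (simp_all add: less_eq_complex_def)
  have "0 \<le> Re ?l" by (rule LIMSEQ_le_const[OF Re]) (use f in blast)
  moreover have "Im ?l = 0" using Im unfolding f by (simp add: LIMSEQ_const_iff)
  ultimately show "0 \<le> (F' a a - fscale (of_real K) (F a a)) B"
    by (simp add: fscale_def less_eq_complex_def)
qed

end

lemma eval_poly_eq: "eval_poly y = op_eval (word_op y)"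
  by (rule ext) (simp add: eval_poly_def op_eval_def)

lemma eval_env_eq: "eval_env opt y = op_eval (\<lambda>x. case x of BiWord u v \<Rightarrow> opt (word_op y u) (word_op y v))"
  by (rule ext) (simp add: eval_env_def op_eval_def)

lemma word_op_append: "word_op y (u @ v) = word_op y u o\<^sub>L word_op y v"
  by (induction u) (simp_all add: word_op_def oper_compose_assoc)

lemma word_op_Cons: "word_op y (i # w) = y i o\<^sub>L word_op y w"
  and word_op_Nil: "word_op y [] = id_blinfun"
  by (simp_all add: word_op_def)

lemma word_op_mem:
  assumes "tracial_algebra N \<tau>" "\<And>i. y i \<in> N"
  shows "word_op y w \<in> N"
proof -
  interpret tracial_algebra N \<tau> by fact
  show ?thesis by (induction w) (simp_all add: word_op_Cons word_op_Nil mem_id mem_compose assms)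
qed

section \<open>The opposite tensor product\<close>

lemma
  assumes opt: "opposite_tensor tens opt"
  shows opt_bop: "A \<in> bop \<Longrightarrow> B \<in> bop \<Longrightarrow> opt A B \<in> bop"
    and opt_tens: "A \<in> bop \<Longrightarrow> B \<in> bop \<Longrightarrow> opt A B (tens x y) = tens (adj A x) (B y)"
    and cinner_tens: "cinner (tens x y) (tens x' y') = cinner x' x * cinner y y'"
  using opt unfolding opposite_tensor_def by blast+

lemma tens_dense:
  assumes opt: "opposite_tensor tens opt"
    and f: "bounded_linear f" and g: "bounded_linear g" and eq: "\<And>x y. f (tens x y) = g (tens x y)"
  shows "f z = g z"
proof -
  have "closure (span {tens x y | x y. True}) = UNIV"
    using opt unfolding opposite_tensor_def by blast
  moreover have "closed {z. f z = g z}"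
    by (intro closed_Collect_eq linear_continuous_on f g)
  moreover have "span {tens x y | x y. True} \<subseteq> {z. f z = g z}"
    using linear_eq_on_span[OF bounded_linear.linear[OF f] bounded_linear.linear[OF g], of "{tens x y | x y. True}"] eq
    by blast
  ultimately have "UNIV \<subseteq> {z. f z = g z}" using closure_minimal[of "span {tens x y | x y. True}"] by simp
  then show ?thesis by blast
qed

text \<open>The first leg acts through adjoints, and taking adjoints reverses products; this is
  where the opposite multiplication comes from.\<close>

lemma opt_compose:
  assumes opt: "opposite_tensor tens opt" and b: "A \<in> bop" "B \<in> bop" "C \<in> bop" "D \<in> bop"
  shows "opt A B o\<^sub>L opt C D = opt (C o\<^sub>L A) (B o\<^sub>L D)"
  by (rule blinfun_eqI, rule tens_dense[OF opt blinfun.bounded_linear_right blinfun.bounded_linear_right])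
    (simp add: opt_tens[OF opt] b adj_compose bop_compose)

lemma adj_opt:
  assumes opt: "opposite_tensor tens opt" and b: "A \<in> bop" "B \<in> bop"
  shows "adj (opt A B) = opt (adj A) (adj B)"
proof (rule blinfun_eqI, rule tens_dense[OF opt blinfun.bounded_linear_right blinfun.bounded_linear_right])
  fix x y
  have "cinner (opt (adj A) (adj B) (tens x y)) z = cinner (tens x y) (opt A B z)" for z
    by (rule tens_dense[OF opt bounded_linear_cinner_right
          bounded_linear_compose[OF bounded_linear_cinner_right blinfun.bounded_linear_right]])
      (simp add: opt_tens[OF opt] b adj_bop adj_adj cinner_tens[OF opt] cinner_adj cinner_adj')
  then show "adj (opt A B) (tens x y) = opt (adj A) (adj B) (tens x y)"
    by (intro cinner_eqI') (simp add: cinner_adj opt_bop[OF opt] b)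
qed

section \<open>The Langevin setting\<close>

lemma tracial_algebra_Wstar:
  assumes "von_neumann_algebra N" "faithful_normal_tracial_state N \<tau>" "S \<subseteq> N"
  shows "tracial_algebra (Wstar S) \<tau>"
proof
  have sub: "Wstar S \<subseteq> N" by (rule Wstar_subset) fact+
  have "S \<subseteq> bop" using assms by (auto simp: von_neumann_algebra_def)
  then show "star_algebra (Wstar S)" by (rule star_algebra_Wstar)
  have l: "clinear_functional_on N \<tau>" and n: "normal_functional N \<tau>"
    using assms(2) by (simp_all add: faithful_normal_tracial_state_def)
  show "clinear_functional_on (Wstar S) \<tau>"
    using l sub by (simp add: clinear_functional_on_def subset_iff)
  obtain x y where xy: "summable (\<lambda>n::nat. (norm (x n))\<^sup>2)" "summable (\<lambda>n. (norm (y n))\<^sup>2)"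
    and s: "\<forall>A\<in>N. (\<lambda>n. cinner (x n) (blinfun_apply A (y n))) sums \<tau> A"
    using n unfolding normal_functional_def by blast
  have "\<forall>A\<in>Wstar S. (\<lambda>n. cinner (x n) (blinfun_apply A (y n))) sums \<tau> A"
    using s sub by (simp add: subset_iff)
  then show "normal_functional (Wstar S) \<tau>"
    unfolding normal_functional_def using xy by blast
  fix A B assume "A \<in> Wstar S"
  then have A: "A \<in> N" using sub by blast
  show "0 \<le> \<tau> A" if "pos_op A"
    using A that assms(2) by (simp add: faithful_normal_tracial_state_def)
  assume "B \<in> Wstar S"
  then have "B \<in> N" using sub by blast
  then show "\<tau> (A o\<^sub>L B) = \<tau> (B o\<^sub>L A)"
    using A assms(2) by (simp add: faithful_normal_tracial_state_def)
qed

lemma tracial_algebra_Wstar':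
  assumes "S \<subseteq> bop" "faithful_normal_tracial_state (Wstar S) \<tau>"
  shows "tracial_algebra (Wstar S) \<tau>"
  using assms star_algebra_Wstar[of S] by unfold_locales (auto simp: faithful_normal_tracial_state_def)

sublocale free_langevin \<subseteq> M: tracial_algebra "Wstar (range (Y 0))" \<rho>
  by (rule tracial_algebra_Wstar[OF Mhat]) (use Y_selfadjoint[of 0] in auto)

section \<open>Evaluation at the initial tuple\<close>

context free_langevin
begin

lemma Y0_mem: "Y 0 i \<in> M"
  using star_algebra_Wstar(2)[of "range (Y 0)"] Y_selfadjoint[of 0] Mhat by (auto simp: von_neumann_algebra_def)

lemma word_mem: "word_op (Y 0) w \<in> M"
  by (rule word_op_mem[OF M.tracial_algebra_axioms]) (rule Y0_mem)

lemma adj_word: "adj (word_op (Y 0) w) = word_op (Y 0) (rev w)"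
  by (induction w)
    (simp_all add: word_op_Cons word_op_Nil word_op_append adj_compose M.mem_bop Y0_mem word_mem Y_selfadjoint[of 0, simplified])

lemma ev_mem: "ev p \<in> M"
  unfolding eval_poly_eq by (rule M.op_eval_mem) (rule word_mem)

lemma ev_mult: "ev (p * q) = ev p o\<^sub>L ev q"
  unfolding eval_poly_eq by (rule M.op_eval_mult) (simp_all add: word_mem plus_list_def word_op_append)

lemma ev_star: "ev (pstar p) = adj (ev p)"
  unfolding eval_poly_eq by (rule M.op_eval_adj) (simp_all add: word_mem slin_pstar adj_word)

lemma ev_basis [simp]: "ev (basis_elt w) = word_op (Y 0) w"
  by (simp add: eval_poly_eq)

lemma flin_law: "flin \<omega>"
  using M.flin_op_eval[of "word_op (Y 0)", OF word_mem M.mem_id] by (simp add: law_def[abs_def] eval_poly_eq)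

end

sublocale free_langevin_semigroup \<subseteq> Me: tracial_algebra "env_algebra opt (Wstar (range (Y 0)))" \<omega>e
  using omega_e(1) unfolding env_algebra_def
  by (intro tracial_algebra_Wstar') (auto intro!: opt_bop[OF tensor] M.mem_bop)

section \<open>Evaluation in the enveloping algebra\<close>

context free_langevin_semigroup
begin

lemma opt_mem: "A \<in> M \<Longrightarrow> B \<in> M \<Longrightarrow> opt A B \<in> Me"
  using star_algebra_Wstar(2)[of "{opt A B | A B. A \<in> M \<and> B \<in> M}"]
  unfolding env_algebra_def by (auto intro!: opt_bop[OF tensor] M.mem_bop)

abbreviation bi_op :: "'m biword \<Rightarrow> 'k oper" where
  "bi_op \<equiv> (\<lambda>x. case x of BiWord u v \<Rightarrow> opt (word_op (Y 0) u) (word_op (Y 0) v))"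

lemma bi_op_mem: "bi_op x \<in> Me"
  by (cases x) (simp add: opt_mem word_mem)

lemma eve_mem: "eve z \<in> Me"
  unfolding eval_env_eq by (rule Me.op_eval_mem) (rule bi_op_mem)

lemma eve_mult: "eve (x * y) = eve x o\<^sub>L eve y"
  unfolding eval_env_eq
proof (rule Me.op_eval_mult)
  show "bi_op (u + v) = bi_op u o\<^sub>L bi_op v" for u v
    by (cases u; cases v) (simp add: opt_compose[OF tensor] M.mem_bop word_mem word_op_append)
qed (rule bi_op_mem)

lemma eve_star: "eve (estar z) = adj (eve z)"
  unfolding eval_env_eq
proof (rule Me.op_eval_adj)
  show "op_eval bi_op (estar (basis_elt w)) = adj (bi_op w)" for w
    by (cases w) (simp add: adj_opt[OF tensor] M.mem_bop word_mem adj_word)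
qed (simp_all add: bi_op_mem slin_estar)

sublocale polynomial_trace \<omega> V "\<lambda>w. \<Lambda> (word_op (Y 0) w)"
proof
  show "\<omega> (basis_elt (u @ v)) = \<omega> (basis_elt (v @ u))" for u v
    by (simp add: law_def word_op_append M.trace word_mem)
  show "\<omega> (basis_elt (rev u @ v)) = cinner (\<Lambda> (word_op (Y 0) u)) (\<Lambda> (word_op (Y 0) v))" for u v
    using L2_omega by (simp add: law_def word_op_append adj_word[symmetric] is_L2_def word_mem)
qed (simp_all add: flin_add[OF flin_law] flin_scale[OF flin_law] V_selfadjoint)

section \<open>Inner products of polynomials and invariance of the state\<close>

lemma cinner_\<Lambda>: "A \<in> M \<Longrightarrow> B \<in> M \<Longrightarrow> cinner (\<Lambda> A) (\<Lambda> B) = \<rho> (adj A o\<^sub>L B)"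
  using L2_omega by (simp add: is_L2_def)

lemma cinner_\<iota>: "cinner (\<iota> p) (\<iota> q) = \<omega> (pstar p * q)"
  by (simp add: cinner_\<Lambda> ev_mem law_def ev_mult ev_star)

lemma \<iota>_diff: "\<iota> (p - q) = \<iota> p - \<iota> q"
proof -
  have "\<iota> (p - q + q) = \<iota> (p - q) + \<iota> q"
    using L2_omega by (simp only: is_L2_def eval_poly_eq oslin_add[OF oslin_op_eval])
      (simp add: eval_poly_eq[symmetric] ev_mem)
  then show ?thesis by simp
qed

lemma generator_unique:
  assumes "(x, y) \<in> L2_generator T2" "(x, y') \<in> L2_generator T2"
  shows "y = y'"
proof -
  let ?q = "\<lambda>t. complex_of_real (1 / t) *\<^sub>C (T2 t x - x)"
  have "(?q \<longlongrightarrow> y) (at_right 0)" "(?q \<longlongrightarrow> y') (at_right 0)"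
    using assms unfolding generator_def by (simp_all add: tendsto_norm_zero_iff LIM_zero_iff del: of_real_divide)
  then show ?thesis by (intro tendsto_unique[OF _ , of "at_right 0" ?q]) auto
qed

text \<open>Symmetry and \<open>T2 t 1 = 1\<close> make the state invariant.\<close>

lemma law_gen_poly: "\<omega> (gen_poly \<omega> V a) = 0"
proof -
  let ?q = "\<lambda>t. complex_of_real (1 / t) *\<^sub>C (T2 t (\<iota> a) - \<iota> a)" and ?e = "\<Lambda> id_blinfun"
  have "(?q \<longlongrightarrow> \<iota> (gen_poly \<omega> V a)) (at_right 0)"
    using generator_on_polynomials[of a] unfolding generator_def
    by (simp add: tendsto_norm_zero_iff LIM_zero_iff del: of_real_divide)
  then have "((\<lambda>t. cinner ?e (?q t)) \<longlongrightarrow> cinner ?e (\<iota> (gen_poly \<omega> V a))) (at_right 0)"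
    by (rule bounded_linear.tendsto[OF bounded_linear_cinner_right])
  moreover have "cinner ?e (?q t) = 0" if "0 < t" for t
  proof -
    have "T2 t ?e = ?e" using that by (simp add: T2(3) M.mem_id Tinf(3))
    then have "cinner ?e (T2 t (\<iota> a)) = cinner ?e (\<iota> a)" using symmetric[of t ?e "\<iota> a"] that by simp
    then show ?thesis by (simp add: cinner_scaleC_right cinner_diff_right)
  qed
  then have "((\<lambda>t. cinner ?e (?q t)) \<longlongrightarrow> 0) (at_right 0)"
    by (intro tendsto_eventually) (auto simp: eventually_at_right_less intro!: eventually_mono[OF eventually_at_right_less])
  ultimately have "cinner ?e (\<iota> (gen_poly \<omega> V a)) = 0" by (intro tendsto_unique[of "at_right (0::real)"]) auto
  then show ?thesis by (simp add: cinner_\<Lambda> M.mem_id ev_mem law_def)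
qed

section \<open>The gradient and its energy\<close>

lemma trace_eve: "\<omega>e (eve z) = \<omega> (slice \<omega> z)"
proof (rule flin_eqI[where p=z])
  show "flin (\<lambda>z. \<omega>e (eve z))"
    using Me.flin_op_eval[of bi_op, OF bi_op_mem Me.mem_id] by (simp add: eval_env_eq)
  show "flin (\<lambda>z. \<omega> (slice \<omega> z))" by (rule flin_slin[OF flin_law slin_slice])
  show "\<omega>e (eve (basis_elt w)) = \<omega> (slice \<omega> (basis_elt w))" for w
    by (cases w) (simp add: eval_env_eq omega_e(2) word_mem flin_scale[OF flin_law], simp add: law_def)
qed

abbreviation gradient :: "'m ncpoly \<Rightarrow> 'le ^ 'm" where
  "gradient a \<equiv> \<chi> i. \<Lambda>e (eve (grad a i))"

lemma gradient_diff: "gradient (p - q) = gradient p - gradient q"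
proof -
  have "\<Lambda>e (eve (grad (p - q) i)) + \<Lambda>e (eve (grad q i)) = \<Lambda>e (eve (grad p i))" for i
  proof -
    have "grad p i = grad (p - q) i + grad q i"
      by (simp add: grad_def slin_diff[OF slin_fdq])
    then have "eve (grad p i) = eve (grad (p - q) i) + eve (grad q i)"
      by (simp add: eval_env_eq oslin_add[OF oslin_op_eval])
    then show ?thesis using L2_omega_e by (simp add: is_L2_def eve_mem)
  qed
  then show ?thesis by (simp add: vec_eq_iff eq_diff_eq)
qed

text \<open>Since \<open>\<omega>e\<close> is \<omega> after slicing, the squared norm is \<omega>
  of the carre du champ of p; invariance removes the generator applied to p^* p and leaves the
  Dirichlet form.\<close>

lemma norm_gradient:
  "complex_of_real ((norm (gradient p))\<^sup>2)
    = - (cinner (\<iota> p) (\<iota> (gen_poly \<omega> V p)) + cinner (\<iota> (gen_poly \<omega> V p)) (\<iota> p)) / 2"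
proof -
  have "complex_of_real ((norm (gradient p))\<^sup>2) = (\<Sum>i\<in>UNIV. cinner (\<Lambda>e (eve (grad p i))) (\<Lambda>e (eve (grad p i))))"
    by (simp add: norm_vec_def L2_set_def sum_nonneg cinner_self)
  also have "\<dots> = (\<Sum>i\<in>UNIV. \<omega>e (eve (estar (grad p i) * grad p i)))"
    using L2_omega_e by (simp add: is_L2_def eve_mem eve_mult eve_star)
  also have "\<dots> = \<omega> (slice \<omega> (Gamma_t_poly p p))"
    unfolding trace_eve by (simp add: Gamma_t_poly_def edot_def slin_sum[OF slin_slice] flin_sum[OF flin_law])
  also have "\<dots> = \<omega> (Gamma_poly \<omega> V p p)" by (simp add: Gamma_slice)
  also have "\<dots> = - (\<omega> (pstar p * gen_poly \<omega> V p) + \<omega> (pstar (gen_poly \<omega> V p) * p)) / 2"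
  proof -
    have d: "\<omega> (x - y) = \<omega> x - \<omega> y" for x y
      using flin_add[OF flin_law, of "x - y" y] by simp
    show ?thesis by (simp add: Gamma_poly_def flin_scale[OF flin_law] d law_gen_poly)
  qed
  finally show ?thesis by (simp add: cinner_\<iota>)
qed

section \<open>The square root of minus the generator\<close>

lemma R_selfadjoint: "R = adjoint_graph R"
  using R_sqrt by (simp add: sqrt_of_minus_def nonneg_selfadjoint_def)

text \<open>A graph of the form \<open>adjoint_graph\<close> is a linear subspace.\<close>

lemma R_diff:
  assumes "(x, y) \<in> R" "(x', y') \<in> R"
  shows "(x - x', y - y') \<in> R"
  using assms by (subst R_selfadjoint, subst (asm) (1 2) R_selfadjoint)
    (auto simp: adjoint_graph_def cinner_diff_right split: prod.splits)

lemma R_symmetric: "(x, y) \<in> R \<Longrightarrow> (x', y') \<in> R \<Longrightarrow> cinner y x' = cinner x y'"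
  using R_selfadjoint unfolding adjoint_graph_def by blast

text \<open>By symmetry the squared norm of y is the inner product of the class of p with z, and z
  is minus the generator at p. Uniqueness of the generator identifies it with the polynomial formula
  in \<open>norm_gradient\<close>.\<close>

lemma norm_gradient_R:
  assumes xy: "(\<iota> p, y) \<in> R" and yz: "(y, z) \<in> R"
  shows "norm (gradient p) = norm y"
proof -
  have "(\<iota> p, z) \<in> R O R" using assms by blast
  then have "(\<iota> p, - z) \<in> L2_generator T2"
    using R_sqrt unfolding sqrt_of_minus_def by auto
  then have z: "\<iota> (gen_poly \<omega> V p) = - z" using generator_unique generator_on_polynomials by blast
  have 1: "cinner (\<iota> p) z = cinner y y" using R_symmetric[OF xy yz] by simp
  then have 2: "cinner z (\<iota> p) = cinner y y" by (metis cinner_commute)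
  have "complex_of_real ((norm (gradient p))\<^sup>2) = complex_of_real ((norm y)\<^sup>2)"
    unfolding norm_gradient z cinner_minus_right cinner_minus_left 1 2 cinner_self by simp
  then have "(norm (gradient p))\<^sup>2 = (norm y)\<^sup>2" using of_real_eq_iff by blast
  then show ?thesis by (simp add: power2_eq_iff_nonneg)
qed

text \<open>For x = \<open>\<iota> p\<close> with R x = y, R y = z, R z = w, symmetry and
  Cauchy-Schwarz give |y|^2 \<le> |x| |z| and |z|^2 \<le> |y| |w|. Eliminating z gives |y|^4 \<le>
  |x|^2 |y| |w|, from which one factor |y| is cancelled.\<close>

lemma gradient_interpolation:
  assumes "(\<iota> p, w) \<in> cube R"
  shows "norm (gradient p) ^ 3 \<le> (norm (\<iota> p))\<^sup>2 * norm w"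
proof -
  obtain y z where R: "(\<iota> p, y) \<in> R" "(y, z) \<in> R" "(z, w) \<in> R" using assms by blast
  let ?a = "norm (\<iota> p)" and ?b = "norm y" and ?c = "norm z" and ?d = "norm w"
  have 1: "?b\<^sup>2 \<le> ?a * ?c"
  proof -
    have "cinner y y = cinner (\<iota> p) z" using R by (intro R_symmetric)
    then have "?b\<^sup>2 = cmod (cinner (\<iota> p) z)" by (metis cinner_self norm_of_real abs_power2)
    then show ?thesis by (simp add: norm_cinner)
  qed
  have 2: "?c\<^sup>2 \<le> ?b * ?d"
  proof -
    have "cinner z z = cinner y w" using R by (intro R_symmetric)
    then have "?c\<^sup>2 = cmod (cinner y w)" by (metis cinner_self norm_of_real abs_power2)
    then show ?thesis by (simp add: norm_cinner)
  qed
  have "?b * ?b ^ 3 = (?b\<^sup>2)\<^sup>2" by (simp add: power2_eq_square power3_eq_cube)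
  also have "\<dots> \<le> (?a * ?c)\<^sup>2" by (intro power_mono 1) simp
  also have "\<dots> = ?a\<^sup>2 * ?c\<^sup>2" by (simp add: power_mult_distrib)
  also have "\<dots> \<le> ?a\<^sup>2 * (?b * ?d)" by (intro mult_left_mono 2) simp
  also have "\<dots> = ?b * (?a\<^sup>2 * ?d)" by simp
  finally have "?b ^ 3 \<le> ?a\<^sup>2 * ?d"
    by (cases "?b = 0") (simp_all add: mult_le_cancel_left_pos)
  then show ?thesis using norm_gradient_R[OF R(1,2)] by simp
qed

text \<open>By \<open>gradient_interpolation\<close>, convergence in the graph norm of \<open>R\<^sup>3\<close> makes the gradients Cauchy.\<close>

lemma polynomial_approximation:
  assumes a: "a \<in> Domain (cube R)"
  shows "\<exists>p. graph_tendsto (cube R) (\<lambda>n. \<iota> (p n)) a \<and> graph_tendsto nabla_bar (\<lambda>n. \<iota> (p n)) a"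
proof -
  obtain w0 where w0: "(a, w0) \<in> cube R" using a by blast
  then have "(a, w0) \<in> closure {(x, y) \<in> cube R. x \<in> range \<iota>}" using core(2) by blast
  then obtain s where s: "\<And>n. s n \<in> {(x, y) \<in> cube R. x \<in> range \<iota>}" and lim: "s \<longlonglongrightarrow> (a, w0)"
    unfolding closure_sequential by blast
  have "\<exists>p. fst (s n) = \<iota> p" for n using s[of n] by auto
  then obtain p where p: "\<And>n. fst (s n) = \<iota> (p n)" by metis
  define w where "w n = snd (s n)" for n
  have sw: "s n = (\<iota> (p n), w n)" for n by (simp add: p[symmetric] w_def)
  have cube: "(\<iota> (p n), w n) \<in> cube R" for n using s[of n] by (simp add: sw)
  have p_lim: "(\<lambda>n. \<iota> (p n)) \<longlonglongrightarrow> a" using tendsto_fst[OF lim] by (simp add: sw)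
  have w_lim: "w \<longlonglongrightarrow> w0" using tendsto_snd[OF lim] by (simp add: sw)
  have "Cauchy (\<lambda>n. gradient (p n))"
  proof (rule metric_CauchyI)
    fix e :: real assume e: "0 < e"
    obtain N1 where N1: "\<And>m n. m \<ge> N1 \<Longrightarrow> n \<ge> N1 \<Longrightarrow> dist (\<iota> (p m)) (\<iota> (p n)) < e"
      using metric_CauchyD[OF LIMSEQ_imp_Cauchy[OF p_lim] e] by blast
    obtain N2 where N2: "\<And>m n. m \<ge> N2 \<Longrightarrow> n \<ge> N2 \<Longrightarrow> dist (w m) (w n) < e"
      using metric_CauchyD[OF LIMSEQ_imp_Cauchy[OF w_lim] e] by blast
    have "dist (gradient (p m)) (gradient (p n)) < e" if mn: "m \<ge> max N1 N2" "n \<ge> max N1 N2" for m n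
    proof -
      \<comment> \<open>Differences of polynomials are polynomials, so the interpolation applies to
        them; the bounds \<open>e\<^sup>2\<close> and e on the two factors multiply to the cube of
        e.\<close>
      have "(\<iota> (p m - p n), w m - w n) \<in> cube R"
        using cube[of m] cube[of n] R_diff unfolding \<iota>_diff by (meson relcomp.cases relcomp.relcompI)
      then have "norm (gradient (p m - p n)) ^ 3 \<le> (norm (\<iota> (p m - p n)))\<^sup>2 * norm (w m - w n)"
        by (rule gradient_interpolation)
      also have "\<dots> \<le> e\<^sup>2 * norm (w m - w n)"
        using N1[of m n] mn by (intro mult_right_mono power_mono) (simp_all add: \<iota>_diff dist_norm)
      also have "\<dots> < e\<^sup>2 * e"
        using N2[of m n] mn e by (intro mult_strict_left_mono) (simp_all add: dist_norm)
      also have "\<dots> = e ^ 3" by (simp add: power2_eq_square power3_eq_cube)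
      finally have "norm (gradient (p m - p n)) < e"
        using e by (meson less_imp_le power_less_imp_less_base)
      then show ?thesis by (simp add: dist_norm gradient_diff)
    qed
    then show "\<exists>M. \<forall>m\<ge>M. \<forall>n\<ge>M. dist (gradient (p m)) (gradient (p n)) < e" by blast
  qed
  then obtain g where g: "(\<lambda>n. gradient (p n)) \<longlonglongrightarrow> g" using Cauchy_convergent_iff convergent_def by blast
  have mem: "(\<iota> (p n), gradient (p n)) \<in> nabla_bar" for n
    unfolding nabla_bar_def by (rule subsetD[OF closure_subset]) auto
  have "(a, g) \<in> nabla_bar"
  proof (rule closed_sequentially)
    show "closed nabla_bar" by (simp add: nabla_bar_def)
    show "(\<lambda>n. (\<iota> (p n), gradient (p n))) \<longlonglongrightarrow> (a, g)" by (intro tendsto_Pair p_lim g)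
  qed (rule mem)
  then have "graph_tendsto nabla_bar (\<lambda>n. \<iota> (p n)) a"
    unfolding graph_tendsto_def
    by (intro exI[of _ "\<lambda>n. gradient (p n)"] exI[of _ g]) (simp add: mem g p_lim)
  moreover have "graph_tendsto (cube R) (\<lambda>n. \<iota> (p n)) a"
    unfolding graph_tendsto_def
    by (intro exI[of _ w] exI[of _ w0] conjI allI cube w0 w_lim p_lim)
  ultimately show ?thesis by blast
qed

section \<open>The two inequalities on polynomials\<close>

lemma fully_convex_polynomials:
  assumes conv: "fully_convex opt (Y 0) V K" and B: "B \<in> Me" "pos_op B"
  shows "0 \<le> \<omega>e (eve (Gamma2_t_poly \<omega> V p p) o\<^sub>L B) - of_real K * \<omega>e (eve (Gamma_t_poly p p) o\<^sub>L B)"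
proof -
  define \<psi> where "\<psi> z = \<omega>e (eve z o\<^sub>L B)" for z
  have \<psi>: "flin \<psi>" unfolding \<psi>_def eval_env_eq by (rule Me.flin_op_eval[of bi_op, OF bi_op_mem B(1)])
  have "0 \<le> \<psi> (Gamma2_t_poly \<omega> V p p - pscale (of_real K) (Gamma_t_poly p p))"
  proof (rule bochner_nonneg[OF \<psi>])
    show "0 \<le> \<psi> (estar z * z)" for z
      unfolding \<psi>_def eve_mult eve_star by (rule Me.tau_sandwich[OF eve_mem B])
    \<comment> \<open>Convexity makes the Hessian term a positive operator without presenting it as
      a square, hence the trace inequality for a product of two positive operators.\<close>
    show "0 \<le> \<psi> (Q_form V K (grad p))"
      using conv unfolding \<psi>_def fully_convex_def by (intro Me.tau_pos_mult eve_mem B) blast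
  qed
  moreover have "\<psi> (x - pscale c y) = \<psi> x - c * \<psi> y" for x y c
    using flin_add[OF \<psi>, of "x - pscale c y" "pscale c y"] by (simp add: flin_scale[OF \<psi>])
  ultimately show ?thesis by (simp add: \<psi>_def)
qed

text \<open>The test functional is the trace against B composed with the slice map. It turns the
  tilded forms into the untilded ones, by \<open>Gamma_slice\<close> and
  \<open>Gamma2_slice\<close>, and the Hessian term into what partial convexity controls.\<close>

lemma partially_convex_polynomials:
  assumes conv: "partially_convex \<rho> (Y 0) V K" and B: "B \<in> M" "pos_op B"
  shows "0 \<le> \<rho> (ev (Gamma2_poly \<omega> V p p) o\<^sub>L B) - of_real K * \<rho> (ev (Gamma_poly \<omega> V p p) o\<^sub>L B)"
proof -
  define \<phi> where "\<phi> q = \<rho> (ev q o\<^sub>L B)" for q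
  have \<phi>: "flin \<phi>" unfolding \<phi>_def eval_poly_eq by (rule M.flin_op_eval[of "word_op (Y 0)", OF word_mem B(1)])
  have \<phi>_pos: "0 \<le> \<phi> (pstar q * q)" for q
    unfolding \<phi>_def ev_mult ev_star by (rule M.tau_sandwich[OF ev_mem B])
  define \<psi> where "\<psi> z = \<phi> (slice \<omega> z)" for z
  have \<psi>: "flin \<psi>" unfolding \<psi>_def by (rule flin_slin[OF \<phi> slin_slice])
  have "0 \<le> \<psi> (Gamma2_t_poly \<omega> V p p - pscale (of_real K) (Gamma_t_poly p p))"
  proof (rule bochner_nonneg[OF \<psi>])
    show "0 \<le> \<psi> (estar z * z)" for z
      unfolding \<psi>_def by (rule slice_positive[OF \<phi> \<phi>_pos])
    show "0 \<le> \<psi> (Q_form V K (grad p))"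
      using conv unfolding \<psi>_def \<phi>_def partially_convex_def by (intro M.tau_pos_mult ev_mem B) blast
  qed
  moreover have "\<psi> (x - pscale c y) = \<psi> x - c * \<psi> y" for x y c
    using flin_add[OF \<psi>, of "x - pscale c y" "pscale c y"] by (simp add: flin_scale[OF \<psi>])
  ultimately show ?thesis
    by (simp add: \<psi>_def \<phi>_def Gamma_slice[symmetric] Gamma2_slice[OF law_gen_poly, symmetric])
qed

end

theorem proposition5p22:
  fixes Mhat :: "'h::chilbert oper set"
    and \<rho> :: "'h oper \<Rightarrow> complex"
    and V :: "'m::finite ncpoly"
    and X Y :: "real \<Rightarrow> 'm \<Rightarrow> 'h oper"
    and E0 :: "'h oper \<Rightarrow> 'h oper"
    and tens :: "'h \<Rightarrow> 'h \<Rightarrow> 'k::chilbert"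
    and opt :: "'h oper \<Rightarrow> 'h oper \<Rightarrow> 'k oper"
    and \<omega>e :: "'k oper \<Rightarrow> complex"
    and \<Lambda> :: "'h oper \<Rightarrow> 'l::chilbert"
    and \<Lambda>e :: "'k oper \<Rightarrow> 'le::chilbert"
    and Tinf :: "real \<Rightarrow> 'h oper \<Rightarrow> 'h oper"
    and T2 :: "real \<Rightarrow> 'l \<Rightarrow> 'l"
    and T1 :: "real \<Rightarrow> ('h oper \<Rightarrow> complex) \<Rightarrow> ('h oper \<Rightarrow> complex)"
    and T1e :: "real \<Rightarrow> ('k oper \<Rightarrow> complex) \<Rightarrow> ('k oper \<Rightarrow> complex)"
    and R :: "('l \<times> 'l) set"
    and \<Gamma> \<Gamma>2 :: "'l \<Rightarrow> 'l \<Rightarrow> ('h oper \<Rightarrow> complex)"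
    and \<Gamma>t \<Gamma>t2 :: "'l \<Rightarrow> 'l \<Rightarrow> ('k oper \<Rightarrow> complex)"
    and K :: real
  assumes "free_langevin_carre_du_champ Mhat \<rho> V X Y E0 tens opt \<omega>e \<Lambda> \<Lambda>e Tinf T2 T1 T1e R \<Gamma> \<Gamma>2 \<Gamma>t \<Gamma>t2"
    and "0 \<le> K"
  shows "(fully_convex opt (Y 0) V K \<longrightarrow>
            (\<forall>a\<in>Domain (cube R).
               L1_le (env_algebra opt (Wstar (range (Y 0)))) (fscale (complex_of_real K) (\<Gamma>t a a)) (\<Gamma>t2 a a))) \<and>
         (partially_convex \<rho> (Y 0) V K \<longrightarrow>
            (\<forall>a\<in>Domain (cube R).
               L1_le (Wstar (range (Y 0))) (fscale (complex_of_real K) (\<Gamma> a a)) (\<Gamma>2 a a)))"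
proof -
  interpret free_langevin_carre_du_champ Mhat \<rho> V X Y E0 tens opt \<omega>e \<Lambda> \<Lambda>e Tinf T2 T1 T1e R \<Gamma> \<Gamma>2 \<Gamma>t \<Gamma>t2
    by (rule assms(1))
  have "L1_le Me (fscale (complex_of_real K) (\<Gamma>t a a)) (\<Gamma>t2 a a)"
    if conv: "fully_convex opt (Y 0) V K" and a: "a \<in> Domain (cube R)" for a
  proof -
    obtain p where p: "graph_tendsto (cube R) (\<lambda>n. \<iota> (p n)) a" "graph_tendsto nabla_bar (\<lambda>n. \<iota> (p n)) a"
      using polynomial_approximation[OF a] by blast
    show ?thesis
      by (rule Me.L1_le_extension[OF \<Gamma>t_ext \<Gamma>t2_ext p(2) p(1)]) (rule fully_convex_polynomials[OF conv])
  qed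
  moreover have "L1_le M (fscale (complex_of_real K) (\<Gamma> a a)) (\<Gamma>2 a a)"
    if conv: "partially_convex \<rho> (Y 0) V K" and a: "a \<in> Domain (cube R)" for a
  proof -
    obtain p where p: "graph_tendsto (cube R) (\<lambda>n. \<iota> (p n)) a" "graph_tendsto nabla_bar (\<lambda>n. \<iota> (p n)) a"
      using polynomial_approximation[OF a] by blast
    show ?thesis
      by (rule M.L1_le_extension[OF \<Gamma>_ext \<Gamma>2_ext p(2) p(1)]) (rule partially_convex_polynomials[OF conv])
  qed
  ultimately show ?thesis by blast
qed

end
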